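(* Let $A=\mathbb{K}[X_1][X_2;\sigma_2,\delta_2]\cdots[X_N;\sigma_N,\delta_N]$ be a quantum nilpotent algebra (see context), $F=\mathrm{Frac}(A)$, and fix $j\in[\![2,N]\!]$. Let $(x_1,\dots,x_N)=(X_1^{(j+1)},\dots,X_N^{(j+1)})$ be the sequence of elements of $F$ given by the algorithm described in the context, let $A^{(j+1)}=\mathbb{K}\langle x_1,\dots,x_N\rangle\subseteq F$, and assume: (a) there is a $\mathbb{K}$-algebra isomorphism $A^{(j+1)}\cong\mathbb{K}[X_1]\cdots[X_j;\sigma_j,\delta_j][X_{j+1};\sigma_{j+1}^{(j+1)}]\cdots[X_N;\sigma_N^{(j+1)}]$ sending $x_i$ to $X_i$ for all $i\in[\![1,N]\!]$; (b) for each $i\in[\![j+1,N]\!]$, $\sigma_i^{(j+1)}$ is an automorphism with $\sigma_i^{(j+1)}(X_l)=\lambda_{i,l}X_l$ for all $l\in[\![1,i-1]\!]$, and $\sigma_i^{(j+1)}\circ d_{l,n}=\lambda_{i,l}^n\,d_{l,n}\circ\sigma_i^{(j+1)}$ for all $l\in[\![2,j]\!]$ and $n\ge0$. Define $y_1,\dots,y_N\in F$ by $y_l=x_l$ for $l\ge j$ and $$y_l=\sum_{n=0}^{\infty}q_j^{\frac{n(n+1)}{2}}(q_j-1)^{-n}\,d_{j,n}\circ\sigma_j^{-n}(x_l)\,x_j^{-n}\qquad(l<j),$$ and let $A^{(j)}=\mathbb{K}\langle y_1,\dots,y_N\rangle\subseteq F$. Then: (I) $A^{(j)}\cong\mathbb{K}[X_1][X_2;\sigma_2,\delta_2]\cdots[X_{j-1};\sigma_{j-1},\delta_{j-1}][X_j;\sigma_j^{(j)}]\cdots[X_N;\sigma_N^{(j)}]$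 by an isomorphism sending $y_l$ to $X_l$ for all $l\in[\![1,N]\!]$. (II) For all $i\in[\![j,N]\!]$ the $\sigma_i^{(j)}$ are automorphisms satisfying: (i) $\sigma_i^{(j)}(X_l)=\lambda_{i,l}X_l$ for all $l\in[\![1,i-1]\!]$; (ii) $\sigma_i^{(j)}\circ d_{l,n}=\lambda_{i,l}^n\,d_{l,n}\circ\sigma_i^{(j)}$ for all $n\ge0$ and $l\in[\![2,j-1]\!]$. (III) $S_j:=\{x_j^n\mid n\ge0\}=\{y_j^n\mid n\ge0\}$ is a multiplicatively closed set of regular elements satisfying the two-sided Ore condition in both $A^{(j+1)}$ and $A^{(j)}$, and $A^{(j)}S_j^{-1}=A^{(j+1)}S_j^{-1}$.
   Context: Notation: $\mathbb{K}$ is a field; $[\![a,b]\!]$ is the set of integers from $a$ to $b$; $\mathbb{K}\langle\cdots\rangle$ denotes the subalgebra generated. Ore extensions: in $R[x;\sigma,\delta]$, $\sigma$ is a $\mathbb{K}$-algebra automorphism of $R$, $\delta$ is a $\mathbb{K}$-linear $\sigma$-derivation, $\delta(ab)=\sigma(a)\delta(b)+\delta(a)b$, and $xr=\sigma(r)x+\delta(r)$; $R[x;\sigma]$ means $\delta=0$. Higher skew derivations: for $1\ne q\in\mathbb{K}^*$, $\delta$ extends to a higher $q$-skew $\sigma$-derivation $\{d_n\}_{n\ge0}$ on $R$ if the $d_n$ are $\mathbb{K}$-linear operators on $R$ with $d_0=\mathrm{id}$, $d_1=\delta$, $d_n(rs)=\sum_{i=0}^n\sigma^{n-i}d_i(r)\,d_{n-i}(s)$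 and $d_n\circ\sigma=q^n\sigma\circ d_n$ for all $n$. It is locally nilpotent if for each $r\in R$ there is $n_r\ge0$ with $d_n(r)=0$ for all $n\ge n_r$, and iterative if $d_nd_m=\binom{n+m}{m}_q d_{n+m}$ for all $n,m$ ($q$-Gaussian binomial coefficients). Quantum nilpotent algebra: $A=\mathbb{K}[X_1][X_2;\sigma_2,\delta_2]\cdots[X_N;\sigma_N,\delta_N]$ with $A_{i}=\mathbb{K}\langle X_1,\dots,X_i\rangle$ such that: (1) $\sigma_i(X_l)=\lambda_{i,l}X_l$ for $l<i$, $\lambda_{i,l}\in\mathbb{K}^*$; (2) $\Lambda=(\lambda_{i,j})\in M_N(\mathbb{K}^* )$ is multiplicatively antisymmetric ($\lambda_{i,l}=\lambda_{l,i}^{-1}$, $\lambda_{i,i}=1$); (3) for $2\le i\le N$ there is $1\ne q_i\in\mathbb{K}^*$ with $\delta_i\circ\sigma_i=q_i\sigma_i\circ\delta_i$; (4) for $2\le i\le N$, $\delta_i$ extends to a (fixed) locally nilpotent, iterative higher $q_i$-skew $\sigma_i$-derivation $\{d_{i,n}\}_{n\ge0}$ on $A_{i-1}$, and $\sigma_l\circ d_{i,n}=\lambda_{l,i}^n d_{i,n}\circ\sigma_l$ on $A_{i-1}$ for all $n\ge0$, $i+1\le l\le N$. Such an $A$ is a Noetherian domain. Algorithm: start with $(X_1^{(N+1)},\dots,X_N^{(N+1)})=(X_1,\dots,X_N)$. For $j=N,N-1,\dots,2$ successively, $(X_1^{(j)},\dots,X_N^{(j)})=(y_1,\dots,y_N)$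 is obtained from $(x_1,\dots,x_N)=(X_1^{(j+1)},\dots,X_N^{(j+1)})$ by the formula displayed in the claim. Via the isomorphism in (a), the maps $\sigma_j$ and $d_{j,n}$ are regarded as maps on $\mathbb{K}\langle x_1,\dots,x_{j-1}\rangle\cong A_{j-1}$ (same action on generators); the sum is finite by local nilpotence. *)

theory Defs
  imports
    "HOL-Algebra.Module"
    "HOL-Algebra.Generated_Rings"
    "HOL-Algebra.QuotRing"
    "HOL-Library.Groups_Big_Fun"
begin

text \<open>The base field is a type \<open>'k\<close> of class \<open>field\<close>.  An algebra over it is a \<open>module\<close> record,
  which is a ring record extended by a scalar multiplication.\<close>

section \<open>Noncommutative algebras\<close>

definition scalars :: "'k::field ring" where
  "scalars = \<lparr>carrier = UNIV, mult = (*), one = 1, zero = 0, add = (+)\<rparr>"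

text \<open>The library locale \<open>algebra\<close> is for commutative rings only.\<close>

definition k_algebra :: "('k::field, 'a) module \<Rightarrow> bool" where
  "k_algebra A \<longleftrightarrow> Module.module scalars A \<and> ring A \<and>
     (\<forall>c. \<forall>a\<in>carrier A. \<forall>b\<in>carrier A.
        (c \<odot>\<^bsub>A\<^esub> a) \<otimes>\<^bsub>A\<^esub> b = c \<odot>\<^bsub>A\<^esub> (a \<otimes>\<^bsub>A\<^esub> b) \<and>
        a \<otimes>\<^bsub>A\<^esub> (c \<odot>\<^bsub>A\<^esub> b) = c \<odot>\<^bsub>A\<^esub> (a \<otimes>\<^bsub>A\<^esub> b))"

definition k_alg_hom :: "('k, 'a) module \<Rightarrow> ('k, 'b) module \<Rightarrow> ('a \<Rightarrow> 'b) set" where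
  "k_alg_hom A B = {h \<in> ring_hom A B. \<forall>c. \<forall>a\<in>carrier A. h (c \<odot>\<^bsub>A\<^esub> a) = c \<odot>\<^bsub>B\<^esub> h a}"

definition k_alg_iso :: "('k, 'a) module \<Rightarrow> ('k, 'b) module \<Rightarrow> ('a \<Rightarrow> 'b) set" where
  "k_alg_iso A B = ring_iso A B \<inter> k_alg_hom A B"

definition k_subalgebra :: "('k::field, 'a) module \<Rightarrow> ('k, 'a) module \<Rightarrow> bool" where
  "k_subalgebra R S \<longleftrightarrow> k_algebra R \<and> k_algebra S \<and> (\<lambda>a. a) \<in> k_alg_hom R S"

text \<open>The subalgebra generated by \<open>G\<close>, as the subring generated by \<open>G\<close> and the scalars.\<close>

definition alg_gen :: "('k, 'a) module \<Rightarrow> 'a set \<Rightarrow> ('k, 'a) module" where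
  "alg_gen A G = A\<lparr>carrier := generate_ring A (G \<union> range (\<lambda>c. c \<odot>\<^bsub>A\<^esub> \<one>\<^bsub>A\<^esub>))\<rparr>"

text \<open>The subalgebra generated by \<open>X\<^sub>1, \<dots>, X\<^sub>i\<close>; for \<open>i = 0\<close> it consists of the scalars.\<close>

abbreviation stage :: "('k, 'a) module \<Rightarrow> (nat \<Rightarrow> 'a) \<Rightarrow> nat \<Rightarrow> ('k, 'a) module" where
  "stage A X i \<equiv> alg_gen A (X ` {1..i})"

definition k_linear_on :: "('k, 'a) module \<Rightarrow> ('a \<Rightarrow> 'a) \<Rightarrow> bool" where
  "k_linear_on R f \<longleftrightarrow> f \<in> carrier R \<rightarrow> carrier R \<and>
     (\<forall>a\<in>carrier R. \<forall>b\<in>carrier R. f (a \<oplus>\<^bsub>R\<^esub> b) = f a \<oplus>\<^bsub>R\<^esub> f b) \<and>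
     (\<forall>c. \<forall>a\<in>carrier R. f (c \<odot>\<^bsub>R\<^esub> a) = c \<odot>\<^bsub>R\<^esub> f a)"


section \<open>Ore extensions\<close>

definition skew_derivation :: "('k, 'a) module \<Rightarrow> ('a \<Rightarrow> 'a) \<Rightarrow> ('a \<Rightarrow> 'a) \<Rightarrow> bool" where
  "skew_derivation R \<sigma> \<delta> \<longleftrightarrow> k_linear_on R \<delta> \<and>
     (\<forall>a\<in>carrier R. \<forall>b\<in>carrier R. \<delta> (a \<otimes>\<^bsub>R\<^esub> b) = \<sigma> a \<otimes>\<^bsub>R\<^esub> \<delta> b \<oplus>\<^bsub>R\<^esub> \<delta> a \<otimes>\<^bsub>R\<^esub> b)"

text \<open>\<open>S = R[x; \<sigma>, \<delta>]\<close>: \<open>S\<close> contains \<open>R\<close> and \<open>x\<close>, is a free left \<open>R\<close>-module with basis the powers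
  of \<open>x\<close>, and \<open>x r = \<sigma>(r) x + \<delta>(r)\<close>.  The maps are relevant on \<open>carrier R\<close> only.\<close>

definition ore_extension ::
  "('k::field, 'a) module \<Rightarrow> ('k, 'a) module \<Rightarrow> 'a \<Rightarrow> ('a \<Rightarrow> 'a) \<Rightarrow> ('a \<Rightarrow> 'a) \<Rightarrow> bool" where
  "ore_extension R S x \<sigma> \<delta> \<longleftrightarrow>
     k_subalgebra R S \<and> \<sigma> \<in> k_alg_iso R R \<and> skew_derivation R \<sigma> \<delta> \<and> x \<in> carrier S \<and>
     (\<forall>r\<in>carrier R. x \<otimes>\<^bsub>S\<^esub> r = \<sigma> r \<otimes>\<^bsub>S\<^esub> x \<oplus>\<^bsub>S\<^esub> \<delta> r) \<and>
     (\<forall>s\<in>carrier S. \<exists>!r :: nat \<Rightarrow> 'a.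
        range r \<subseteq> carrier R \<and> finite {n. r n \<noteq> \<zero>\<^bsub>S\<^esub>} \<and>
        s = (\<Oplus>\<^bsub>S\<^esub>n\<in>{n. r n \<noteq> \<zero>\<^bsub>S\<^esub>}. r n \<otimes>\<^bsub>S\<^esub> x [^]\<^bsub>S\<^esub> n))"

text \<open>\<open>A = K[X\<^sub>1][X\<^sub>2; \<sigma>\<^sub>2, \<delta>\<^sub>2] \<dots> [X\<^sub>N; \<sigma>\<^sub>N, \<delta>\<^sub>N]\<close>.  The first step is stated as
  \<open>K[X\<^sub>1; \<sigma>\<^sub>1, \<delta>\<^sub>1]\<close>; on the scalars an algebra automorphism is the identity and a linear skew
  derivation vanishes, so this is the polynomial ring whatever \<open>\<sigma>\<^sub>1\<close> and \<open>\<delta>\<^sub>1\<close> are.\<close>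

definition iterated_ore_extension ::
  "nat \<Rightarrow> ('k::field, 'a) module \<Rightarrow> (nat \<Rightarrow> 'a) \<Rightarrow> (nat \<Rightarrow> 'a \<Rightarrow> 'a) \<Rightarrow> (nat \<Rightarrow> 'a \<Rightarrow> 'a) \<Rightarrow> bool" where
  "iterated_ore_extension N A X \<sigma> \<delta> \<longleftrightarrow>
     k_algebra A \<and> \<one>\<^bsub>A\<^esub> \<noteq> \<zero>\<^bsub>A\<^esub> \<and> X ` {1..N} \<subseteq> carrier A \<and> carrier A = carrier (stage A X N) \<and>
     (\<forall>i\<in>{1..N}. ore_extension (stage A X (i - 1)) (stage A X i) (X i) (\<sigma> i) (\<delta> i))"

text \<open>\<open>B = K[X\<^sub>1] \<dots> [X\<^sub>m; \<sigma>\<^sub>m, \<delta>\<^sub>m][Z\<^sub>m\<^sub>+\<^sub>1; \<tau>\<^sub>m\<^sub>+\<^sub>1] \<dots> [Z\<^sub>N; \<tau>\<^sub>N]\<close>, where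
  \<open>A = K[X\<^sub>1] \<dots> [X\<^sub>N; \<sigma>\<^sub>N, \<delta>\<^sub>N]\<close>.  The first \<open>m\<close> steps of both constructions are the same algebra.
  For \<open>i > m\<close> the variable \<open>Z\<^sub>i\<close> is a new one, since \<open>A\<close> and \<open>B\<close> have different
  multiplications.\<close>

definition skew_tail_extension ::
  "nat \<Rightarrow> ('k::field, 'a) module \<Rightarrow> (nat \<Rightarrow> 'a) \<Rightarrow> (nat \<Rightarrow> 'a \<Rightarrow> 'a) \<Rightarrow> (nat \<Rightarrow> 'a \<Rightarrow> 'a) \<Rightarrow>
   nat \<Rightarrow> ('k, 'a) module \<Rightarrow> (nat \<Rightarrow> 'a) \<Rightarrow> (nat \<Rightarrow> 'a \<Rightarrow> 'a) \<Rightarrow> bool" where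
  "skew_tail_extension N A X \<sigma> \<delta> m B Z \<tau> \<longleftrightarrow>
     k_subalgebra (stage A X m) B \<and> (\<forall>l\<in>{1..m}. Z l = X l) \<and>
     iterated_ore_extension N B Z
       (\<lambda>i. if i \<le> m then \<sigma> i else \<tau> i)
       (\<lambda>i. if i \<le> m then \<delta> i else (\<lambda>_. \<zero>\<^bsub>B\<^esub>))"


section \<open>Higher skew derivations\<close>

text \<open>Gaussian binomial coefficients by the \<open>q\<close>-Pascal rule, so that they are also the right ones
  when \<open>q\<close> is a root of unity and \<open>q\<close>-factorials vanish.\<close>

fun q_binomial :: "'k::field \<Rightarrow> nat \<Rightarrow> nat \<Rightarrow> 'k" where
  "q_binomial q n 0 = 1"
| "q_binomial q 0 (Suc k) = 0"
| "q_binomial q (Suc n) (Suc k) = q_binomial q n k + q ^ Suc k * q_binomial q n (Suc k)"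

definition higher_skew_derivation ::
  "('k::field, 'a) module \<Rightarrow> 'k \<Rightarrow> ('a \<Rightarrow> 'a) \<Rightarrow> ('a \<Rightarrow> 'a) \<Rightarrow> (nat \<Rightarrow> 'a \<Rightarrow> 'a) \<Rightarrow> bool" where
  "higher_skew_derivation R q \<sigma> \<delta> d \<longleftrightarrow>
     (\<forall>n. k_linear_on R (d n)) \<and>
     (\<forall>r\<in>carrier R. d 0 r = r) \<and>
     (\<forall>r\<in>carrier R. d 1 r = \<delta> r) \<and>
     (\<forall>n. \<forall>r\<in>carrier R. \<forall>s\<in>carrier R.
        d n (r \<otimes>\<^bsub>R\<^esub> s) = (\<Oplus>\<^bsub>R\<^esub>i\<in>{0..n}. (\<sigma> ^^ (n - i)) (d i r) \<otimes>\<^bsub>R\<^esub> d (n - i) s)) \<and>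
     (\<forall>n. \<forall>r\<in>carrier R. d n (\<sigma> r) = q ^ n \<odot>\<^bsub>R\<^esub> \<sigma> (d n r))"

definition locally_nilpotent :: "('k, 'a) module \<Rightarrow> (nat \<Rightarrow> 'a \<Rightarrow> 'a) \<Rightarrow> bool" where
  "locally_nilpotent R d \<longleftrightarrow> (\<forall>r\<in>carrier R. \<exists>n0. \<forall>n\<ge>n0. d n r = \<zero>\<^bsub>R\<^esub>)"

definition iterative :: "('k::field, 'a) module \<Rightarrow> 'k \<Rightarrow> (nat \<Rightarrow> 'a \<Rightarrow> 'a) \<Rightarrow> bool" where
  "iterative R q d \<longleftrightarrow>
     (\<forall>n m. \<forall>r\<in>carrier R. d n (d m r) = q_binomial q (n + m) m \<odot>\<^bsub>R\<^esub> d (n + m) r)"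


section \<open>Quantum nilpotent algebras\<close>

definition quantum_nilpotent_algebra ::
  "nat \<Rightarrow> ('k::field, 'a) module \<Rightarrow> (nat \<Rightarrow> 'a) \<Rightarrow> (nat \<Rightarrow> 'a \<Rightarrow> 'a) \<Rightarrow> (nat \<Rightarrow> 'a \<Rightarrow> 'a) \<Rightarrow>
   (nat \<Rightarrow> nat \<Rightarrow> 'k) \<Rightarrow> (nat \<Rightarrow> 'k) \<Rightarrow> (nat \<Rightarrow> nat \<Rightarrow> 'a \<Rightarrow> 'a) \<Rightarrow> bool" where
  "quantum_nilpotent_algebra N A X \<sigma> \<delta> \<Lambda> q d \<longleftrightarrow>
     iterated_ore_extension N A X \<sigma> \<delta> \<and>
     (\<forall>i\<in>{2..N}. \<forall>l\<in>{1..<i}. \<sigma> i (X l) = \<Lambda> i l \<odot>\<^bsub>A\<^esub> X l) \<and>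
     (\<forall>i\<in>{1..N}. \<forall>l\<in>{1..N}. \<Lambda> i l \<noteq> 0 \<and> \<Lambda> i l = inverse (\<Lambda> l i)) \<and>
     (\<forall>i\<in>{1..N}. \<Lambda> i i = 1) \<and>
     (\<forall>i\<in>{2..N}. q i \<noteq> 0 \<and> q i \<noteq> 1 \<and>
        (\<forall>a\<in>carrier (stage A X (i - 1)). \<delta> i (\<sigma> i a) = q i \<odot>\<^bsub>A\<^esub> \<sigma> i (\<delta> i a))) \<and>
     (\<forall>i\<in>{2..N}.
        higher_skew_derivation (stage A X (i - 1)) (q i) (\<sigma> i) (\<delta> i) (d i) \<and>
        locally_nilpotent (stage A X (i - 1)) (d i) \<and>
        iterative (stage A X (i - 1)) (q i) (d i)) \<and>
     (\<forall>i\<in>{2..N}. \<forall>l\<in>{i+1..N}. \<forall>n. \<forall>a\<in>carrier (stage A X (i - 1)).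
        \<sigma> l (d i n a) = \<Lambda> l i ^ n \<odot>\<^bsub>A\<^esub> d i n (\<sigma> l a))"


section \<open>The skew field of fractions\<close>

text \<open>The skew field of fractions is a type \<open>'f\<close> of class \<open>division_ring\<close> with a scalar
  multiplication \<open>sc\<close>.  Its subalgebras are records obtained from \<open>ambient sc\<close>.\<close>

definition ambient :: "('k \<Rightarrow> 'f::ring_1 \<Rightarrow> 'f) \<Rightarrow> ('k, 'f) module" where
  "ambient sc = \<lparr>carrier = UNIV, mult = (*), one = 1, zero = 0, add = (+), smult = sc\<rparr>"

text \<open>Right fractions suffice in the definition.\<close>

definition frac_embedding ::
  "('k::field, 'a) module \<Rightarrow> ('k \<Rightarrow> 'f::division_ring \<Rightarrow> 'f) \<Rightarrow> ('a \<Rightarrow> 'f) \<Rightarrow> bool" where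
  "frac_embedding A sc \<iota> \<longleftrightarrow>
     k_algebra (ambient sc) \<and> \<iota> \<in> k_alg_hom A (ambient sc) \<and> inj_on \<iota> (carrier A) \<and>
     (\<forall>f. \<exists>a\<in>carrier A. \<exists>s\<in>carrier A - {\<zero>\<^bsub>A\<^esub>}. f = \<iota> a * inverse (\<iota> s))"

definition ore_set :: "('k, 'a) module \<Rightarrow> 'a set \<Rightarrow> bool" where
  "ore_set A S \<longleftrightarrow>
     S \<subseteq> carrier A \<and> \<one>\<^bsub>A\<^esub> \<in> S \<and> (\<forall>s\<in>S. \<forall>t\<in>S. s \<otimes>\<^bsub>A\<^esub> t \<in> S) \<and>
     (\<forall>s\<in>S. \<forall>a\<in>carrier A. (s \<otimes>\<^bsub>A\<^esub> a = \<zero>\<^bsub>A\<^esub> \<longrightarrow> a = \<zero>\<^bsub>A\<^esub>) \<and> (a \<otimes>\<^bsub>A\<^esub> s = \<zero>\<^bsub>A\<^esub> \<longrightarrow> a = \<zero>\<^bsub>A\<^esub>)) \<and>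
     (\<forall>a\<in>carrier A. \<forall>s\<in>S. \<exists>b\<in>carrier A. \<exists>t\<in>S. a \<otimes>\<^bsub>A\<^esub> t = s \<otimes>\<^bsub>A\<^esub> b) \<and>
     (\<forall>a\<in>carrier A. \<forall>s\<in>S. \<exists>b\<in>carrier A. \<exists>t\<in>S. t \<otimes>\<^bsub>A\<^esub> a = b \<otimes>\<^bsub>A\<^esub> s)"

text \<open>The localization \<open>A S\<^sup>-\<^sup>1\<close> inside the skew field.\<close>

definition right_fractions :: "('k, 'f::division_ring) module \<Rightarrow> 'f set \<Rightarrow> 'f set" where
  "right_fractions A S = {a * inverse s | a s. a \<in> carrier A \<and> s \<in> S}"


section \<open>The deleting derivations algorithm\<close>

text \<open>The isomorphism from the subalgebra of \<open>A\<close> generated by \<open>X\<^sub>1, \<dots>, X\<^sub>m\<close> to the subalgebra of the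
  skew field generated by \<open>x\<^sub>1, \<dots>, x\<^sub>m\<close> that sends each \<open>X\<^sub>l\<close> to \<open>x\<^sub>l\<close>.  If it exists, it is unique
  on the carrier; if not, the value is unspecified.\<close>

definition generator_iso ::
  "('k, 'a) module \<Rightarrow> (nat \<Rightarrow> 'a) \<Rightarrow> ('k \<Rightarrow> 'f::division_ring \<Rightarrow> 'f) \<Rightarrow> (nat \<Rightarrow> 'f) \<Rightarrow> nat \<Rightarrow> 'a \<Rightarrow> 'f" where
  "generator_iso A X sc x m =
     (SOME \<psi>. \<psi> \<in> k_alg_iso (stage A X m) (stage (ambient sc) x m) \<and> (\<forall>l\<in>{1..m}. \<psi> (X l) = x l))"

text \<open>A map on the subalgebra generated by \<open>X\<^sub>1, \<dots>, X\<^sub>m\<close>, regarded as a map on the subalgebra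
  generated by \<open>x\<^sub>1, \<dots>, x\<^sub>m\<close>.\<close>

definition transported ::
  "('k, 'a) module \<Rightarrow> (nat \<Rightarrow> 'a) \<Rightarrow> ('k \<Rightarrow> 'f::division_ring \<Rightarrow> 'f) \<Rightarrow> (nat \<Rightarrow> 'f) \<Rightarrow> nat \<Rightarrow>
   ('a \<Rightarrow> 'a) \<Rightarrow> 'f \<Rightarrow> 'f" where
  "transported A X sc x m f =
     generator_iso A X sc x m \<circ> f \<circ> inv_into (carrier (stage A X m)) (generator_iso A X sc x m)"

text \<open>\<open>Sum_any\<close> is the sum over all \<open>n\<close> with nonzero summand, a finite sum by local nilpotence.\<close>

definition deletion_step ::
  "('k::field, 'a) module \<Rightarrow> (nat \<Rightarrow> 'a) \<Rightarrow> (nat \<Rightarrow> 'a \<Rightarrow> 'a) \<Rightarrow> (nat \<Rightarrow> 'k) \<Rightarrow> (nat \<Rightarrow> nat \<Rightarrow> 'a \<Rightarrow> 'a) \<Rightarrow>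
   ('k \<Rightarrow> 'f::division_ring \<Rightarrow> 'f) \<Rightarrow> nat \<Rightarrow> (nat \<Rightarrow> 'f) \<Rightarrow> nat \<Rightarrow> 'f" where
  "deletion_step A X \<sigma> q d sc j x l =
     (if l < j then
        Sum_any (\<lambda>n. sc (q j ^ (n * (n + 1) div 2) * inverse ((q j - 1) ^ n))
          (transported A X sc x (j - 1)
             (d j n \<circ> inv_into (carrier (stage A X (j - 1))) (\<sigma> j) ^^ n) (x l))
          * inverse (x j) ^ n)
      else x l)"

text \<open>\<open>deletion_seq A X \<sigma> q d sc \<iota> N k\<close> is the sequence \<open>(X\<^sub>1\<^sup>(\<^sup>k\<^sup>), X\<^sub>2\<^sup>(\<^sup>k\<^sup>), \<dots>)\<close> of the algorithm, for
  \<open>2 \<le> k \<le> N + 1\<close>.\<close>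

function deletion_seq ::
  "('k::field, 'a) module \<Rightarrow> (nat \<Rightarrow> 'a) \<Rightarrow> (nat \<Rightarrow> 'a \<Rightarrow> 'a) \<Rightarrow> (nat \<Rightarrow> 'k) \<Rightarrow> (nat \<Rightarrow> nat \<Rightarrow> 'a \<Rightarrow> 'a) \<Rightarrow>
   ('k \<Rightarrow> 'f::division_ring \<Rightarrow> 'f) \<Rightarrow> ('a \<Rightarrow> 'f) \<Rightarrow> nat \<Rightarrow> nat \<Rightarrow> nat \<Rightarrow> 'f" where
  "deletion_seq A X \<sigma> q d sc \<iota> N k =
     (if N < k then \<iota> \<circ> X
      else deletion_step A X \<sigma> q d sc k (deletion_seq A X \<sigma> q d sc \<iota> N (Suc k)))"
  by auto
termination
  by (relation "measure (\<lambda>(A, X, \<sigma>, q, d, sc, \<iota>, N, k). Suc N - k)") auto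

declare deletion_seq.simps [simp del]

end

(*
  The step is governed by theta(r) = sum_n q^(n(n+1)/2) (q-1)^(-n) d_n sigma^(-n)(r) x^(-n), so that
  y_l = theta(x_l) for l < j, where x = x_j.  A comparison of coefficients, using d_1 d_n = [n+1] d_(n+1),
  gives x theta(r) = theta(sigma(r)) x.  With this relation the powers x^(-n) in theta(r) theta(t) can be
  moved to the right, and the product rule for d_n turns the resulting double sum into theta(rt).  The
  leading term of theta(r) is r, so theta is injective and the powers of x stay left independent over its
  image; the later variables stay independent because their coefficients become elements of the old algebra
  after multiplication by a power of x.  Conjugation by y_i inside the skew field multiplies every y_l
  with l < i by lambda_(i,l), and it is the automorphism of the new Ore extension at step i.

  The statement asks for the new algebra on the type of the old one and containing the first stages
  literally.  Comparing bases of powers extends theta to a bijection between the two subalgebras of the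
  skew field, along which the multiplication is pulled back.
*)
theory Submission
  imports Defs "HOL-Algebra.UnivPoly"
begin

section \<open>Homomorphisms and generated subalgebras\<close>

text \<open>The constants come from the relation x theta(r) = theta(sigma(r)) x. With theta(r) = sum
  c_n d_n sigma^(-n)(r) x^(-n) and c_0 = 1 it asks for c_n (1 - q^(-n)) = c_(n-1) [n]. Since (q -
  1)[n] = q^n - 1, the choice c_n = c_(n-1) q^n / (q - 1) meets this for every q other than 0 and 1;
  nothing is divided by [n], so roots of unity need no separate argument. The same choice gives
  c_(n+m) q^(-nm) = c_n c_m, and q^(-nm) is exactly the cost of moving sigma^m past d_n in the
  product rule. The obstacle is that x passes elements r of the old base algebra only with
  derivation terms, so x^(-n) r unfolds into a sum of fractions. Elements theta(r) are passed
  without remainder. The right Ore condition of the old algebra is therefore read off by expressing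
  r through theta, while the left one is proved directly: x is pushed through r until nilpotency
  exhausts the derivation terms. Independence is always decided by degrees in x after multiplication
  by a high power of x, so that only honest polynomials are compared.\<close>

lemma k_algebraD:
  assumes "k_algebra A"
  shows "ring A" "Module.module scalars A"
    and "a \<in> carrier A \<Longrightarrow> c \<odot>\<^bsub>A\<^esub> a \<in> carrier A"
    and "a \<in> carrier A \<Longrightarrow> b \<in> carrier A \<Longrightarrow> (c \<odot>\<^bsub>A\<^esub> a) \<otimes>\<^bsub>A\<^esub> b = c \<odot>\<^bsub>A\<^esub> (a \<otimes>\<^bsub>A\<^esub> b)"
    and "a \<in> carrier A \<Longrightarrow> b \<in> carrier A \<Longrightarrow> a \<otimes>\<^bsub>A\<^esub> (c \<odot>\<^bsub>A\<^esub> b) = c \<odot>\<^bsub>A\<^esub> (a \<otimes>\<^bsub>A\<^esub> b)"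
proof -
  show "ring A" and m: "Module.module scalars A" using assms by (simp_all add: k_algebra_def)
  show "a \<in> carrier A \<Longrightarrow> c \<odot>\<^bsub>A\<^esub> a \<in> carrier A"
    using module.smult_closed[OF m, of c a] by (simp add: scalars_def)
  show "a \<in> carrier A \<Longrightarrow> b \<in> carrier A \<Longrightarrow> (c \<odot>\<^bsub>A\<^esub> a) \<otimes>\<^bsub>A\<^esub> b = c \<odot>\<^bsub>A\<^esub> (a \<otimes>\<^bsub>A\<^esub> b)"
    and "a \<in> carrier A \<Longrightarrow> b \<in> carrier A \<Longrightarrow> a \<otimes>\<^bsub>A\<^esub> (c \<odot>\<^bsub>A\<^esub> b) = c \<odot>\<^bsub>A\<^esub> (a \<otimes>\<^bsub>A\<^esub> b)"
    using assms by (simp_all add: k_algebra_def)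
qed

lemma k_alg_homI:
  assumes "\<And>a. a \<in> carrier A \<Longrightarrow> h a \<in> carrier B"
    and "\<And>a b. a \<in> carrier A \<Longrightarrow> b \<in> carrier A \<Longrightarrow> h (a \<otimes>\<^bsub>A\<^esub> b) = h a \<otimes>\<^bsub>B\<^esub> h b"
    and "\<And>a b. a \<in> carrier A \<Longrightarrow> b \<in> carrier A \<Longrightarrow> h (a \<oplus>\<^bsub>A\<^esub> b) = h a \<oplus>\<^bsub>B\<^esub> h b"
    and "h \<one>\<^bsub>A\<^esub> = \<one>\<^bsub>B\<^esub>"
    and "\<And>c a. a \<in> carrier A \<Longrightarrow> h (c \<odot>\<^bsub>A\<^esub> a) = c \<odot>\<^bsub>B\<^esub> h a"
  shows "h \<in> k_alg_hom A B"
  using assms by (auto simp: k_alg_hom_def intro: ring_hom_memI)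

lemma k_alg_homD:
  assumes "h \<in> k_alg_hom A B"
  shows "h \<in> ring_hom A B"
    and "a \<in> carrier A \<Longrightarrow> h a \<in> carrier B"
    and "a \<in> carrier A \<Longrightarrow> b \<in> carrier A \<Longrightarrow> h (a \<otimes>\<^bsub>A\<^esub> b) = h a \<otimes>\<^bsub>B\<^esub> h b"
    and "a \<in> carrier A \<Longrightarrow> b \<in> carrier A \<Longrightarrow> h (a \<oplus>\<^bsub>A\<^esub> b) = h a \<oplus>\<^bsub>B\<^esub> h b"
    and "h \<one>\<^bsub>A\<^esub> = \<one>\<^bsub>B\<^esub>"
    and "a \<in> carrier A \<Longrightarrow> h (c \<odot>\<^bsub>A\<^esub> a) = c \<odot>\<^bsub>B\<^esub> h a"
  using assms ring_hom_memE[of h A B] by (auto simp: k_alg_hom_def)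

lemma k_alg_hom_zero: "h \<in> k_alg_hom A B \<Longrightarrow> k_algebra A \<Longrightarrow> k_algebra B \<Longrightarrow> h \<zero>\<^bsub>A\<^esub> = \<zero>\<^bsub>B\<^esub>"
  by (rule ring_hom_zero) (auto dest: k_alg_homD k_algebraD)

lemma k_alg_isoI: "h \<in> k_alg_hom A B \<Longrightarrow> bij_betw h (carrier A) (carrier B) \<Longrightarrow> h \<in> k_alg_iso A B"
  by (auto simp: k_alg_iso_def ring_iso_def k_alg_hom_def)

lemma k_alg_isoD:
  assumes "h \<in> k_alg_iso A B"
  shows "h \<in> k_alg_hom A B" "bij_betw h (carrier A) (carrier B)"
  using assms by (auto simp: k_alg_iso_def ring_iso_def)

lemma k_alg_iso_inv_into:
  assumes "k_algebra A" "h \<in> k_alg_iso A B"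
  shows "inv_into (carrier A) h \<in> k_alg_iso B A"
proof -
  let ?g = "inv_into (carrier A) h"
  note hom = k_alg_homD[OF k_alg_isoD(1)[OF assms(2)]]
  have bij: "bij_betw h (carrier A) (carrier B)" using k_alg_isoD(2)[OF assms(2)] .
  interpret ring A using k_algebraD(1)[OF assms(1)] .
  have g: "?g b \<in> carrier A" "h (?g b) = b" if "b \<in> carrier B" for b
    using that bij by (auto simp: bij_betw_def inv_into_into f_inv_into_f)
  have gh: "?g (h a) = a" if "a \<in> carrier A" for a
    using that bij by (simp add: bij_betw_def)
  show ?thesis
  proof (rule k_alg_isoI[OF k_alg_homI bij_betw_inv_into[OF bij]])
    fix a b assume *: "a \<in> carrier B" "b \<in> carrier B"
    show "?g (a \<otimes>\<^bsub>B\<^esub> b) = ?g a \<otimes>\<^bsub>A\<^esub> ?g b"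
      using gh[of "?g a \<otimes>\<^bsub>A\<^esub> ?g b"] * by (simp add: g hom)
    show "?g (a \<oplus>\<^bsub>B\<^esub> b) = ?g a \<oplus>\<^bsub>A\<^esub> ?g b"
      using gh[of "?g a \<oplus>\<^bsub>A\<^esub> ?g b"] * by (simp add: g hom)
  next
    show "?g \<one>\<^bsub>B\<^esub> = \<one>\<^bsub>A\<^esub>" using gh[of "\<one>\<^bsub>A\<^esub>"] by (simp add: hom)
  next
    fix c a assume *: "a \<in> carrier B"
    show "?g (c \<odot>\<^bsub>B\<^esub> a) = c \<odot>\<^bsub>A\<^esub> ?g a"
      using gh[of "c \<odot>\<^bsub>A\<^esub> ?g a"] * by (simp add: g hom k_algebraD(3)[OF assms(1)])
  qed (rule g)
qed

lemma k_alg_hom_comp: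
  assumes "f \<in> k_alg_hom A B" "g \<in> k_alg_hom B C"
  shows "(\<lambda>a. g (f a)) \<in> k_alg_hom A C"
  using k_alg_homD[OF assms(1)] k_alg_homD[OF assms(2)] by (intro k_alg_homI) simp_all

lemma k_subalgebraD:
  assumes "k_subalgebra R S"
  shows "k_algebra R" "k_algebra S" "(\<lambda>a. a) \<in> k_alg_hom R S" "carrier R \<subseteq> carrier S"
    and "a \<in> carrier R \<Longrightarrow> b \<in> carrier R \<Longrightarrow> a \<otimes>\<^bsub>R\<^esub> b = a \<otimes>\<^bsub>S\<^esub> b"
    and "a \<in> carrier R \<Longrightarrow> b \<in> carrier R \<Longrightarrow> a \<oplus>\<^bsub>R\<^esub> b = a \<oplus>\<^bsub>S\<^esub> b"
    and "\<one>\<^bsub>R\<^esub> = \<one>\<^bsub>S\<^esub>" "\<zero>\<^bsub>R\<^esub> = \<zero>\<^bsub>S\<^esub>"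
    and "a \<in> carrier R \<Longrightarrow> c \<odot>\<^bsub>R\<^esub> a = c \<odot>\<^bsub>S\<^esub> a"
proof -
  show *: "k_algebra R" "k_algebra S" "(\<lambda>a. a) \<in> k_alg_hom R S"
    using assms by (simp_all add: k_subalgebra_def)
  show "carrier R \<subseteq> carrier S"
    and "a \<in> carrier R \<Longrightarrow> b \<in> carrier R \<Longrightarrow> a \<otimes>\<^bsub>R\<^esub> b = a \<otimes>\<^bsub>S\<^esub> b"
    and "a \<in> carrier R \<Longrightarrow> b \<in> carrier R \<Longrightarrow> a \<oplus>\<^bsub>R\<^esub> b = a \<oplus>\<^bsub>S\<^esub> b"
    and "\<one>\<^bsub>R\<^esub> = \<one>\<^bsub>S\<^esub>"
    and "a \<in> carrier R \<Longrightarrow> c \<odot>\<^bsub>R\<^esub> a = c \<odot>\<^bsub>S\<^esub> a"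
    using k_alg_homD[OF *(3)] by auto
  show "\<zero>\<^bsub>R\<^esub> = \<zero>\<^bsub>S\<^esub>" using k_alg_hom_zero[OF *(3,1,2)] .
qed

lemma k_alg_hom_restrict: "h \<in> k_alg_hom A B \<Longrightarrow> k_subalgebra R A \<Longrightarrow> h \<in> k_alg_hom R B"
  using k_alg_hom_comp[OF k_subalgebraD(3)[of R A], of h B] by simp

lemma k_alg_hom_corestrict:
  assumes "h \<in> k_alg_hom A B" "k_subalgebra R B" "h ` carrier A \<subseteq> carrier R"
  shows "h \<in> k_alg_hom A R"
  using k_alg_homD[OF assms(1)] k_subalgebraD[OF assms(2)] assms(3)
  by (intro k_alg_homI) (simp_all add: image_subset_iff)

section \<open>Subalgebras generated by a set\<close>

lemma alg_gen_simps [simp]: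
  "mult (alg_gen A G) = mult A" "add (alg_gen A G) = add A" "one (alg_gen A G) = one A"
  "zero (alg_gen A G) = zero A" "smult (alg_gen A G) = smult A"
  by (simp_all add: alg_gen_def)

lemma carrier_alg_gen: "carrier (alg_gen A G) = generate_ring A (G \<union> range (\<lambda>c. c \<odot>\<^bsub>A\<^esub> \<one>\<^bsub>A\<^esub>))"
  by (simp add: alg_gen_def)

lemma alg_gen_incl: "G \<subseteq> carrier (alg_gen A G)"
  unfolding carrier_alg_gen by (auto intro: generate_ring.incl)

lemma scalar_in_alg_gen: "c \<odot>\<^bsub>A\<^esub> \<one>\<^bsub>A\<^esub> \<in> carrier (alg_gen A G)"
  unfolding carrier_alg_gen by (auto intro: generate_ring.incl)

lemma alg_gen_add: "a \<in> carrier (alg_gen A G) \<Longrightarrow> b \<in> carrier (alg_gen A G) \<Longrightarrow> a \<oplus>\<^bsub>A\<^esub> b \<in> carrier (alg_gen A G)"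
  and alg_gen_mult: "a \<in> carrier (alg_gen A G) \<Longrightarrow> b \<in> carrier (alg_gen A G) \<Longrightarrow> a \<otimes>\<^bsub>A\<^esub> b \<in> carrier (alg_gen A G)"
  unfolding carrier_alg_gen by (auto intro: generate_ring.intros)

lemma alg_gen_subalgebra:
  fixes A :: "('k::field, 'a) module"
  assumes "k_algebra A" "G \<subseteq> carrier A"
  shows "k_subalgebra (alg_gen A G) A"
proof -
  interpret ring A using k_algebraD(1)[OF assms(1)] .
  let ?H = "G \<union> range (\<lambda>c. c \<odot>\<^bsub>A\<^esub> \<one>\<^bsub>A\<^esub>)"
  have H: "?H \<subseteq> carrier A" using assms k_algebraD(3)[OF assms(1)] by auto
  have ring: "ring (alg_gen A G)"
    unfolding alg_gen_def by (rule generate_ring_is_ring[OF H])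
  have sub: "carrier (alg_gen A G) \<subseteq> carrier A"
    unfolding carrier_alg_gen by (rule generate_ring_incl[OF H])
  \<comment> \<open>Scalars are among the generators, so scaling is a multiplication inside the
    generated ring.\<close>
  have smult: "c \<odot>\<^bsub>A\<^esub> a \<in> carrier (alg_gen A G)" if "a \<in> carrier (alg_gen A G)" for c a
  proof -
    have "c \<odot>\<^bsub>A\<^esub> a = (c \<odot>\<^bsub>A\<^esub> \<one>\<^bsub>A\<^esub>) \<otimes>\<^bsub>A\<^esub> a"
      using that sub k_algebraD(4)[OF assms(1), of "\<one>\<^bsub>A\<^esub>" a c] by auto
    then show ?thesis using alg_gen_mult[OF scalar_in_alg_gen that] by simp
  qed
  interpret M: module scalars A using k_algebraD(2)[OF assms(1)] .
  have "Module.module scalars (alg_gen A G)"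
  proof (rule moduleI)
    show "abelian_group (alg_gen A G)" using ring by (simp add: ring_def)
    show "cring (scalars :: 'k ring)" by (rule M.R.is_cring)
  qed (use smult sub in \<open>auto simp: M.smult_l_distr M.smult_r_distr M.smult_assoc1 subset_iff\<close>)
  then have "k_algebra (alg_gen A G)"
    using ring by (simp add: k_algebra_def subsetD[OF sub] k_algebraD(4,5)[OF assms(1)])
  then show ?thesis
    using assms(1) sub by (auto simp: k_subalgebra_def intro: k_alg_homI)
qed

text \<open>The unit and the negatives produced by \<open>generate_ring\<close> are absorbed by the
  scalars: the unit is its own multiple by 1, and -b is the product of the scalar -1 with b. This
  leaves an induction without a case for negation.\<close>

lemma alg_gen_induct [consumes 3, case_names scalar incl add mult]:
  assumes "k_algebra A" "G \<subseteq> carrier A" "a \<in> carrier (alg_gen A G)"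
    and scalar: "\<And>c. P (c \<odot>\<^bsub>A\<^esub> \<one>\<^bsub>A\<^esub>)" and incl: "\<And>g. g \<in> G \<Longrightarrow> P g"
    and add: "\<And>a b. a \<in> carrier (alg_gen A G) \<Longrightarrow> b \<in> carrier (alg_gen A G) \<Longrightarrow> P a \<Longrightarrow> P b \<Longrightarrow> P (a \<oplus>\<^bsub>A\<^esub> b)"
    and mult: "\<And>a b. a \<in> carrier (alg_gen A G) \<Longrightarrow> b \<in> carrier (alg_gen A G) \<Longrightarrow> P a \<Longrightarrow> P b \<Longrightarrow> P (a \<otimes>\<^bsub>A\<^esub> b)"
  shows "P a"
proof -
  interpret ring A using k_algebraD(1)[OF assms(1)] .
  interpret M: module scalars A using k_algebraD(2)[OF assms(1)] .
  have one: "1 \<odot>\<^bsub>A\<^esub> b = b" if "b \<in> carrier A" for b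
    using M.smult_one[OF that] by (simp add: scalars_def)
  have neg: "\<ominus>\<^bsub>A\<^esub> b = ((- 1) \<odot>\<^bsub>A\<^esub> \<one>\<^bsub>A\<^esub>) \<otimes>\<^bsub>A\<^esub> b" if "b \<in> carrier A" for b
  proof (rule minus_equality)
    have "((- 1) \<odot>\<^bsub>A\<^esub> \<one>\<^bsub>A\<^esub>) \<otimes>\<^bsub>A\<^esub> b = (- 1) \<odot>\<^bsub>A\<^esub> b"
      using k_algebraD(4)[OF assms(1), of "\<one>\<^bsub>A\<^esub>" b] that by simp
    moreover have "(- 1) \<odot>\<^bsub>A\<^esub> b \<oplus>\<^bsub>A\<^esub> 1 \<odot>\<^bsub>A\<^esub> b = \<zero>\<^bsub>A\<^esub>"
      using M.smult_l_distr[of "- 1" 1 b] M.smult_l_null[OF that] that by (simp add: scalars_def)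
    ultimately show "((- 1) \<odot>\<^bsub>A\<^esub> \<one>\<^bsub>A\<^esub>) \<otimes>\<^bsub>A\<^esub> b \<oplus>\<^bsub>A\<^esub> b = \<zero>\<^bsub>A\<^esub>"
      by (simp add: one that)
  qed (use that k_algebraD(3)[OF assms(1)] in auto)
  have sub: "carrier (alg_gen A G) \<subseteq> carrier A"
    by (rule k_subalgebraD(4)[OF alg_gen_subalgebra[OF assms(1,2)]])
  show ?thesis
    using assms(3) unfolding carrier_alg_gen
  proof (induction rule: generate_ring.induct)
    case one
    then show ?case using scalar[of 1] by (simp add: \<open>\<And>b. b \<in> carrier A \<Longrightarrow> 1 \<odot>\<^bsub>A\<^esub> b = b\<close>)
  next
    case (incl h)
    then show ?case using scalar assms(5) by auto
  next
    case (a_inv h)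
    then have h: "h \<in> carrier (alg_gen A G)" by (simp add: carrier_alg_gen)
    then show ?case
      using neg[of h] sub mult[OF scalar_in_alg_gen h scalar a_inv.IH] by auto
  next
    case (eng_add h1 h2)
    then show ?case using add by (simp add: carrier_alg_gen)
  next
    case (eng_mult h1 h2)
    then show ?case using mult by (simp add: carrier_alg_gen)
  qed
qed

lemma k_alg_hom_alg_gen_subset:
  assumes "h \<in> k_alg_hom A B" "k_algebra A" "k_algebra B" "G \<subseteq> carrier A"
    and "h ` G \<subseteq> carrier (alg_gen B G')"
  shows "h ` carrier (alg_gen A G) \<subseteq> carrier (alg_gen B G')"
proof (intro image_subsetI)
  note hom = k_alg_homD[OF assms(1)]
  have sub: "carrier (alg_gen A G) \<subseteq> carrier A"
    by (rule k_subalgebraD(4)[OF alg_gen_subalgebra[OF assms(2,4)]])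
  interpret ring A using k_algebraD(1)[OF assms(2)] .
  fix a assume "a \<in> carrier (alg_gen A G)"
  with assms(2,4) show "h a \<in> carrier (alg_gen B G')"
  proof (induction rule: alg_gen_induct)
    case (scalar c)
    then show ?case by (simp add: hom scalar_in_alg_gen)
  next
    case (incl g)
    then show ?case using assms(5) by blast
  next
    case (add a b)
    then show ?case using sub by (simp add: hom alg_gen_add subset_iff)
  next
    case (mult a b)
    then show ?case using sub by (simp add: hom alg_gen_mult subset_iff)
  qed
qed

lemma k_alg_hom_image_alg_gen:
  assumes "h \<in> k_alg_hom A B" "k_algebra A" "k_algebra B" "G \<subseteq> carrier A"
  shows "h ` carrier (alg_gen A G) = carrier (alg_gen B (h ` G))"
proof
  note hom = k_alg_homD[OF assms(1)]
  have sub: "carrier (alg_gen A G) \<subseteq> carrier A"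
    by (rule k_subalgebraD(4)[OF alg_gen_subalgebra[OF assms(2,4)]])
  interpret ring A using k_algebraD(1)[OF assms(2)] .
  show "h ` carrier (alg_gen A G) \<subseteq> carrier (alg_gen B (h ` G))"
    by (rule k_alg_hom_alg_gen_subset[OF assms alg_gen_incl])
  show "carrier (alg_gen B (h ` G)) \<subseteq> h ` carrier (alg_gen A G)"
  proof
    fix b assume b: "b \<in> carrier (alg_gen B (h ` G))"
    have "h ` G \<subseteq> carrier B" using assms(4) hom(2) by auto
    with assms(3) show "b \<in> h ` carrier (alg_gen A G)" using b
    proof (induction rule: alg_gen_induct)
      case (scalar c)
      have "c \<odot>\<^bsub>B\<^esub> \<one>\<^bsub>B\<^esub> = h (c \<odot>\<^bsub>A\<^esub> \<one>\<^bsub>A\<^esub>)" by (simp add: hom)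
      then show ?case by (rule image_eqI[OF _ scalar_in_alg_gen])
    next
      case (incl g)
      then show ?case using alg_gen_incl[of G A] by blast
    next
      case (add a b)
      then obtain a' b' where "a = h a'" "b = h b'" "a' \<in> carrier (alg_gen A G)" "b' \<in> carrier (alg_gen A G)"
        by blast
      then have "a \<oplus>\<^bsub>B\<^esub> b = h (a' \<oplus>\<^bsub>A\<^esub> b')" "a' \<oplus>\<^bsub>A\<^esub> b' \<in> carrier (alg_gen A G)"
        using sub by (auto simp: hom alg_gen_add subset_iff)
      then show ?case by blast
    next
      case (mult a b)
      then obtain a' b' where "a = h a'" "b = h b'" "a' \<in> carrier (alg_gen A G)" "b' \<in> carrier (alg_gen A G)"
        by blast
      then have "a \<otimes>\<^bsub>B\<^esub> b = h (a' \<otimes>\<^bsub>A\<^esub> b')" "a' \<otimes>\<^bsub>A\<^esub> b' \<in> carrier (alg_gen A G)"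
        using sub by (auto simp: hom alg_gen_mult subset_iff)
      then show ?case by blast
    qed
  qed
qed

lemma alg_gen_of_subalgebra:
  assumes "k_subalgebra R S" "G \<subseteq> carrier R"
  shows "carrier (alg_gen R G) = carrier (alg_gen S G)"
  using k_alg_hom_image_alg_gen[OF k_subalgebraD(3,1,2)[OF assms(1)] assms(2)] by simp

lemma alg_gen_alg_gen:
  assumes "k_algebra A" "G' \<subseteq> carrier A" "G \<subseteq> carrier (alg_gen A G')"
  shows "alg_gen (alg_gen A G') G = alg_gen A G"
  using alg_gen_of_subalgebra[OF alg_gen_subalgebra[OF assms(1,2)] assms(3)]
  by (simp add: alg_gen_def)

lemma alg_gen_mono_subalgebra:
  assumes "k_algebra A" "G' \<subseteq> carrier A" "G \<subseteq> G'"
  shows "k_subalgebra (alg_gen A G) (alg_gen A G')"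
proof -
  have G: "G \<subseteq> carrier (alg_gen A G')" by (rule order_trans[OF assms(3) alg_gen_incl])
  have "k_subalgebra (alg_gen (alg_gen A G') G) (alg_gen A G')"
    by (rule alg_gen_subalgebra[OF k_subalgebraD(1)[OF alg_gen_subalgebra[OF assms(1,2)]] G])
  then show ?thesis by (simp only: alg_gen_alg_gen[OF assms(1,2) G])
qed

lemma k_alg_hom_eqI:
  assumes "f \<in> k_alg_hom A B" "g \<in> k_alg_hom A B" "k_algebra A" "G \<subseteq> carrier A"
    and "\<And>a. a \<in> G \<Longrightarrow> f a = g a" and "a \<in> carrier (alg_gen A G)"
  shows "f a = g a"
  using assms(3,4,6)
proof (induction rule: alg_gen_induct)
  note f = k_alg_homD[OF assms(1)] and g = k_alg_homD[OF assms(2)]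
  have sub: "carrier (alg_gen A G) \<subseteq> carrier A"
    by (rule k_subalgebraD(4)[OF alg_gen_subalgebra[OF assms(3,4)]])
  interpret ring A using k_algebraD(1)[OF assms(3)] .
  {
    case (scalar c)
    then show ?case by (simp add: f g)
  next
    case (incl g)
    then show ?case using assms(5) by blast
  next
    case (add a b)
    then show ?case using sub by (simp add: f g subset_iff)
  next
    case (mult a b)
    then show ?case using sub by (simp add: f g subset_iff)
  }
qed

lemma k_alg_iso_alg_gen:
  assumes "h \<in> k_alg_hom A B" "inj_on h (carrier A)" "k_algebra A" "k_algebra B" "G \<subseteq> carrier A"
  shows "h \<in> k_alg_iso (alg_gen A G) (alg_gen B (h ` G))"
proof (rule k_alg_isoI)
  have sub: "k_subalgebra (alg_gen A G) A" by (rule alg_gen_subalgebra[OF assms(3,5)])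
  have img: "h ` carrier (alg_gen A G) = carrier (alg_gen B (h ` G))"
    by (rule k_alg_hom_image_alg_gen[OF assms(1,3-5)])
  have "h ` G \<subseteq> carrier B" using assms(5) k_alg_homD(2)[OF assms(1)] by auto
  then show "h \<in> k_alg_hom (alg_gen A G) (alg_gen B (h ` G))"
    using img by (intro k_alg_hom_corestrict[OF k_alg_hom_restrict[OF assms(1) sub]] alg_gen_subalgebra assms(4)) auto
  show "bij_betw h (carrier (alg_gen A G)) (carrier (alg_gen B (h ` G)))"
    using img inj_on_subset[OF assms(2) k_subalgebraD(4)[OF sub]] by (simp add: bij_betw_def)
qed

section \<open>Transport of an algebra structure along a bijection\<close>

definition pullback_algebra :: "'a set \<Rightarrow> ('a \<Rightarrow> 'b) \<Rightarrow> ('k, 'b) module \<Rightarrow> ('k, 'a) module" where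
  "pullback_algebra D f M = (let g = inv_into D f in
     \<lparr>carrier = D, mult = (\<lambda>a b. g (f a \<otimes>\<^bsub>M\<^esub> f b)), one = g \<one>\<^bsub>M\<^esub>, zero = g \<zero>\<^bsub>M\<^esub>,
      add = (\<lambda>a b. g (f a \<oplus>\<^bsub>M\<^esub> f b)), smult = (\<lambda>c a. g (c \<odot>\<^bsub>M\<^esub> f a))\<rparr>)"

lemma carrier_pullback [simp]: "carrier (pullback_algebra D f M) = D"
  by (simp add: pullback_algebra_def Let_def)

lemma pullback_algebra:
  fixes M :: "('k::field, 'b) module"
  assumes "k_algebra M" "bij_betw f D (carrier M)"
  shows "k_algebra (pullback_algebra D f M)" "inv_into D f \<in> k_alg_iso M (pullback_algebra D f M)"
proof -
  let ?C = "pullback_algebra D f M" and ?g = "inv_into D f"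
  interpret ring M using k_algebraD(1)[OF assms(1)] .
  interpret M: module scalars M using k_algebraD(2)[OF assms(1)] .
  have g: "?g b \<in> D" "f (?g b) = b" if "b \<in> carrier M" for b
    using that assms(2) by (auto simp: bij_betw_def inv_into_into f_inv_into_f)
  have f: "f a \<in> carrier M" "?g (f a) = a" if "a \<in> D" for a
    using that assms(2) by (auto simp: bij_betw_def)
  have hom: "?g \<in> k_alg_hom M ?C"
    by (rule k_alg_homI) (simp_all add: pullback_algebra_def Let_def g)
  then show iso: "?g \<in> k_alg_iso M ?C"
    using bij_betw_inv_into[OF assms(2)] by (intro k_alg_isoI) simp_all
  then have "ring (?C\<lparr>zero := ?g \<zero>\<^bsub>M\<^esub>\<rparr>)"
    by (intro ring_iso_imp_img_ring) (simp add: k_alg_iso_def)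
  then have ring: "ring ?C" by (simp add: pullback_algebra_def Let_def)
  have "Module.module scalars ?C"
  proof (rule moduleI)
    show "abelian_group ?C" using ring by (simp add: ring_def)
    show "cring (scalars :: 'k ring)" by (rule M.R.is_cring)
  qed (simp_all add: pullback_algebra_def Let_def f g M.smult_l_distr M.smult_r_distr M.smult_assoc1)
  then show "k_algebra ?C"
    using ring by (auto simp: k_algebra_def pullback_algebra_def Let_def f g k_algebraD[OF assms(1)])
qed


section \<open>Transfer of Ore extensions\<close>

lemma k_alg_hom_finsum_powers:
  assumes "h \<in> k_alg_hom S S'" "k_algebra S" "k_algebra S'" "range r \<subseteq> carrier S" "x \<in> carrier S" "finite I"
  shows "h (\<Oplus>\<^bsub>S\<^esub>n\<in>I. r n \<otimes>\<^bsub>S\<^esub> x [^]\<^bsub>S\<^esub> (n::nat)) = (\<Oplus>\<^bsub>S'\<^esub>n\<in>I. h (r n) \<otimes>\<^bsub>S'\<^esub> h x [^]\<^bsub>S'\<^esub> n)"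
proof -
  interpret S: ring S using k_algebraD(1)[OF assms(2)] .
  interpret S': ring S' using k_algebraD(1)[OF assms(3)] .
  interpret ring_hom_ring S S' h
    by (rule ring_hom_ringI2[OF S.ring_axioms S'.ring_axioms k_alg_homD(1)[OF assms(1)]])
  have r: "r n \<in> carrier S" for n using assms(4) by auto
  have "h (\<Oplus>\<^bsub>S\<^esub>n\<in>I. r n \<otimes>\<^bsub>S\<^esub> x [^]\<^bsub>S\<^esub> n) = (\<Oplus>\<^bsub>S'\<^esub>n\<in>I. (h \<circ> (\<lambda>n. r n \<otimes>\<^bsub>S\<^esub> x [^]\<^bsub>S\<^esub> n)) n)"
    by (rule hom_finsum) (use r assms(5) in auto)
  then show ?thesis using r assms(5) by (simp add: hom_nat_pow)
qed

text \<open>The sums in \<open>ore_extension\<close> run over the support of the coefficient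
  sequence, so the basis property moves along \<open>h\<close> because injectivity keeps supports.
  \<open>R'\<close> is a separate record, tied to the image of \<open>R\<close> through its carrier
  and its inclusion in \<open>S'\<close>; this makes the lemma applicable to stages of another
  tower. The new maps are prescribed on images only.\<close>

lemma ore_extension_transfer:
  assumes ore: "ore_extension R S x \<sigma> \<delta>"
    and h: "h \<in> k_alg_iso S S'" and sub: "k_subalgebra R' S'" and R': "carrier R' = h ` carrier R"
    and \<sigma>': "\<And>r. r \<in> carrier R \<Longrightarrow> \<sigma>' (h r) = h (\<sigma> r)"
    and \<delta>': "\<And>r. r \<in> carrier R \<Longrightarrow> \<delta>' (h r) = h (\<delta> r)"
  shows "ore_extension R' S' (h x) \<sigma>' \<delta>'"
proof -
  have RS: "k_subalgebra R S" and \<sigma>: "\<sigma> \<in> k_alg_iso R R" and \<delta>: "skew_derivation R \<sigma> \<delta>" and x: "x \<in> carrier S"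
    and comm: "\<And>r. r \<in> carrier R \<Longrightarrow> x \<otimes>\<^bsub>S\<^esub> r = \<sigma> r \<otimes>\<^bsub>S\<^esub> x \<oplus>\<^bsub>S\<^esub> \<delta> r"
    and basis: "\<And>s. s \<in> carrier S \<Longrightarrow> \<exists>!r :: nat \<Rightarrow> _.
        range r \<subseteq> carrier R \<and> finite {n. r n \<noteq> \<zero>\<^bsub>S\<^esub>} \<and>
        s = (\<Oplus>\<^bsub>S\<^esub>n\<in>{n. r n \<noteq> \<zero>\<^bsub>S\<^esub>}. r n \<otimes>\<^bsub>S\<^esub> x [^]\<^bsub>S\<^esub> n)"
    using ore by (simp_all add: ore_extension_def)
  note RS' = k_subalgebraD[OF RS] and sub' = k_subalgebraD[OF sub]
  note hS = k_alg_homD[OF k_alg_isoD(1)[OF h]]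
  note s = k_alg_homD[OF k_alg_isoD(1)[OF \<sigma>]]
  interpret R: ring R using k_algebraD(1)[OF RS'(1)] .
  interpret S: ring S using k_algebraD(1)[OF RS'(2)] .
  have bij: "bij_betw h (carrier S) (carrier S')" using k_alg_isoD(2)[OF h] .
  have hR: "h \<in> k_alg_hom R R'"
    by (rule k_alg_hom_corestrict[OF k_alg_hom_restrict[OF k_alg_isoD(1)[OF h] RS] sub]) (simp add: R')
  note hRR' = k_alg_homD[OF hR]
  have bijR: "bij_betw h (carrier R) (carrier R')"
    using bij RS'(4) inj_on_subset by (auto simp: bij_betw_def R')
  have h0: "h \<zero>\<^bsub>S\<^esub> = \<zero>\<^bsub>S'\<^esub>" by (rule k_alg_hom_zero[OF k_alg_isoD(1)[OF h] RS'(2) sub'(2)])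
  have d: "\<delta> r \<in> carrier R" if "r \<in> carrier R" for r
    using \<delta> that by (auto simp: skew_derivation_def k_linear_on_def)
  have "\<sigma>' \<in> k_alg_iso R' R'"
  proof (rule k_alg_isoI)
    show "\<sigma>' \<in> k_alg_hom R' R'"
    proof (rule k_alg_homI)
      show "\<sigma>' \<one>\<^bsub>R'\<^esub> = \<one>\<^bsub>R'\<^esub>" using \<sigma>'[of "\<one>\<^bsub>R\<^esub>"] by (simp add: hRR' s)
    qed (use s(2) in \<open>auto simp: R' \<sigma>' s hRR'(3-6)[symmetric] k_algebraD(3)[OF RS'(1)]\<close>)
    have "bij_betw (h \<circ> \<sigma> \<circ> inv_into (carrier R) h) (carrier R') (carrier R')"
      by (intro bij_betw_trans[OF bij_betw_inv_into[OF bijR]] bij_betw_trans[OF k_alg_isoD(2)[OF \<sigma>] bijR])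
    moreover have "(h \<circ> \<sigma> \<circ> inv_into (carrier R) h) a = \<sigma>' a" if "a \<in> carrier R'" for a
      using that bijR \<sigma>'[of "inv_into (carrier R) h a"]
      by (auto simp: bij_betw_def inv_into_into f_inv_into_f)
    ultimately show "bij_betw \<sigma>' (carrier R') (carrier R')" using bij_betw_cong by blast
  qed
  moreover have "skew_derivation R' \<sigma>' \<delta>'"
    using \<delta> s(2) unfolding skew_derivation_def k_linear_on_def
    by (auto simp: R' \<sigma>' \<delta>' hRR'(3-6)[symmetric] k_algebraD(3)[OF RS'(1)] d Pi_iff)
  moreover have "h x \<otimes>\<^bsub>S'\<^esub> r = \<sigma>' r \<otimes>\<^bsub>S'\<^esub> h x \<oplus>\<^bsub>S'\<^esub> \<delta>' r" if "r \<in> carrier R'" for r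
  proof -
    obtain t where t: "t \<in> carrier R" "r = h t" using \<open>r \<in> carrier R'\<close> by (auto simp: R')
    then have "t \<in> carrier S" "\<sigma> t \<in> carrier S" "\<delta> t \<in> carrier S" using RS'(4) s(2) d by auto
    then show ?thesis using t x by (simp add: \<sigma>' \<delta>' comm flip: hS(3,4))
  qed
  moreover have "\<exists>!r :: nat \<Rightarrow> _. range r \<subseteq> carrier R' \<and> finite {n. r n \<noteq> \<zero>\<^bsub>S'\<^esub>} \<and>
        s' = (\<Oplus>\<^bsub>S'\<^esub>n\<in>{n. r n \<noteq> \<zero>\<^bsub>S'\<^esub>}. r n \<otimes>\<^bsub>S'\<^esub> h x [^]\<^bsub>S'\<^esub> n)" if s': "s' \<in> carrier S'" for s'
  proof -
    let ?Q = "\<lambda>s r. range r \<subseteq> carrier R \<and> finite {n. r n \<noteq> \<zero>\<^bsub>S\<^esub>} \<and>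
        s = (\<Oplus>\<^bsub>S\<^esub>n\<in>{n. r n \<noteq> \<zero>\<^bsub>S\<^esub>}. r n \<otimes>\<^bsub>S\<^esub> x [^]\<^bsub>S\<^esub> (n::nat))"
    let ?Q' = "\<lambda>r. range r \<subseteq> carrier R' \<and> finite {n. r n \<noteq> \<zero>\<^bsub>S'\<^esub>} \<and>
        s' = (\<Oplus>\<^bsub>S'\<^esub>n\<in>{n. r n \<noteq> \<zero>\<^bsub>S'\<^esub>}. r n \<otimes>\<^bsub>S'\<^esub> h x [^]\<^bsub>S'\<^esub> (n::nat))"
    obtain s where s: "s \<in> carrier S" "s' = h s" using s' bij by (auto simp: bij_betw_def)
    have h_eq_0: "h a = \<zero>\<^bsub>S'\<^esub> \<longleftrightarrow> a = \<zero>\<^bsub>S\<^esub>" if "a \<in> carrier R" for a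
      using that RS'(4) bij h0 by (metis S.zero_closed bij_betw_imp_inj_on inj_onD subsetD)
    have *: "?Q' (h \<circ> r) \<longleftrightarrow> ?Q s r" if r: "range r \<subseteq> carrier R" for r
    proof -
      have supp: "{n. (h \<circ> r) n \<noteq> \<zero>\<^bsub>S'\<^esub>} = {n. r n \<noteq> \<zero>\<^bsub>S\<^esub>}" using r h_eq_0 by auto
      have rS: "range r \<subseteq> carrier S" using r RS'(4) by blast
      have sum: "(\<Oplus>\<^bsub>S\<^esub>n\<in>I. r n \<otimes>\<^bsub>S\<^esub> x [^]\<^bsub>S\<^esub> n) \<in> carrier S" for I
        using rS x by (intro S.finsum_closed) auto
      have inj: "s' = h s0 \<longleftrightarrow> s = s0" if "s0 \<in> carrier S" for s0
        using s that bij by (auto simp: bij_betw_def inj_on_def)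
      have "s' = (\<Oplus>\<^bsub>S'\<^esub>n\<in>I. (h \<circ> r) n \<otimes>\<^bsub>S'\<^esub> h x [^]\<^bsub>S'\<^esub> n)
          \<longleftrightarrow> s = (\<Oplus>\<^bsub>S\<^esub>n\<in>I. r n \<otimes>\<^bsub>S\<^esub> x [^]\<^bsub>S\<^esub> n)" if "finite I" for I
        using k_alg_hom_finsum_powers[OF k_alg_isoD(1)[OF h] RS'(2) sub'(2) rS x that] inj[OF sum, of I]
        by (simp add: o_def)
      moreover have "range (h \<circ> r) \<subseteq> carrier R'" using r by (auto simp: R')
      ultimately show ?thesis using r unfolding supp by blast
    qed
    obtain r where r: "?Q s r" and uniq: "\<And>r'. ?Q s r' \<Longrightarrow> r' = r" using basis[OF s(1)] by blast
    show ?thesis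
    proof (rule ex1I[of _ "h \<circ> r"])
      show "?Q' (h \<circ> r)" using * r by blast
      fix r' assume r': "?Q' r'"
      define r0 where "r0 = inv_into (carrier R) h \<circ> r'"
      have r0: "range r0 \<subseteq> carrier R" "h \<circ> r0 = r'"
        using r' bijR by (auto simp: r0_def bij_betw_def fun_eq_iff inv_into_into f_inv_into_f subset_iff R')
      have "?Q s r0" using *[OF r0(1)] r' unfolding r0(2) by (rule iffD1)
      then have "r0 = r" by (rule uniq)
      then show "r' = h \<circ> r" using r0(2) by (simp only:)
    qed
  qed
  ultimately show ?thesis
    using sub hS(2)[OF x] unfolding ore_extension_def by blast
qed


section \<open>Subalgebras of a skew field\<close>

definition left_poly :: "'f::division_ring \<Rightarrow> (nat \<Rightarrow> 'f) \<Rightarrow> 'f" where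
  "left_poly z a = (\<Sum>n | a n \<noteq> 0. a n * z ^ n)"

definition coeff_seqs :: "'f::zero set \<Rightarrow> (nat \<Rightarrow> 'f) set" where
  "coeff_seqs H = {a. range a \<subseteq> H \<and> finite {n. a n \<noteq> 0}}"

definition left_free :: "'f::division_ring set \<Rightarrow> 'f \<Rightarrow> bool" where
  "left_free H z \<longleftrightarrow> inj_on (left_poly z) (coeff_seqs H)"

text \<open>Degree filtration. Only the first \<open>k\<close> coefficients count, so no support
  condition is imposed and degrees are compared in plain finite sums.\<close>

definition polys_below :: "'f::division_ring set \<Rightarrow> 'f \<Rightarrow> nat \<Rightarrow> 'f set" where
  "polys_below H z k = {\<Sum>n<k. a n * z ^ n | a. range a \<subseteq> H}"

text \<open>For the variable of a skew polynomial extension this is its automorphism, available on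
  the whole skew field without a choice of domain.\<close>

definition conjugate :: "'f::division_ring \<Rightarrow> 'f \<Rightarrow> 'f" where
  "conjugate z b = z * b * inverse z"

text \<open>The elements of the localization at the powers of \<open>z\<close>, if \<open>z \<in> U\<close>.\<close>

definition denom_powers :: "'f::division_ring set \<Rightarrow> 'f \<Rightarrow> 'f set" where
  "denom_powers U z = {b. eventually (\<lambda>n. b * z ^ n \<in> U) at_top}"

locale skew_field_algebra =
  fixes sc :: "'k::field \<Rightarrow> 'f::division_ring \<Rightarrow> 'f"
  assumes algebra: "k_algebra (ambient sc)"
begin

lemma ambient_simps [simp]:
  "carrier (ambient sc) = UNIV" "x \<otimes>\<^bsub>ambient sc\<^esub> y = x * y" "x \<oplus>\<^bsub>ambient sc\<^esub> y = x + y"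
  "\<one>\<^bsub>ambient sc\<^esub> = 1" "\<zero>\<^bsub>ambient sc\<^esub> = 0" "c \<odot>\<^bsub>ambient sc\<^esub> x = sc c x"
  by (simp_all add: ambient_def)

lemma ambient_module: "Module.module scalars (ambient sc)"
  using algebra by (simp_all add: k_algebra_def)

lemma sc_mult_left: "sc c a * b = sc c (a * b)"
  and sc_mult_right: "a * sc c b = sc c (a * b)"
  using algebra by (simp_all add: k_algebra_def)

lemma sc_add_right: "sc c (a + b) = sc c a + sc c b"
  using module.smult_r_distr[OF ambient_module, of c a b] by (simp add: scalars_def)

lemma sc_add_left: "sc (c + e) a = sc c a + sc e a"
  using module.smult_l_distr[OF ambient_module, of c e a] by (simp add: scalars_def)

lemma sc_sc [simp]: "sc c (sc e a) = sc (c * e) a"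
  using module.smult_assoc1[OF ambient_module, of c e a] by (simp add: scalars_def)

lemma sc_one [simp]: "sc 1 a = a"
  using module.smult_one[OF ambient_module, of a] by (simp add: scalars_def)

lemma sc_zero_left [simp]: "sc 0 a = 0"
  using sc_add_left[of 0 0 a] by simp

lemma sc_zero_right [simp]: "sc c 0 = 0"
  using sc_add_right[of c 0 0] by simp

lemma sc_eq_0_iff [simp]: "sc c a = 0 \<longleftrightarrow> c = 0 \<or> a = 0"
proof
  assume "sc c a = 0"
  then have "sc (inverse c) (sc c a) = 0" by simp
  then show "c = 0 \<or> a = 0" by (cases "c = 0") auto
qed auto

lemma sc_sum: "sc c (\<Sum>i\<in>I. f i) = (\<Sum>i\<in>I. sc c (f i))"
  by (induction I rule: infinite_finite_induct) (simp_all add: sc_add_right)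

lemma sc_conv_mult: "sc c a = sc c 1 * a"
  by (simp add: sc_mult_left)

text \<open>All subalgebras of the skew field share its operations, so they are handled as sets.
  Zero and negatives come from the scalars 0 and -1.\<close>

definition subalg :: "'f set \<Rightarrow> bool" where
  "subalg H \<longleftrightarrow> 1 \<in> H \<and> (\<forall>a\<in>H. \<forall>b\<in>H. a + b \<in> H \<and> a * b \<in> H) \<and> (\<forall>c. \<forall>a\<in>H. sc c a \<in> H)"

definition gen :: "'f set \<Rightarrow> 'f set" where
  "gen G = carrier (alg_gen (ambient sc) G)"

lemma subalgD:
  assumes "subalg H"
  shows "1 \<in> H" "0 \<in> H" "a \<in> H \<Longrightarrow> b \<in> H \<Longrightarrow> a + b \<in> H" "a \<in> H \<Longrightarrow> b \<in> H \<Longrightarrow> a * b \<in> H"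
    "a \<in> H \<Longrightarrow> sc c a \<in> H" "a \<in> H \<Longrightarrow> - a \<in> H" "a \<in> H \<Longrightarrow> a ^ n \<in> H"
    "(\<And>i. i \<in> I \<Longrightarrow> f i \<in> H) \<Longrightarrow> sum f I \<in> H"
proof -
  show *: "1 \<in> H" "a \<in> H \<Longrightarrow> b \<in> H \<Longrightarrow> a + b \<in> H" "a \<in> H \<Longrightarrow> b \<in> H \<Longrightarrow> a * b \<in> H"
    "a \<in> H \<Longrightarrow> sc c a \<in> H" for a b c
    using assms by (auto simp: subalg_def)
  show **: "0 \<in> H" using *(4)[OF *(1), of 0] by simp
  have "sc (- 1) a = - a" for a
    using sc_add_left[of 1 "- 1" a] by (simp add: eq_neg_iff_add_eq_0 add.commute)
  then show "a \<in> H \<Longrightarrow> - a \<in> H" using *(4)[of a "- 1"] by simp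
  show "a \<in> H \<Longrightarrow> a ^ n \<in> H" by (induction n) (use * in auto)
  show "(\<And>i. i \<in> I \<Longrightarrow> f i \<in> H) \<Longrightarrow> sum f I \<in> H"
    by (induction I rule: infinite_finite_induct) (use * ** in auto)
qed

lemma subalg_diff: "subalg H \<Longrightarrow> a \<in> H \<Longrightarrow> b \<in> H \<Longrightarrow> a - b \<in> H"
  using subalgD(3)[of H a "- b"] subalgD(6)[of H b] by simp

lemma carrier_alg_gen_ambient [simp]: "carrier (alg_gen (ambient sc) G) = gen G"
  by (simp add: gen_def)

lemma subalg_gen: "subalg (gen G)"
proof -
  note sub = k_subalgebraD[OF alg_gen_subalgebra[OF algebra, of G]]
  have "sc c a \<in> gen G" if "a \<in> gen G" for a c
    using k_algebraD(3)[OF sub(1), of a c] that by simp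
  moreover have "1 \<in> gen G"
    using ring.ring_simprules(6)[OF k_algebraD(1)[OF sub(1)]] by simp
  ultimately show ?thesis
    using alg_gen_add[of _ "ambient sc" G] alg_gen_mult[of _ "ambient sc" G] by (simp add: subalg_def)
qed

lemma gen_incl: "G \<subseteq> gen G"
  unfolding gen_def by (rule alg_gen_incl)

lemma gen_induct [consumes 1, case_names scalar incl add mult]:
  assumes "a \<in> gen G"
    and "\<And>c. P (sc c 1)" "\<And>g. g \<in> G \<Longrightarrow> P g"
    and "\<And>a b. a \<in> gen G \<Longrightarrow> b \<in> gen G \<Longrightarrow> P a \<Longrightarrow> P b \<Longrightarrow> P (a + b)"
    and "\<And>a b. a \<in> gen G \<Longrightarrow> b \<in> gen G \<Longrightarrow> P a \<Longrightarrow> P b \<Longrightarrow> P (a * b)"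
  shows "P a"
  using alg_gen_induct[OF algebra, of G a P] assms by simp

lemma gen_minimal:
  assumes "subalg H" "G \<subseteq> H"
  shows "gen G \<subseteq> H"
proof
  fix a assume "a \<in> gen G"
  then show "a \<in> H"
    by (induction rule: gen_induct) (use assms in \<open>auto intro: subalgD\<close>)
qed

lemma gen_mono: "G \<subseteq> G' \<Longrightarrow> gen G \<subseteq> gen G'"
  by (meson gen_minimal subalg_gen gen_incl order_trans)

lemma gen_gen_Un: "gen (gen G \<union> G') = gen (G \<union> G')"
  by (intro equalityI gen_minimal subalg_gen Un_least gen_mono)
     (use gen_incl[of G] gen_incl[of "gen G \<union> G'"] gen_incl[of "G \<union> G'"] in auto)


section \<open>Free powers\<close>

lemma left_poly_bounded:
  assumes "\<And>n. n \<ge> k \<Longrightarrow> a n = 0"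
  shows "left_poly z a = (\<Sum>n<k. a n * z ^ n)"
  unfolding left_poly_def
  by (rule sum.mono_neutral_left) (use assms in \<open>auto simp: not_le[symmetric]\<close>)

lemma polys_belowI: "range a \<subseteq> H \<Longrightarrow> b = (\<Sum>n<k. a n * z ^ n) \<Longrightarrow> b \<in> polys_below H z k"
  unfolding polys_below_def by blast

lemma polys_belowE:
  assumes "b \<in> polys_below H z k"
  obtains a where "range a \<subseteq> H" "b = (\<Sum>n<k. a n * z ^ n)"
  using assms unfolding polys_below_def by blast

lemma polys_below_add:
  assumes "subalg H" "b \<in> polys_below H z k" "c \<in> polys_below H z k"
  shows "b + c \<in> polys_below H z k"
proof -
  obtain a where a: "range a \<subseteq> H" "b = (\<Sum>n<k. a n * z ^ n)"
    using assms(2) by (rule polys_belowE)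
  obtain a' where a': "range a' \<subseteq> H" "c = (\<Sum>n<k. a' n * z ^ n)"
    using assms(3) by (rule polys_belowE)
  have "b + c = (\<Sum>n<k. (a n + a' n) * z ^ n)"
    by (simp add: a(2) a'(2) sum.distrib distrib_right)
  moreover have "range (\<lambda>n. a n + a' n) \<subseteq> H"
    using a(1) a'(1) subalgD(3)[OF assms(1)] by (auto simp: image_subset_iff)
  ultimately show ?thesis by (intro polys_belowI)
qed

lemma monom_in_polys_below:
  assumes "subalg H" "h \<in> H" "n < k"
  shows "h * z ^ n \<in> polys_below H z k"
proof -
  have "h * z ^ n = (\<Sum>i<k. (if i = n then h else 0) * z ^ i)"
    using assms(3) by (subst sum.cong[OF refl, of _ _ "\<lambda>i. if i = n then h * z ^ n else 0"]) auto
  moreover have "range (\<lambda>i. if i = n then h else 0) \<subseteq> H"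
    using assms(2) subalgD(2)[OF assms(1)] by auto
  ultimately show ?thesis by (intro polys_belowI)
qed

lemma zero_in_polys_below: "subalg H \<Longrightarrow> 0 \<in> polys_below H z k"
  using subalgD(2)[of H] by (intro polys_belowI[of "\<lambda>_. 0"]) auto

lemma sum_in_polys_below:
  assumes "subalg H" "\<And>i. i \<in> I \<Longrightarrow> f i \<in> polys_below H z k"
  shows "sum f I \<in> polys_below H z k"
  using assms(2)
  by (induction I rule: infinite_finite_induct)
     (auto intro: polys_below_add[OF assms(1)] zero_in_polys_below[OF assms(1)])

lemma polys_below_mult_power:
  assumes "subalg H" "b \<in> polys_below H z k" "k + m \<le> k'"
  shows "b * z ^ m \<in> polys_below H z k'"
proof -
  obtain a where a: "range a \<subseteq> H" "b = (\<Sum>n<k. a n * z ^ n)"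
    using assms(2) by (rule polys_belowE)
  have "b * z ^ m = (\<Sum>n<k. a n * z ^ (n + m))"
    by (simp add: a(2) sum_distrib_right power_add mult.assoc)
  also have "\<dots> \<in> polys_below H z k'"
    by (rule sum_in_polys_below[OF assms(1)], rule monom_in_polys_below[OF assms(1)])
       (use a(1) assms(3) in auto)
  finally show ?thesis .
qed

lemma polys_below_minus:
  assumes "subalg H" "b \<in> polys_below H z k"
  shows "- b \<in> polys_below H z k"
proof -
  obtain a where a: "range a \<subseteq> H" "b = (\<Sum>n<k. a n * z ^ n)"
    using assms(2) by (rule polys_belowE)
  have "- b = (\<Sum>n<k. (- a n) * z ^ n)" by (simp add: a(2) sum_negf)
  moreover have "range (\<lambda>n. - a n) \<subseteq> H"
    using a(1) subalgD(6)[OF assms(1)] by (auto simp: image_subset_iff)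
  ultimately show ?thesis by (intro polys_belowI)
qed

lemma polys_below_subset: "subalg U \<Longrightarrow> H \<subseteq> U \<Longrightarrow> z \<in> U \<Longrightarrow> polys_below H z k \<subseteq> U"
  by (auto elim!: polys_belowE intro!: subalgD(8) subalgD(4) subalgD(7) simp: image_subset_iff)

lemma left_poly_image:
  assumes "subalg H"
  shows "left_poly z ` coeff_seqs H = (\<Union>k. polys_below H z k)"
proof (intro equalityI subsetI)
  fix b assume "b \<in> left_poly z ` coeff_seqs H"
  then obtain a where a: "a \<in> coeff_seqs H" "b = left_poly z a" by auto
  then obtain k where "\<And>n. n \<ge> k \<Longrightarrow> a n = 0"
    by (auto simp: coeff_seqs_def finite_nat_set_iff_bounded not_less) (meson not_le)
  then have "b = (\<Sum>n<k. a n * z ^ n)" using a(2) left_poly_bounded by blast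
  moreover have "range a \<subseteq> H" using a(1) by (simp add: coeff_seqs_def)
  ultimately show "b \<in> (\<Union>k. polys_below H z k)" by (blast intro: polys_belowI)
next
  fix b assume "b \<in> (\<Union>k. polys_below H z k)"
  then obtain k a where a: "range a \<subseteq> H" "b = (\<Sum>n<k. a n * z ^ n)" by (auto elim!: polys_belowE)
  let ?a = "\<lambda>n. if n < k then a n else 0"
  have "?a \<in> coeff_seqs H"
    using a(1) subalgD(2)[OF assms] by (auto simp: coeff_seqs_def intro!: finite_subset[of _ "{..<k}"])
  moreover have "b = left_poly z ?a" by (subst left_poly_bounded[of k]) (auto simp: a(2))
  ultimately show "b \<in> left_poly z ` coeff_seqs H" by blast
qed

lemma left_freeD:
  assumes "left_free H z" "subalg H" "range a \<subseteq> H" "(\<Sum>n<k. a n * z ^ n) = 0" "n < k"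
  shows "a n = 0"
proof -
  let ?a = "\<lambda>n. if n < k then a n else 0"
  have "?a \<in> coeff_seqs H" "(\<lambda>_. 0) \<in> coeff_seqs H"
    using assms(3) subalgD(2)[OF assms(2)]
    by (auto simp: coeff_seqs_def intro!: finite_subset[of _ "{..<k}"])
  moreover have "left_poly z ?a = 0" by (subst left_poly_bounded[of k]) (auto simp: assms(4))
  moreover have "left_poly z (\<lambda>_. 0) = 0" by (simp add: left_poly_def)
  ultimately have "?a = (\<lambda>_. 0)"
    using assms(1) unfolding left_free_def by (metis inj_onD)
  then show ?thesis using assms(5) by (metis)
qed

text \<open>Vanishing of the top coefficient shortens a relation by one term, so descending
  induction handles the remaining coefficients. Independence is thereby reduced to arguments on
  leading terms.\<close>

lemma left_freeI:
  assumes "subalg H"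
    and "\<And>a k. range a \<subseteq> H \<Longrightarrow> (\<Sum>n<Suc k. a n * z ^ n) = 0 \<Longrightarrow> a k = 0"
  shows "left_free H z"
  unfolding left_free_def
proof (rule inj_onI)
  fix a a' assume *: "a \<in> coeff_seqs H" "a' \<in> coeff_seqs H" "left_poly z a = left_poly z a'"
  let ?b = "\<lambda>n. a n - a' n"
  have b: "range ?b \<subseteq> H"
    using *(1,2) subalg_diff[OF assms(1)] by (auto simp: coeff_seqs_def image_subset_iff)
  have "finite ({n. a n \<noteq> 0} \<union> {n. a' n \<noteq> 0})"
    using *(1,2) by (auto simp: coeff_seqs_def)
  then obtain k where "\<forall>n\<in>{n. a n \<noteq> 0} \<union> {n. a' n \<noteq> 0}. n < k"
    unfolding finite_nat_set_iff_bounded by blast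
  then have k: "a n = 0" "a' n = 0" if "n \<ge> k" for n
    using that by (auto simp: not_less[symmetric])
  have "(\<Sum>n<k. ?b n * z ^ n) = 0"
    using *(3) left_poly_bounded[of k a z] left_poly_bounded[of k a' z] k
    by (simp add: left_diff_distrib sum_subtractf)
  then have "\<forall>n<k. ?b n = 0"
  proof (induction k)
    case (Suc k)
    have "?b k = 0" by (rule assms(2)[OF b Suc.prems])
    moreover from this have "(\<Sum>n<k. ?b n * z ^ n) = 0" using Suc.prems by simp
    ultimately show ?case using Suc.IH by (simp add: less_Suc_eq)
  qed simp
  then show "a = a'" using k by (metis eq_iff_diff_eq_0 ext not_le)
qed

text \<open>If \<open>z\<close> were 0, the coefficient sequence 0, 1 would represent 0.\<close>

lemma left_free_nonzero: "left_free H z \<Longrightarrow> subalg H \<Longrightarrow> z \<noteq> 0"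
  using left_freeD[of H z "\<lambda>n. if n = 1 then 1 else 0" 2 1] subalgD(1,2)[of H]
  by (auto simp: numeral_2_eq_2)

text \<open>The form in which independence is applied to leading terms: moving the lower part to the
  other side gives a vanishing sum with top coefficient \<open>b\<close>.\<close>

lemma monom_polys_below_eq_0:
  assumes "left_free H z" "subalg H" "b \<in> H" "b * z ^ k \<in> polys_below H z k"
  shows "b = 0"
proof -
  obtain a where a: "range a \<subseteq> H" "b * z ^ k = (\<Sum>n<k. a n * z ^ n)"
    using assms(4) by (rule polys_belowE)
  let ?a = "\<lambda>n. if n < k then - a n else b"
  have "(\<Sum>n<Suc k. ?a n * z ^ n) = 0" by (simp add: a(2) sum_negf)
  moreover have "range ?a \<subseteq> H" using a(1) assms(3) subalgD(6)[OF assms(2)] by auto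
  ultimately have "?a k = 0" using left_freeD[OF assms(1,2), of ?a "Suc k" k] by blast
  then show ?thesis by simp
qed


section \<open>Localization at the powers of an element\<close>

text \<open>\<open>denom_powers\<close> asks for all large exponents, so that finitely many elements
  share one. When \<open>z\<close> lies in \<open>U\<close>, a single exponent yields all larger
  ones.\<close>

lemma denom_powersI:
  assumes "subalg U" "z \<in> U" "b * z ^ m \<in> U"
  shows "b \<in> denom_powers U z"
proof -
  have "b * z ^ n \<in> U" if "n \<ge> m" for n
  proof -
    have "b * z ^ n = b * z ^ m * z ^ (n - m)" using that by (simp add: mult.assoc flip: power_add)
    then show ?thesis using assms by (simp add: subalgD)
  qed
  then show ?thesis unfolding denom_powers_def by (auto simp: eventually_at_top_linorder)
qed

lemma denom_powersE:
  assumes "b \<in> denom_powers U z"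
  obtains m where "b * z ^ m \<in> U"
  using assms unfolding denom_powers_def by (auto simp: eventually_at_top_linorder)

lemma denom_powers_add:
  "subalg U \<Longrightarrow> b \<in> denom_powers U z \<Longrightarrow> c \<in> denom_powers U z \<Longrightarrow> b + c \<in> denom_powers U z"
  unfolding denom_powers_def mem_Collect_eq distrib_right
  by (erule (1) eventually_elim2) (rule subalgD(3))

lemma denom_powers_minus: "subalg U \<Longrightarrow> b \<in> denom_powers U z \<Longrightarrow> - b \<in> denom_powers U z"
  unfolding denom_powers_def by (auto elim!: eventually_mono dest: subalgD(6))

lemma denom_powers_sc: "subalg U \<Longrightarrow> b \<in> denom_powers U z \<Longrightarrow> sc c b \<in> denom_powers U z"
  unfolding denom_powers_def by (auto simp: sc_mult_left elim!: eventually_mono intro: subalgD)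

lemma subset_denom_powers: "subalg U \<Longrightarrow> z \<in> U \<Longrightarrow> U \<subseteq> denom_powers U z"
  using denom_powersI[of U z _ 0] by auto

lemma denom_powers_mult_inverse:
  assumes "subalg U" "z \<in> U" "z \<noteq> 0" "b \<in> denom_powers U z"
  shows "b * inverse z ^ n \<in> denom_powers U z"
proof -
  obtain m where "b * z ^ m \<in> U" using assms(4) by (rule denom_powersE)
  moreover have "b * inverse z ^ n * z ^ (n + m) = b * z ^ m"
    using assms(3) by (simp add: power_add power_inverse mult.assoc flip: mult.assoc[of _ "z ^ n"])
  ultimately show ?thesis by (intro denom_powersI[OF assms(1,2), of _ "n + m"]) simp
qed

lemma inverse_power_mult_cancel: "z \<noteq> (0::'f) \<Longrightarrow> inverse z ^ n * (z ^ n * b) = b"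
  "z \<noteq> (0::'f) \<Longrightarrow> z ^ n * (inverse z ^ n * b) = b"
  "z \<noteq> (0::'f) \<Longrightarrow> z ^ n * inverse z ^ n = 1"
  "z \<noteq> (0::'f) \<Longrightarrow> inverse z ^ n * z ^ n = 1"
  by (simp_all add: power_inverse flip: mult.assoc)

lemma conjugate_power_self:
  assumes "z \<noteq> (0::'f)"
  shows "z ^ n * z * inverse z ^ n = z" "inverse z ^ n * z * z ^ n = z"
proof -
  have "z ^ n * z * inverse z ^ n = z * (z ^ n * inverse z ^ n)"
    by (simp only: power_commutes mult.assoc)
  then show "z ^ n * z * inverse z ^ n = z" using assms by (simp add: inverse_power_mult_cancel)
  have "inverse z ^ n * z * z ^ n = inverse z ^ n * (z ^ n * z)"
    by (simp only: power_commutes mult.assoc)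
  then show "inverse z ^ n * z * z ^ n = z" using assms by (simp add: inverse_power_mult_cancel)
qed

text \<open>For a product ab the power z^(-n) is moved through a, which turns it into some z^(-m),
  and then through b. Hence the induction has to cover all exponents n at once.\<close>

lemma right_ore_gen:
  assumes "z \<in> gen G" "z \<noteq> 0"
    and G: "\<And>g n. g \<in> G \<Longrightarrow> inverse z ^ n * g \<in> denom_powers (gen G) z"
    and "a \<in> gen G"
  shows "inverse z ^ n * a \<in> denom_powers (gen G) z"
  using assms(4)
proof (induction arbitrary: n rule: gen_induct)
  case (scalar c)
  have "sc c 1 \<in> gen G" using subalg_gen by (simp add: subalgD)
  then show ?case
    using assms(1,2) by (intro denom_powersI[of _ _ _ n] subalg_gen)
      (simp_all add: sc_mult_left sc_mult_right power_inverse)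
next
  case (incl g)
  then show ?case using G by blast
next
  case (add a b)
  then show ?case using denom_powers_add[OF subalg_gen] by (simp add: distrib_left)
next
  case (mult a b)
  from mult.IH(1) obtain m where m: "inverse z ^ n * a * z ^ m \<in> gen G" by (rule denom_powersE)
  from mult.IH(2) obtain k where k: "inverse z ^ m * b * z ^ k \<in> gen G" by (rule denom_powersE)
  have "inverse z ^ n * (a * b) * z ^ k = (inverse z ^ n * a * z ^ m) * (inverse z ^ m * b * z ^ k)"
    using assms(2) by (simp add: mult.assoc inverse_power_mult_cancel)
  then show ?case using m k subalgD(4)[OF subalg_gen] assms(1)
    by (intro denom_powersI[of _ _ _ k] subalg_gen) simp_all
qed

text \<open>Mirror image of \<open>right_ore_gen\<close>: the right factor of a product is treated
  first, and the power of \<open>z\<close> that it needs is handed to the left factor.\<close>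

lemma left_ore_gen:
  assumes "z \<in> gen G" "z \<noteq> 0"
    and G: "\<And>g n. g \<in> G \<Longrightarrow> \<exists>m. z ^ m * g * inverse z ^ n \<in> gen G"
    and "a \<in> gen G"
  shows "\<exists>m. z ^ m * a * inverse z ^ n \<in> gen G"
  using assms(4)
proof (induction arbitrary: n rule: gen_induct)
  case (scalar c)
  have "z ^ n * sc c 1 * inverse z ^ n = sc c 1"
    using assms(2) by (simp add: sc_mult_left sc_mult_right power_inverse)
  then show ?case using subalg_gen by (metis subalgD(1,5))
next
  case (incl g)
  then show ?case using G by blast
next
  case (add a b)
  have mono: "z ^ m' * c * inverse z ^ n \<in> gen G" if "z ^ m * c * inverse z ^ n \<in> gen G" "m \<le> m'" for m m' c
  proof -
    have "z ^ m' * c * inverse z ^ n = z ^ (m' - m) * (z ^ m * c * inverse z ^ n)"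
      using that(2) by (simp flip: mult.assoc power_add)
    then show ?thesis using that(1) assms(1) by (simp add: subalgD[OF subalg_gen])
  qed
  from add.IH obtain m m' where "z ^ m * a * inverse z ^ n \<in> gen G" "z ^ m' * b * inverse z ^ n \<in> gen G"
    by meson
  then have "z ^ max m m' * a * inverse z ^ n + z ^ max m m' * b * inverse z ^ n \<in> gen G"
    by (intro subalgD(3)[OF subalg_gen] mono[of m _ "max m m'"] mono[of m' _ "max m m'"]) auto
  then show ?case by (auto simp: distrib_left distrib_right)
next
  case (mult a b)
  from mult.IH(2) obtain k where k: "z ^ k * b * inverse z ^ n \<in> gen G" by meson
  from mult.IH(1) obtain m where m: "z ^ m * a * inverse z ^ k \<in> gen G" by meson
  have "z ^ m * (a * b) * inverse z ^ n = (z ^ m * a * inverse z ^ k) * (z ^ k * b * inverse z ^ n)"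
    using assms(2) by (simp add: mult.assoc inverse_power_mult_cancel)
  then show ?case using m k subalgD(4)[OF subalg_gen] by metis
qed

text \<open>By the right Ore condition a product of two fractions is again a fraction over a power
  of \<open>z\<close>. The localization is thus a subalgebra, and only generators need
  checking.\<close>

lemma gen_subset_denom_powers:
  assumes "subalg U" "z \<in> U" "z \<noteq> 0"
    and ore: "\<And>a n. a \<in> U \<Longrightarrow> inverse z ^ n * a \<in> denom_powers U z"
    and "G \<subseteq> denom_powers U z"
  shows "gen G \<subseteq> denom_powers U z"
proof (rule gen_minimal[OF _ assms(5)])
  have "a * b \<in> denom_powers U z" if a: "a \<in> denom_powers U z" and b: "b \<in> denom_powers U z" for a b
  proof -
    obtain n where n: "a * z ^ n \<in> U" using a by (rule denom_powersE)
    obtain m where m: "b * z ^ m \<in> U" using b by (rule denom_powersE)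
    obtain k where k: "inverse z ^ n * (b * z ^ m) * z ^ k \<in> U" using ore[OF m] by (rule denom_powersE)
    have "a * b * z ^ (m + k) = (a * z ^ n) * (inverse z ^ n * (b * z ^ m) * z ^ k)"
      using assms(3) by (simp add: mult.assoc inverse_power_mult_cancel power_add)
    then show ?thesis using n k assms(1,2) by (intro denom_powersI[of _ _ _ "m + k"]) (simp_all add: subalgD(4))
  qed
  moreover have "1 \<in> denom_powers U z" using subset_denom_powers[OF assms(1,2)] subalgD(1)[OF assms(1)] by blast
  ultimately show "subalg (denom_powers U z)"
    using denom_powers_add[OF assms(1)] denom_powers_sc[OF assms(1)] by (auto simp: subalg_def)
qed

lemma skew_commute_powers:
  assumes comm: "w * z = sc \<mu> (z * w)"
  shows "w ^ n * z ^ m = sc (\<mu> ^ (n * m)) (z ^ m * w ^ n)"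
proof -
  have 1: "w * z ^ m = sc (\<mu> ^ m) (z ^ m * w)" for m
  proof (induction m)
    case (Suc m)
    have "w * z ^ Suc m = sc \<mu> (z * (w * z ^ m))" by (simp add: comm sc_mult_left flip: mult.assoc)
    also have "\<dots> = sc (\<mu> ^ Suc m) (z ^ Suc m * w)" by (simp add: Suc sc_mult_right mult.assoc)
    finally show ?case .
  qed simp
  show ?thesis
  proof (induction n)
    case (Suc n)
    have "w ^ Suc n * z ^ m = w ^ n * (w * z ^ m)" by (simp add: mult.assoc power_Suc2 del: power_Suc)
    also have "\<dots> = sc (\<mu> ^ m) (w ^ n * z ^ m * w)" by (simp add: 1 sc_mult_right mult.assoc)
    also have "\<dots> = sc (\<mu> ^ (Suc n * m)) (z ^ m * w ^ Suc n)"
      by (simp add: Suc sc_mult_left mult.assoc power_add power_Suc2 del: power_Suc)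
    finally show ?case .
  qed simp
qed

text \<open>A relation over \<open>V\<close> is multiplied on the right by z^m, with m large enough
  for all its coefficients. The power z^m passes w^n with a scalar factor and clears the denominator
  of the n-th coefficient.\<close>

lemma left_free_denom_powers:
  assumes "left_free U w" "subalg U" "subalg V" "V \<subseteq> denom_powers U z" "z \<noteq> 0"
    and "\<mu> \<noteq> 0" and comm: "w * z = sc \<mu> (z * w)"
  shows "left_free V w"
proof (rule left_freeI[OF assms(3)])
  fix a k
  assume a: "range a \<subseteq> V" and zero: "(\<Sum>n<Suc k. a n * w ^ n) = 0"
  have "\<forall>n\<in>{..k}. eventually (\<lambda>m. a n * z ^ m \<in> U) at_top"
    using a assms(4) by (auto simp: denom_powers_def)
  then have "eventually (\<lambda>m. \<forall>n\<in>{..k}. a n * z ^ m \<in> U) at_top"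
    by (simp add: eventually_ball_finite_distrib)
  then obtain m where m: "\<And>n. n \<le> k \<Longrightarrow> a n * z ^ m \<in> U"
    by (auto simp: eventually_at_top_linorder)
  \<comment> \<open>The n-th coefficient after z^m has moved to the left of w^n, whence the exponent
    \<open>n * m\<close>.\<close>
  let ?b = "\<lambda>n. if n \<le> k then sc (\<mu> ^ (n * m)) (a n * z ^ m) else 0"
  have "?b n * w ^ n = a n * w ^ n * z ^ m" if "n < Suc k" for n
    using that skew_commute_powers[OF comm, of n m] by (simp add: mult.assoc sc_mult_left sc_mult_right)
  then have "(\<Sum>n<Suc k. ?b n * w ^ n) = (\<Sum>n<Suc k. a n * w ^ n) * z ^ m"
    unfolding sum_distrib_right by (intro sum.cong) auto
  moreover have "range ?b \<subseteq> U" using m subalgD[OF assms(2)] by auto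
  ultimately have "?b k = 0" using left_freeD[OF assms(1,2), of ?b "Suc k" k] zero by simp
  then show "a k = 0" using assms(5,6) by simp
qed


section \<open>The deleting derivations map\<close>

lemma q_binomial_eq_0: "n < k \<Longrightarrow> q_binomial q n k = 0"
  by (induction q n k rule: q_binomial.induct) auto

lemma q_binomial_self: "q_binomial q n n = 1"
  by (induction n) (simp_all add: q_binomial_eq_0)

text \<open>\<open>q_binomial q (Suc n) n\<close> is the q-number [n+1]; the factor q - 1 avoids
  both a quotient and the geometric sum.\<close>

lemma q_binomial_Suc_self: "(q - 1) * q_binomial q (Suc n) n = q ^ Suc n - 1"
  by (induction n) (simp_all add: q_binomial_self algebra_simps)

end

text \<open>The rules are required on \<open>H\<close> only, since transported maps are arbitrary
  elsewhere. The inverse of \<open>\<sigma>\<close> on \<open>H\<close> is a parameter of its own,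
  so that the transport of an inverse formed in the original algebra can be put in its
  place.\<close>

locale deletion = skew_field_algebra sc
  for sc :: "'k::field \<Rightarrow> 'f::division_ring \<Rightarrow> 'f" +
  fixes H :: "'f set" and \<sigma> s :: "'f \<Rightarrow> 'f" and d :: "nat \<Rightarrow> 'f \<Rightarrow> 'f" and q :: 'k and x :: 'f
  assumes subalg_H: "subalg H" and q_nonzero: "q \<noteq> 0" and q_not_1: "q \<noteq> 1"
    and sigma_closed: "r \<in> H \<Longrightarrow> \<sigma> r \<in> H" and s_closed: "r \<in> H \<Longrightarrow> s r \<in> H"
    and sigma_s: "r \<in> H \<Longrightarrow> \<sigma> (s r) = r" and s_sigma: "r \<in> H \<Longrightarrow> s (\<sigma> r) = r"
    and sigma_add: "r \<in> H \<Longrightarrow> t \<in> H \<Longrightarrow> \<sigma> (r + t) = \<sigma> r + \<sigma> t"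
    and sigma_mult: "r \<in> H \<Longrightarrow> t \<in> H \<Longrightarrow> \<sigma> (r * t) = \<sigma> r * \<sigma> t"
    and sigma_sc: "r \<in> H \<Longrightarrow> \<sigma> (sc c r) = sc c (\<sigma> r)"
    and d_closed: "r \<in> H \<Longrightarrow> d n r \<in> H"
    and d_add: "r \<in> H \<Longrightarrow> t \<in> H \<Longrightarrow> d n (r + t) = d n r + d n t"
    and d_sc: "r \<in> H \<Longrightarrow> d n (sc c r) = sc c (d n r)"
    and d_0: "r \<in> H \<Longrightarrow> d 0 r = r"
    and d_mult: "r \<in> H \<Longrightarrow> t \<in> H \<Longrightarrow> d n (r * t) = (\<Sum>i\<le>n. (\<sigma> ^^ (n - i)) (d i r) * d (n - i) t)"
    and d_sigma: "r \<in> H \<Longrightarrow> d n (\<sigma> r) = sc (q ^ n) (\<sigma> (d n r))"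
    and d_d: "r \<in> H \<Longrightarrow> d n (d m r) = sc (q_binomial q (n + m) m) (d (n + m) r)"
    and d_nilpotent: "r \<in> H \<Longrightarrow> \<exists>n0. \<forall>n\<ge>n0. d n r = 0"
    and x_comm: "r \<in> H \<Longrightarrow> x * r = \<sigma> r * x + d 1 r"
    and free: "left_free H x"
begin

definition coef :: "nat \<Rightarrow> 'k" where
  "coef n = q ^ (n * (n + 1) div 2) * inverse ((q - 1) ^ n)"

definition dterm :: "nat \<Rightarrow> 'f \<Rightarrow> 'f" where
  "dterm n r = d n ((s ^^ n) r)"

definition theta :: "'f \<Rightarrow> 'f" where
  "theta r = Sum_any (\<lambda>n. sc (coef n) (dterm n r) * inverse x ^ n)"

lemma x_nonzero: "x \<noteq> 0"
  using left_free_nonzero[OF free subalg_H] .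

lemma s_pow_closed: "r \<in> H \<Longrightarrow> (s ^^ n) r \<in> H"
  by (induction n) (simp_all add: s_closed)

lemma sigma_pow_closed: "r \<in> H \<Longrightarrow> (\<sigma> ^^ n) r \<in> H"
  by (induction n) (simp_all add: sigma_closed)

lemma sigma_inj: "r \<in> H \<Longrightarrow> t \<in> H \<Longrightarrow> \<sigma> r = \<sigma> t \<Longrightarrow> r = t"
  using s_sigma by metis

lemma s_add: "r \<in> H \<Longrightarrow> t \<in> H \<Longrightarrow> s (r + t) = s r + s t"
  by (rule sigma_inj) (simp_all add: s_closed subalgD[OF subalg_H] sigma_s sigma_add)

lemma s_mult: "r \<in> H \<Longrightarrow> t \<in> H \<Longrightarrow> s (r * t) = s r * s t"
  by (rule sigma_inj) (simp_all add: s_closed subalgD[OF subalg_H] sigma_s sigma_mult)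

lemma s_sc: "r \<in> H \<Longrightarrow> s (sc c r) = sc c (s r)"
  by (rule sigma_inj) (simp_all add: s_closed subalgD[OF subalg_H] sigma_s sigma_sc)

lemma s_pow_add: "r \<in> H \<Longrightarrow> t \<in> H \<Longrightarrow> (s ^^ n) (r + t) = (s ^^ n) r + (s ^^ n) t"
  by (induction n) (simp_all add: s_pow_closed s_add)

lemma s_pow_mult: "r \<in> H \<Longrightarrow> t \<in> H \<Longrightarrow> (s ^^ n) (r * t) = (s ^^ n) r * (s ^^ n) t"
  by (induction n) (simp_all add: s_pow_closed s_mult)

lemma s_pow_sc: "r \<in> H \<Longrightarrow> (s ^^ n) (sc c r) = sc c ((s ^^ n) r)"
  by (induction n) (simp_all add: s_pow_closed s_sc)

lemma sigma_s_pow: "r \<in> H \<Longrightarrow> (\<sigma> ^^ n) ((s ^^ n) r) = r"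
proof (induction n)
  case (Suc n)
  then show ?case
    unfolding funpow_Suc_right[of n \<sigma>] by (simp add: s_pow_closed sigma_s)
qed simp

lemma sigma_d: "r \<in> H \<Longrightarrow> \<sigma> (d n r) = sc (inverse q ^ n) (d n (\<sigma> r))"
  by (simp add: d_sigma power_mult_distrib[symmetric] q_nonzero)

lemma sigma_pow_d: "r \<in> H \<Longrightarrow> (\<sigma> ^^ m) (d n r) = sc (inverse q ^ (n * m)) (d n ((\<sigma> ^^ m) r))"
  by (induction m) (simp_all add: sigma_sc d_closed sigma_pow_closed sigma_d power_add mult.commute)

lemma sigma_eq_0: "r \<in> H \<Longrightarrow> \<sigma> r = 0 \<Longrightarrow> r = 0"
  using sigma_inj[of r 0] sigma_sc[of 0 0] subalgD(2)[OF subalg_H] by simp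

text \<open>As d_n \<sigma> is q^n \<sigma> d_n with q nonzero, the inverse of \<sigma> preserves
  the kernel of d_n. One nilpotency bound of r therefore serves all twists of r.\<close>

lemma d_s_pow_eq_0: "r \<in> H \<Longrightarrow> d n r = 0 \<Longrightarrow> d n ((s ^^ m) r) = 0"
proof (induction m arbitrary: r)
  case (Suc m)
  have "sc (q ^ n) (\<sigma> (d n (s r))) = d n r"
    using Suc.prems(1) by (simp add: d_sigma[symmetric] s_closed sigma_s)
  then have "d n (s r) = 0"
    using Suc.prems q_nonzero by (auto intro!: sigma_eq_0 simp: d_closed s_closed)
  then show ?case using Suc by (simp add: s_closed funpow_Suc_right del: funpow.simps)
qed simp

lemma dterm_closed: "r \<in> H \<Longrightarrow> dterm n r \<in> H"
  by (simp add: dterm_def d_closed s_pow_closed)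

lemma dterm_0: "r \<in> H \<Longrightarrow> dterm 0 r = r"
  by (simp add: dterm_def d_0)

lemma dterm_nilpotent:
  assumes "r \<in> H"
  obtains M where "\<And>n. n \<ge> M \<Longrightarrow> dterm n r = 0"
  using d_nilpotent[OF assms] d_s_pow_eq_0[OF assms] unfolding dterm_def by blast

lemma theta_eq_sum:
  assumes "\<And>n. n \<ge> M \<Longrightarrow> dterm n r = 0"
  shows "theta r = (\<Sum>n<M. sc (coef n) (dterm n r) * inverse x ^ n)"
proof -
  have "n < M" if "dterm n r \<noteq> 0" for n
    using that assms by (meson not_le)
  then show ?thesis
    unfolding theta_def by (intro Sum_any.expand_superset) auto
qed

lemma coef_0: "coef 0 = 1"
  by (simp add: coef_def)

lemma coef_Suc: "coef (Suc n) = coef n * q ^ Suc n * inverse (q - 1)"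
proof -
  have "Suc n * (Suc n + 1) div 2 = n * (n + 1) div 2 + Suc n"
  proof -
    have "Suc n * (Suc n + 1) = n * (n + 1) + Suc n * 2" by simp
    then show ?thesis by (simp only: div_mult_self1[of 2] )
  qed
  then show ?thesis unfolding coef_def by (simp only: power_add) (simp add: mult_ac)
qed

text \<open>The triangular numbers satisfy T(n+m) = T(n) + T(m) + nm; the factor q^(-nm) removes the
  cross term.\<close>

lemma coef_add: "coef (n + m) * inverse q ^ (n * m) = coef n * coef m"
proof (induction m)
  case (Suc m)
  have "coef (n + Suc m) * inverse q ^ (n * Suc m)
      = coef (n + m) * (q ^ (Suc m + n) * inverse q ^ n) * inverse (q - 1) * inverse q ^ (n * m)"
    by (simp add: coef_Suc power_add mult_ac)
  also have "q ^ (Suc m + n) * inverse q ^ n = q ^ Suc m"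
    using q_nonzero by (simp only: power_add) (simp add: mult.assoc flip: power_mult_distrib)
  also have "coef (n + m) * q ^ Suc m * inverse (q - 1) * inverse q ^ (n * m)
      = (coef (n + m) * inverse q ^ (n * m)) * (q ^ Suc m * inverse (q - 1))" by (simp only: mult_ac)
  also have "\<dots> = coef n * coef m * (q ^ Suc m * inverse (q - 1))" by (simp only: Suc)
  also have "\<dots> = coef n * coef (Suc m)" by (simp only: coef_Suc mult_ac)
  finally show ?case .
qed (simp add: coef_0)

lemma theta_add:
  assumes "r \<in> H" "t \<in> H"
  shows "theta (r + t) = theta r + theta t"
proof -
  obtain M where M: "\<And>n. n \<ge> M \<Longrightarrow> dterm n r = 0" using dterm_nilpotent[OF assms(1)] by blast
  obtain M' where M': "\<And>n. n \<ge> M' \<Longrightarrow> dterm n t = 0" using dterm_nilpotent[OF assms(2)] by blast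
  have add: "dterm n (r + t) = dterm n r + dterm n t" for n
    using assms by (simp add: dterm_def s_pow_add s_pow_closed d_add)
  show ?thesis
    by (subst (1 2 3) theta_eq_sum[where M = "max M M'"])
       (use M M' in \<open>simp_all add: add sc_add_right distrib_right sum.distrib\<close>)
qed

lemma theta_sc:
  assumes "r \<in> H"
  shows "theta (sc c r) = sc c (theta r)"
proof -
  obtain M where M: "\<And>n. n \<ge> M \<Longrightarrow> dterm n r = 0" using dterm_nilpotent[OF assms] by blast
  have sc: "dterm n (sc c r) = sc c (dterm n r)" for n
    using assms by (simp add: dterm_def s_pow_sc s_pow_closed d_sc)
  show ?thesis
    by (subst (1 2) theta_eq_sum[where M = M])
       (use M in \<open>simp_all add: sc sc_sum sc_mult_left mult.commute\<close>)
qed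

lemma x_theta:
  assumes "r \<in> H"
  shows "x * theta r = theta (\<sigma> r) * x"
proof -
  let ?X = "inverse x" and ?r = "\<sigma> r"
  have r: "?r \<in> H" using assms by (rule sigma_closed)
  have s_pow: "(s ^^ Suc n) ?r = (s ^^ n) r" for n
    using assms by (simp add: funpow_Suc_right s_sigma del: funpow.simps)
  have sigma_dterm: "\<sigma> (dterm n r) = sc (inverse q ^ n) (dterm n ?r)" for n
  proof -
    have "\<sigma> ((s ^^ n) r) = (s ^^ n) ?r"
      by (cases n) (use s_pow[of "n - 1"] assms in \<open>simp_all add: s_pow_closed r sigma_s\<close>)
    then show ?thesis using assms by (simp add: dterm_def sigma_d s_pow_closed)
  qed
  have d_dterm: "d 1 (dterm n r) = sc (q_binomial q (Suc n) n) (dterm (Suc n) ?r)" for n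
    using d_d[OF s_pow_closed[OF assms], of 1 n n] unfolding dterm_def s_pow by simp
  obtain M0 where M0: "\<And>n. n \<ge> M0 \<Longrightarrow> dterm n r = 0" using dterm_nilpotent[OF assms] by blast
  obtain M1 where M1: "\<And>n. n \<ge> M1 \<Longrightarrow> dterm n ?r = 0" using dterm_nilpotent[OF r] by blast
  define M where "M = max M0 M1"
  \<comment> \<open>Both sides become sums of such terms: x commutes with its inverse powers, so it
    can stand at the right end.\<close>
  define g where "g n c = sc c (dterm n ?r) * ?X ^ n * x" for n c
  \<comment> \<open>The contribution of d_1 to the coefficient of the n-th term. It stems from term
    n - 1 with the factor [n], hence is 0 at n = 0.\<close>
  define h where "h n = (case n of 0 \<Rightarrow> 0 | Suc m \<Rightarrow> coef m * q_binomial q (Suc m) m)" for n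
  have X: "?X ^ n = ?X ^ Suc n * x" for n
    using x_nonzero by (simp only: power_Suc2 mult.assoc) simp
  have xX: "x * ?X ^ n = ?X ^ n * x" for n
    using x_nonzero by (intro power_commuting_commutes[symmetric]) simp
  have q_inv: "q ^ n * inverse q ^ n = 1" for n
    using q_nonzero by (simp add: power_inverse)
  have coef_h: "coef n = coef n * inverse q ^ n + h n" for n
  proof (cases n)
    case (Suc m)
    \<comment> \<open>Multiplication by q - 1 turns [n] into q^n - 1; only q - 1 has to be cancelled
      at the end.\<close>
    have "(q - 1) * h n = coef m * ((q - 1) * q_binomial q (Suc m) m)"
      by (simp add: h_def Suc)
    also have "\<dots> = coef m * (q ^ n - 1)" by (simp only: q_binomial_Suc_self Suc)
    also have "\<dots> = coef m * q ^ n * (1 - inverse q ^ n)"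
      by (simp only: right_diff_distrib mult.assoc q_inv mult_1_right)
    also have "\<dots> = (q - 1) * (inverse (q - 1) * (coef m * q ^ n * (1 - inverse q ^ n)))"
      using q_not_1 by (simp only: mult.assoc[symmetric]) simp
    also have "\<dots> = (q - 1) * (coef n * (1 - inverse q ^ n))"
      by (simp only: Suc coef_Suc mult_ac)
    finally have "h n = coef n * (1 - inverse q ^ n)" using q_not_1 by simp
    then show ?thesis by (simp add: algebra_simps)
  qed (simp add: h_def)
  have "x * theta r = (\<Sum>n<M. sc (coef n) (x * dterm n r) * ?X ^ n)"
  proof -
    have "theta r = (\<Sum>n<M. sc (coef n) (dterm n r) * ?X ^ n)"
      by (rule theta_eq_sum) (use M0 in \<open>simp add: M_def\<close>)
    then show ?thesis by (simp add: sum_distrib_left sc_mult_right sc_mult_left mult.assoc)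
  qed
  also have "\<dots> = (\<Sum>n<M. g n (coef n * inverse q ^ n) + g (Suc n) (h (Suc n)))"
  proof (rule sum.cong)
    fix n
    have "sc (coef n) (x * dterm n r) * ?X ^ n
        = sc (coef n * inverse q ^ n) (dterm n ?r) * (x * ?X ^ n) + sc (h (Suc n)) (dterm (Suc n) ?r) * ?X ^ n"
      using assms by (simp add: x_comm dterm_closed sigma_dterm d_dterm[unfolded One_nat_def] sc_add_right
        distrib_right sc_mult_left mult.assoc h_def)
    then show "sc (coef n) (x * dterm n r) * ?X ^ n = g n (coef n * inverse q ^ n) + g (Suc n) (h (Suc n))"
      unfolding g_def xX by (simp only: X[of n, symmetric] mult.assoc)
  qed simp
  \<comment> \<open>The shifted sum gains its zeroth term, which is 0 because \<open>h 0\<close> is,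
    and the other sum is extended by its vanishing term M.\<close>
  also have "\<dots> = (\<Sum>n<Suc M. g n (coef n * inverse q ^ n)) + (\<Sum>n<Suc M. g n (h n))"
    using M1[of M] unfolding sum.distrib sum.lessThan_Suc_shift[of "\<lambda>n. g n (h n)"]
    by (simp add: g_def h_def M_def)
  also have "\<dots> = (\<Sum>n<Suc M. g n (coef n))"
  proof -
    have "g n (coef n) = g n (coef n * inverse q ^ n) + g n (h n)" for n
      unfolding g_def by (subst coef_h[of n]) (simp only: sc_add_left distrib_right)
    then show ?thesis by (simp only: sum.distrib)
  qed
  also have "\<dots> = theta ?r * x"
  proof -
    have "theta ?r = (\<Sum>n<Suc M. sc (coef n) (dterm n ?r) * ?X ^ n)"
      by (rule theta_eq_sum) (use M1 in \<open>simp add: M_def\<close>)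
    then show ?thesis by (simp only: g_def sum_distrib_right)
  qed
  finally show ?thesis .
qed

lemma dterm_eq_0: "r \<in> H \<Longrightarrow> d n r = 0 \<Longrightarrow> dterm n ((s ^^ k) r) = 0"
  using d_s_pow_eq_0[of r n "n + k"] by (simp add: dterm_def funpow_add)

lemma inverse_x_theta:
  assumes "r \<in> H"
  shows "inverse x ^ n * theta r = theta ((s ^^ n) r) * inverse x ^ n"
proof (induction n)
  case (Suc n)
  let ?r = "(s ^^ n) r"
  have "x * theta (s ?r) = theta ?r * x"
    using x_theta[OF s_closed, of ?r] assms by (simp add: s_pow_closed sigma_s)
  note comm = this
  have "theta (s ?r) * inverse x = (inverse x * x) * theta (s ?r) * inverse x"
    using x_nonzero by simp
  also have "\<dots> = inverse x * (x * theta (s ?r)) * inverse x" by (simp only: mult.assoc)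
  also have "\<dots> = inverse x * theta ?r" using x_nonzero by (simp add: comm mult.assoc)
  finally have 1: "theta (s ?r) * inverse x = inverse x * theta ?r" .
  have "inverse x ^ Suc n * theta r = inverse x * (inverse x ^ n * theta r)" by (simp add: mult.assoc)
  also have "\<dots> = theta ((s ^^ Suc n) r) * inverse x ^ Suc n"
    unfolding Suc using 1 by (simp flip: mult.assoc)
  finally show ?case .
qed simp

text \<open>The product rule produces \<sigma>^(k-i) d_i \<sigma>^(-k) in the first factor. Moving
  \<sigma>^(k-i) past d_i costs q^(-i(k-i)) and leaves d_i \<sigma>^(-i); the second factor keeps
  the twist of t by \<sigma>^(-i).\<close>

lemma dterm_mult:
  assumes "r \<in> H" "t \<in> H"
  shows "dterm k (r * t)
    = (\<Sum>i\<le>k. sc (inverse q ^ (i * (k - i))) (dterm i r * dterm (k - i) ((s ^^ i) t)))"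
proof -
  have "(\<sigma> ^^ (k - i)) (d i ((s ^^ k) r)) * d (k - i) ((s ^^ k) t)
      = sc (inverse q ^ (i * (k - i))) (dterm i r * dterm (k - i) ((s ^^ i) t))" if "i \<le> k" for i
  proof -
    have "(s ^^ k) u = (s ^^ (k - i)) ((s ^^ i) u)" for u
      using that funpow_add[of "k - i" i s] by simp
    then show ?thesis
      using assms
      by (simp add: sigma_pow_d s_pow_closed sigma_s_pow dterm_def sc_mult_left)
  qed
  then show ?thesis
    using assms by (simp add: dterm_def[of k] s_pow_mult s_pow_closed d_mult)
qed

lemma theta_mult:
  assumes "r \<in> H" "t \<in> H"
  shows "theta (r * t) = theta r * theta t"
proof -
  let ?X = "inverse x"
  obtain M where M: "\<And>n. n \<ge> M \<Longrightarrow> d n r = 0" using d_nilpotent[OF assms(1)] by blast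
  obtain M' where M': "\<And>n. n \<ge> M' \<Longrightarrow> d n t = 0" using d_nilpotent[OF assms(2)] by blast
  \<comment> \<open>If n + m is at least M + M', then n is at least M or m is at least M', and the
    product of the two terms vanishes.\<close>
  define K where "K = M + M'"
  \<comment> \<open>The (n, m) term of theta(r) theta(t) once x^(-n) has passed theta(t), which
    twists t by \<open>s ^^ n\<close>.\<close>
  define f where "f n m = sc (coef n * coef m) (dterm n r * dterm m ((s ^^ n) t)) * ?X ^ (n + m)" for n m
  have f_0: "dterm n r * dterm m ((s ^^ n) t) = 0" if "n + m \<ge> K" for n m
  proof (cases "n \<ge> M")
    case True
    then show ?thesis using dterm_eq_0[OF assms(1) M, of n 0] by simp
  next
    case False
    then have "m \<ge> M'" using that by (simp add: K_def)
    then show ?thesis using dterm_eq_0[OF assms(2) M', of m n] by simp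
  qed
  then have f_eq_0: "f n m = 0" if "n + m \<ge> K" for n m
    using that by (simp add: f_def)
  have "theta r * theta t = (\<Sum>n<K. sc (coef n) (dterm n r) * (?X ^ n * theta t))"
    using dterm_eq_0[OF assms(1) M, of _ 0]
    by (subst theta_eq_sum[where M = K]) (auto simp: K_def sum_distrib_right mult.assoc)
  also have "\<dots> = (\<Sum>n<K. \<Sum>m<K. f n m)"
  proof (rule sum.cong)
    fix n
    have "theta ((s ^^ n) t) = (\<Sum>m<K. sc (coef m) (dterm m ((s ^^ n) t)) * ?X ^ m)"
      by (rule theta_eq_sum) (use dterm_eq_0[OF assms(2) M', of _ n] in \<open>simp add: K_def\<close>)
    then show "sc (coef n) (dterm n r) * (?X ^ n * theta t) = (\<Sum>m<K. f n m)"
      by (simp add: inverse_x_theta[OF assms(2)] sum_distrib_left sum_distrib_right f_def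
        sc_mult_left sc_mult_right mult.assoc power_add add.commute[of n] mult.commute)
  qed simp
  also have "\<dots> = (\<Sum>(n, m)\<in>{..<K} \<times> {..<K}. f n m)"
    by (rule sum.cartesian_product)
  also have "\<dots> = (\<Sum>(n, m)\<in>{(n, m). n + m < K}. f n m)"
    by (rule sum.mono_neutral_right) (auto intro!: f_eq_0)
  also have "\<dots> = (\<Sum>k<K. \<Sum>i\<le>k. f i (k - i))"
    by (rule sum.triangle_reindex)
  also have "\<dots> = (\<Sum>k<K. sc (coef k) (dterm k (r * t)) * ?X ^ k)"
  proof (rule sum.cong)
    fix k
    have "coef k * inverse q ^ (i * (k - i)) = coef i * coef (k - i)" if "i \<le> k" for i
      using coef_add[of i "k - i"] that by simp
    then show "(\<Sum>i\<le>k. f i (k - i)) = sc (coef k) (dterm k (r * t)) * ?X ^ k"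
      by (simp add: dterm_mult[OF assms] sc_sum sum_distrib_right f_def)
  qed simp
  also have "\<dots> = theta (r * t)"
  proof (rule theta_eq_sum[symmetric])
    fix k assume "k \<ge> K"
    then show "dterm k (r * t) = 0"
      unfolding dterm_mult[OF assms] by (intro sum.neutral ballI) (use f_0 in auto)
  qed
  finally show ?thesis ..
qed

text \<open>Only finitely many powers of x occur in theta(r) - r, and all of them are negative, so a
  large x^K leaves a polynomial of degree below K.\<close>

lemma theta_leading_term:
  assumes "r \<in> H"
  shows "eventually (\<lambda>K. (theta r - r) * x ^ K \<in> polys_below H x K) at_top"
proof -
  obtain M where M: "\<And>n. n \<ge> M \<Longrightarrow> dterm n r = 0" using dterm_nilpotent[OF assms] by blast
  have "(theta r - r) * x ^ K \<in> polys_below H x K" if "K \<ge> M" for K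
  proof -
    have "theta r = (\<Sum>n<Suc M. sc (coef n) (dterm n r) * inverse x ^ n)"
      by (rule theta_eq_sum) (use M in simp)
    then have "theta r - r = (\<Sum>n<M. sc (coef (Suc n)) (dterm (Suc n) r) * inverse x ^ Suc n)"
      unfolding sum.lessThan_Suc_shift by (simp add: coef_0 dterm_0 assms del: power_Suc)
    moreover have "inverse x ^ n * x ^ K = x ^ (K - n)" if "n \<le> K" for n
      using that x_nonzero inverse_power_mult_cancel(1)[of x n "x ^ (K - n)"]
      by (simp flip: power_add)
    ultimately have "(theta r - r) * x ^ K
        = (\<Sum>n<M. sc (coef (Suc n)) (dterm (Suc n) r) * x ^ (K - Suc n))"
      using that by (simp add: sum_distrib_right mult.assoc del: power_Suc)
    also have "\<dots> \<in> polys_below H x K"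
      by (intro sum_in_polys_below monom_in_polys_below subalg_H subalgD(5)[OF subalg_H] dterm_closed assms)
        (use that in auto)
    finally show ?thesis .
  qed
  then show ?thesis by (auto simp: eventually_at_top_linorder)
qed

lemma theta_eq_0:
  assumes "r \<in> H" "theta r = 0"
  shows "r = 0"
proof -
  obtain K where "(theta r - r) * x ^ K \<in> polys_below H x K"
    using theta_leading_term[OF assms(1)] by (auto simp: eventually_at_top_linorder)
  then have "r * x ^ K \<in> polys_below H x K"
    using assms(2) polys_below_minus[OF subalg_H] by force
  then show ?thesis by (rule monom_polys_below_eq_0[OF free subalg_H assms(1)])
qed

lemma theta_zero: "theta 0 = 0"
  using theta_sc[of 0 0] subalgD(2)[OF subalg_H] by simp

lemma theta_inj: "inj_on theta H"
proof (rule inj_onI)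
  fix r t assume *: "r \<in> H" "t \<in> H" "theta r = theta t"
  have "theta (r - t) = theta r + theta (sc (- 1) t)"
    using theta_add[of r "sc (- 1) t"] * subalgD(5)[OF subalg_H] sc_add_left[of 1 "- 1" t]
    by (simp add: diff_conv_add_uminus eq_neg_iff_add_eq_0 minus_unique del: add_uminus_conv_diff)
  also have "\<dots> = sc 0 (theta t)"
    using * sc_add_left[of 1 "- 1" "theta t"] by (simp add: theta_sc)
  finally show "r = t" using theta_eq_0[of "r - t"] * subalg_diff[OF subalg_H] by simp
qed

text \<open>A nonzero idempotent of a skew field is 1, which avoids computing d_n at 1.\<close>

lemma theta_one: "theta 1 = 1"
proof -
  have 1: "1 \<in> H" by (rule subalgD(1)[OF subalg_H])
  then have "theta 1 * theta 1 = theta 1 * 1" "theta 1 \<noteq> 0"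
    using theta_mult[of 1 1] theta_eq_0[of 1] by auto
  then show ?thesis by (metis mult_left_cancel)
qed

lemma subalg_theta: "subalg (theta ` H)"
  unfolding subalg_def
proof (intro conjI ballI allI)
  show "1 \<in> theta ` H" using theta_one subalgD(1)[OF subalg_H] by (metis image_eqI)
  fix a assume "a \<in> theta ` H"
  then obtain r where r: "a = theta r" "r \<in> H" by auto
  show "sc c a \<in> theta ` H" for c
    using r theta_sc[of r c] subalgD(5)[OF subalg_H] by (metis image_eqI)
  fix b assume "b \<in> theta ` H"
  then obtain t where t: "b = theta t" "t \<in> H" by auto
  show "a + b \<in> theta ` H" "a * b \<in> theta ` H"
    using r t theta_add[of r t] theta_mult[of r t] subalgD(3,4)[OF subalg_H] by (metis image_eqI)+
qed

lemma theta_in_polys_below: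
  assumes "(theta r - r) * x ^ K \<in> polys_below H x K" "r \<in> H"
  shows "theta r * x ^ K \<in> polys_below H x (Suc K)"
proof -
  have "(theta r - r) * x ^ K * x ^ 0 + r * x ^ K \<in> polys_below H x (Suc K)"
    by (intro polys_below_add polys_below_mult_power[OF _ assms(1)] monom_in_polys_below subalg_H assms) auto
  then show ?thesis by (simp add: left_diff_distrib)
qed

text \<open>After multiplication by a large x^K, common to all coefficients, the top summand has
  leading term b_k x^(K+k) and everything else has lower degree. Independence over \<open>H\<close>
  then gives b_k = 0.\<close>

lemma left_free_theta: "left_free (theta ` H) x"
proof (rule left_freeI[OF subalg_theta])
  fix a k
  assume "range a \<subseteq> theta ` H" and zero: "(\<Sum>n<Suc k. a n * x ^ n) = 0"
  then have "\<forall>n. \<exists>r. r \<in> H \<and> a n = theta r" by blast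
  then obtain b where b: "\<And>n. b n \<in> H" "\<And>n. a n = theta (b n)" by metis
  have "eventually (\<lambda>K. \<forall>n\<in>{..k}. (theta (b n) - b n) * x ^ K \<in> polys_below H x K) at_top"
    using theta_leading_term[OF b(1)] by (simp add: eventually_ball_finite_distrib)
  then obtain K where K: "\<And>n. n \<le> k \<Longrightarrow> (theta (b n) - b n) * x ^ K \<in> polys_below H x K"
    by (auto simp: eventually_at_top_linorder)
  have lower: "(\<Sum>n<k. theta (b n) * x ^ K * x ^ n) \<in> polys_below H x (K + k)"
    by (intro sum_in_polys_below polys_below_mult_power[OF subalg_H theta_in_polys_below] subalg_H K b)
       auto
  have top: "(theta (b k) - b k) * x ^ K * x ^ k \<in> polys_below H x (K + k)"
    by (intro polys_below_mult_power[OF subalg_H K]) auto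
  have "0 = (\<Sum>n<Suc k. a n * x ^ n) * x ^ K" by (simp only: zero mult_zero_left)
  also have "\<dots> = (\<Sum>n<Suc k. theta (b n) * x ^ K * x ^ n)"
    unfolding sum_distrib_right
    by (intro sum.cong) (simp_all add: b(2) mult.assoc add.commute flip: power_add)
  also have "\<dots> = (\<Sum>n<k. theta (b n) * x ^ K * x ^ n) + (theta (b k) - b k) * x ^ K * x ^ k + b k * x ^ (K + k)"
    by (simp add: left_diff_distrib power_add mult.assoc)
  finally have "b k * x ^ (K + k)
      = - ((\<Sum>n<k. theta (b n) * x ^ K * x ^ n) + (theta (b k) - b k) * x ^ K * x ^ k)"
    by (rule minus_unique[OF sym, symmetric])
  then have "b k * x ^ (K + k) \<in> polys_below H x (K + k)"
    using polys_below_minus[OF subalg_H polys_below_add[OF subalg_H lower top]] by simp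
  then have "b k = 0" by (rule monom_polys_below_eq_0[OF free subalg_H b(1)])
  then show "a k = 0" by (simp add: b theta_zero)
qed

text \<open>Since \<open>r - theta r\<close> involves only terms \<open>h x\<^sup>-\<^sup>k\<close> in which \<open>h\<close> has smaller nilpotency degree than
  \<open>r\<close>, the map \<open>theta\<close> can be inverted recursively.\<close>

lemma theta_span_induct:
  assumes V: "\<And>a b. a \<in> V \<Longrightarrow> b \<in> V \<Longrightarrow> a + b \<in> V" "\<And>a. a \<in> V \<Longrightarrow> - a \<in> V" "0 \<in> V"
    and theta: "\<And>r m. r \<in> H \<Longrightarrow> theta r * inverse x ^ m \<in> V"
    and "r \<in> H"
  shows "inverse x ^ n * r * inverse x ^ m \<in> V"
proof -
  let ?X = "inverse x"
  \<comment> \<open>Induction on the nilpotency bound M, with r and the right exponent m arbitrary,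
    because the correction terms bring new ones.\<close>
  have "?X ^ n * r * ?X ^ m \<in> V" if "r \<in> H" "\<And>k. k \<ge> M \<Longrightarrow> d k r = 0" for M
    using that
  proof (induction M arbitrary: r m)
    case 0
    then show ?case using d_0[of r] V(3) by simp
  next
    case (Suc M)
    define h where "h k = sc (coef (Suc k)) (dterm (Suc k) r)" for k
    have "theta r = (\<Sum>k<Suc M. sc (coef k) (dterm k r) * ?X ^ k)"
      by (rule theta_eq_sum) (use Suc.prems dterm_eq_0[OF Suc.prems(1), of _ 0] in simp)
    then have theta_r: "theta r = r + (\<Sum>k<M. h k * ?X ^ Suc k)"
      unfolding sum.lessThan_Suc_shift by (simp add: coef_0 dterm_0 Suc.prems(1) h_def del: power_Suc)
    have h: "h k \<in> H" for k
      unfolding h_def using dterm_closed[OF Suc.prems(1)] subalgD(5)[OF subalg_H] by blast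
    \<comment> \<open>d_l d_(k+1) is a scalar multiple of d_(l+k+1), so applying d_(k+1) lowers the
      bound by at least one.\<close>
    have d_h: "d l (h k) = 0" if "l \<ge> M" for l k
    proof -
      have "d (l + Suc k) ((s ^^ Suc k) r) = 0"
        by (rule d_s_pow_eq_0) (use Suc.prems that in auto)
      then show ?thesis
        using Suc.prems(1) by (simp add: h_def d_sc d_closed dterm_def d_d s_pow_closed s_closed)
    qed
    have sum: "(\<Sum>k<M. ?X ^ n * h k * ?X ^ (Suc k + m)) \<in> V"
    proof -
      have "finite {..<M}" by simp
      moreover have "?X ^ n * h k * ?X ^ (Suc k + m) \<in> V" for k
        by (rule Suc.IH[OF h d_h])
      ultimately show ?thesis
        by (induction rule: finite_induct) (simp_all only: sum.empty sum.insert V if_True not_False_eq_True)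
    qed
    \<comment> \<open>This is x^(-n) theta(r) x^(-m) with x^(-n) moved through theta(r); subtracting
      the corrections leaves x^(-n) r x^(-m).\<close>
    have "theta ((s ^^ n) r) * ?X ^ (n + m) \<in> V"
      by (rule theta[OF s_pow_closed[OF Suc.prems(1)]])
    from V(1)[OF this V(2)[OF sum]]
    show ?case
    proof (rule back_subst[where P = "\<lambda>u. u \<in> V"])
      have "?X ^ n * theta r * ?X ^ m = theta ((s ^^ n) r) * ?X ^ (n + m)"
        using inverse_x_theta[OF Suc.prems(1)] by (simp add: power_add mult.assoc)
      moreover have "?X ^ n * theta r * ?X ^ m
          = ?X ^ n * r * ?X ^ m + (\<Sum>k<M. ?X ^ n * h k * ?X ^ (Suc k + m))"
        by (simp add: theta_r distrib_left distrib_right sum_distrib_left sum_distrib_right power_add mult.assoc)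
      ultimately show "theta ((s ^^ n) r) * ?X ^ (n + m) + - (\<Sum>k<M. ?X ^ n * h k * ?X ^ (Suc k + m))
          = ?X ^ n * r * ?X ^ m"
        by (simp add: diff_eq_eq)
    qed
  qed
  then show ?thesis using d_nilpotent[OF assms(5)] assms(5) by blast
qed

text \<open>z passes x^(-n) with the factor \<mu>^(-n) and d_n r with the factor \<mu>^n \<kappa>,
  so every term of theta(r) has weight \<kappa>. Since r is an eigenvector of \<open>s\<close>, the
  powers of \<open>s\<close> in the terms are mere scalars.\<close>

lemma theta_skew_commute:
  assumes "r \<in> H" "\<mu> \<noteq> 0" "z * x = sc \<mu> (x * z)" "s r = sc \<nu> r"
    and zd: "\<And>n. z * d n r = sc (\<mu> ^ n * \<kappa>) (d n r * z)"
  shows "z * theta r = sc \<kappa> (theta r * z)"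
proof -
  let ?X = "inverse x"
  have s_pow: "(s ^^ n) r = sc (\<nu> ^ n) r" for n
    by (induction n) (simp_all add: assms(1,4) s_sc mult.commute)
  have "z * x ^ n = sc (\<mu> ^ n) (x ^ n * z)" for n
    using skew_commute_powers[OF assms(3), of 1 n] by simp
  then have "?X ^ n * (z * x ^ n) * ?X ^ n = sc (\<mu> ^ n) (?X ^ n * (x ^ n * z) * ?X ^ n)" for n
    by (simp add: sc_mult_left sc_mult_right)
  then have zX: "?X ^ n * z = sc (\<mu> ^ n) (z * ?X ^ n)" for n
    using x_nonzero by (simp add: inverse_power_mult_cancel mult.assoc)
  have "z * (d n r * ?X ^ n) = sc \<kappa> (d n r * (?X ^ n * z))" for n
    by (simp add: zX sc_mult_left sc_mult_right mult.commute zd flip: mult.assoc)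
  then have *: "z * (sc (coef n) (dterm n r) * ?X ^ n) = sc \<kappa> (sc (coef n) (dterm n r) * ?X ^ n * z)" for n
    by (simp add: dterm_def s_pow d_sc assms(1) sc_mult_left sc_mult_right mult.assoc mult.commute mult.left_commute)
  obtain M where M: "\<And>n. n \<ge> M \<Longrightarrow> dterm n r = 0" using dterm_nilpotent[OF assms(1)] by blast
  then have "theta r = (\<Sum>n<M. sc (coef n) (dterm n r) * inverse x ^ n)" by (rule theta_eq_sum)
  then show ?thesis by (simp only: sum_distrib_left sum_distrib_right sc_sum *)
qed

text \<open>Passing x through r yields \<sigma>(r), with the same nilpotency bound, and d_1 r, whose
  bound is one lower. Hence M extra powers of x pay for all derivation terms, by induction on M and
  within it on n.\<close>

lemma power_mult_in_left_multiples:
  assumes "subalg U" "H \<subseteq> U" "x \<in> U" "r \<in> H" "\<And>k. k \<ge> M \<Longrightarrow> d k r = 0"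
  shows "\<exists>u\<in>U. x ^ (n + M) * r = u * x ^ n"
  using assms(4,5)
proof (induction M arbitrary: r n)
  case 0
  then show ?case using d_0[of r] subalgD(2)[OF assms(1)] by force
next
  case (Suc M)
  note outer = Suc.IH
  show ?case using Suc.prems
  proof (induction n arbitrary: r)
    case 0
    have "x ^ (0 + Suc M) * r * 1 = x ^ (0 + Suc M) * r * x ^ 0" by simp
    moreover have "x ^ (0 + Suc M) * r \<in> U" using 0 assms(1-3) by (auto intro!: subalgD(4,7) simp del: power_Suc)
    ultimately show ?case by auto
  next
    case (Suc n)
    have "d k (d 1 r) = 0" if "k \<ge> M" for k
      using Suc.prems(1) Suc.prems(2)[of "k + 1"] that by (simp add: d_d del: One_nat_def)
    then obtain u where u: "u \<in> U" "x ^ (Suc n + M) * d 1 r = u * x ^ Suc n"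
      using outer[OF d_closed[OF Suc.prems(1)]] by metis
    have "d k (\<sigma> r) = 0" if "k \<ge> Suc M" for k
      using Suc.prems that d_sigma[of r k] sigma_sc[of 0 0] subalgD(2)[OF subalg_H] by simp
    then obtain v where v: "v \<in> U" "x ^ (n + Suc M) * \<sigma> r = v * x ^ n"
      using Suc.IH[OF sigma_closed[OF Suc.prems(1)]] by metis
    have "x ^ (Suc n + Suc M) * r = x ^ (n + Suc M) * (x * r)"
      by (simp add: power_Suc2 mult.assoc del: power_Suc)
    also have "\<dots> = x ^ (n + Suc M) * \<sigma> r * x + x ^ (Suc n + M) * d 1 r"
      using x_comm[OF Suc.prems(1)] by (simp add: distrib_left mult.assoc)
    also have "\<dots> = (v + u) * x ^ Suc n"
      using u(2) v(2) by (simp add: distrib_right power_Suc2 mult.assoc del: power_Suc)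
    finally show ?case using u(1) v(1) subalgD(3)[OF assms(1)] by metis
  qed
qed

end

section \<open>The algebras before and after the step and their common localization\<close>

locale deletion_tail = deletion +
  fixes Y :: "'b set"
  assumes Y_skew: "y \<in> Y \<Longrightarrow> \<exists>\<mu>. \<mu> \<noteq> 0 \<and> x * y = sc \<mu> (y * x)"
begin

text \<open>\<open>Y\<close> will be the set of variables x_(j+1), ..., x_i for varying i, so that
  \<open>before\<close> and \<open>after\<close> become stage i of the old and of the new
  algebra.\<close>

definition before where "before = gen (H \<union> insert x Y)"

definition after where "after = gen (theta ` H \<union> insert x Y)"

lemma
  shows subalg_before: "subalg before" and subalg_after: "subalg after"
    and H_before: "H \<subseteq> before" and x_before: "x \<in> before" and Y_before: "Y \<subseteq> before"
    and theta_after: "theta ` H \<subseteq> after" and x_after: "x \<in> after" and Y_after: "Y \<subseteq> after"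
  using gen_incl[of "H \<union> insert x Y"] gen_incl[of "theta ` H \<union> insert x Y"]
  by (auto simp: before_def after_def subalg_gen)

lemma inverse_power_mult_Y:
  assumes "y \<in> Y"
  obtains \<mu> where "inverse x ^ n * y * x ^ n = sc \<mu> y"
proof -
  obtain \<mu> where "\<mu> \<noteq> 0" "x * y = sc \<mu> (y * x)" using Y_skew[OF assms] by blast
  then have 1: "\<mu> ^ n \<noteq> 0" "x ^ n * y = sc (\<mu> ^ n) (y * x ^ n)"
    using skew_commute_powers[of x y \<mu> n 1] by simp_all
  then have "y * x ^ n = sc (inverse (\<mu> ^ n)) (x ^ n * y)" by simp
  then have "inverse x ^ n * y * x ^ n = sc (inverse (\<mu> ^ n)) y"
    using x_nonzero by (simp add: mult.assoc sc_mult_right inverse_power_mult_cancel)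
  then show ?thesis using that by blast
qed

lemma power_mult_Y:
  assumes "y \<in> Y"
  obtains \<mu> where "x ^ n * y * inverse x ^ n = sc \<mu> y"
proof -
  obtain \<mu> where "x * y = sc \<mu> (y * x)" using Y_skew[OF assms] by blast
  then have "x ^ n * y = sc (\<mu> ^ n) (y * x ^ n)"
    using skew_commute_powers[of x y \<mu> n 1] by simp
  then have "x ^ n * y * inverse x ^ n = sc (\<mu> ^ n) y"
    using x_nonzero by (simp add: mult.assoc sc_mult_left inverse_power_mult_cancel)
  then show ?thesis using that by blast
qed

lemma theta_in_denom_powers: "r \<in> H \<Longrightarrow> theta r \<in> denom_powers before x"
proof -
  assume r: "r \<in> H"
  obtain K where "(theta r - r) * x ^ K \<in> polys_below H x K"
    using theta_leading_term[OF r] by (auto simp: eventually_at_top_linorder)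
  then have "theta r * x ^ K \<in> before"
    using theta_in_polys_below r polys_below_subset[OF subalg_before H_before x_before] by blast
  then show ?thesis by (rule denom_powersI[OF subalg_before x_before])
qed

text \<open>For r in \<open>H\<close>, \<open>theta_span_induct\<close> makes x^(-n) r a combination
  of elements theta(t) x^(-m), and these lie in the localization by
  \<open>theta_in_denom_powers\<close>. Elements of \<open>Y\<close> are passed at the cost of a
  scalar.\<close>

lemma before_right_ore:
  assumes "a \<in> before"
  shows "inverse x ^ n * a \<in> denom_powers before x"
  unfolding before_def
proof (rule right_ore_gen, fold before_def)
  fix g n assume "g \<in> H \<union> insert x Y"
  then consider "g \<in> H" | "g = x" | "g \<in> Y" by blast
  then show "inverse x ^ n * g \<in> denom_powers before x"
  proof cases
    case 1
    have "inverse x ^ n * g * inverse x ^ 0 \<in> denom_powers before x"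
      by (rule theta_span_induct[OF _ _ _ _ 1])
         (use subset_denom_powers[OF subalg_before x_before] subalgD(2)[OF subalg_before] in
          \<open>auto intro!: denom_powers_add denom_powers_minus denom_powers_mult_inverse subalg_before
            x_before x_nonzero theta_in_denom_powers\<close>)
    then show ?thesis by simp
  next
    case 2
    then show ?thesis
      using x_nonzero x_before
      by (intro denom_powersI[OF subalg_before x_before, of _ n]) (simp add: conjugate_power_self)
  next
    case 3
    then obtain \<mu> where "inverse x ^ n * g * x ^ n = sc \<mu> g" by (rule inverse_power_mult_Y)
    then show ?thesis
      using 3 Y_before subalg_before
      by (intro denom_powersI[OF subalg_before x_before, of _ n]) (auto intro: subalgD(5))
  qed
qed (use assms x_before x_nonzero in simp_all)

lemma before_left_ore:
  assumes "a \<in> before"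
  shows "\<exists>m. x ^ m * a * inverse x ^ n \<in> before"
  unfolding before_def
proof (rule left_ore_gen, fold before_def)
  fix g n assume "g \<in> H \<union> insert x Y"
  then consider "g \<in> H" | "g = x" | "g \<in> Y" by blast
  then show "\<exists>m. x ^ m * g * inverse x ^ n \<in> before"
  proof cases
    case 1
    then obtain M where "\<And>k. k \<ge> M \<Longrightarrow> d k g = 0" using d_nilpotent by blast
    then obtain u where "u \<in> before" "x ^ (n + M) * g = u * x ^ n"
      using power_mult_in_left_multiples[OF subalg_before H_before x_before 1] by blast
    then have "x ^ (n + M) * g * inverse x ^ n \<in> before"
      using x_nonzero by (simp add: mult.assoc inverse_power_mult_cancel)
    then show ?thesis ..
  next
    case 2
    then have "x ^ n * g * inverse x ^ n = x" using x_nonzero by (simp add: conjugate_power_self)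
    then show ?thesis using x_before by metis
  next
    case 3
    then obtain \<mu> where "x ^ n * g * inverse x ^ n = sc \<mu> g" by (rule power_mult_Y)
    then show ?thesis using 3 Y_before subalgD(5)[OF subalg_before] by (metis subsetD)
  qed
qed (use assms x_before x_nonzero in simp_all)

text \<open>On theta(H) there are no derivation terms: x^(-n) theta(r) x^n is theta of a twist of r,
  so every generator is cleared by the exponent n itself.\<close>

lemma after_right_ore:
  assumes "a \<in> after"
  shows "inverse x ^ n * a \<in> denom_powers after x"
  unfolding after_def
proof (rule right_ore_gen, fold after_def)
  fix g n assume "g \<in> theta ` H \<union> insert x Y"
  then consider r where "g = theta r" "r \<in> H" | "g = x" | "g \<in> Y" by blast
  then show "inverse x ^ n * g \<in> denom_powers after x"
  proof cases
    case 1
    then have "inverse x ^ n * g * x ^ n = theta ((s ^^ n) r)"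
      using x_nonzero by (simp add: inverse_x_theta mult.assoc inverse_power_mult_cancel)
    then show ?thesis
      using 1 theta_after s_pow_closed
      by (intro denom_powersI[OF subalg_after x_after, of _ n]) auto
  next
    case 2
    then show ?thesis
      using x_nonzero x_after
      by (intro denom_powersI[OF subalg_after x_after, of _ n]) (simp add: conjugate_power_self)
  next
    case 3
    then obtain \<mu> where "inverse x ^ n * g * x ^ n = sc \<mu> g" by (rule inverse_power_mult_Y)
    then show ?thesis
      using 3 Y_after subalg_after
      by (intro denom_powersI[OF subalg_after x_after, of _ n]) (auto intro: subalgD(5))
  qed
qed (use assms x_after x_nonzero in simp_all)

lemma after_left_ore:
  assumes "a \<in> after"
  shows "\<exists>m. x ^ m * a * inverse x ^ n \<in> after"
  unfolding after_def
proof (rule left_ore_gen, fold after_def)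
  fix g n assume "g \<in> theta ` H \<union> insert x Y"
  then consider r where "g = theta r" "r \<in> H" | "g = x" | "g \<in> Y" by blast
  then show "\<exists>m. x ^ m * g * inverse x ^ n \<in> after"
  proof cases
    case 1
    have "x ^ n * theta r = theta ((\<sigma> ^^ n) r) * x ^ n"
    proof (induction n)
      case (Suc n)
      have "x ^ Suc n * theta r = x * theta ((\<sigma> ^^ n) r) * x ^ n"
        using Suc by (simp add: mult.assoc)
      then show ?case using 1(2) by (simp add: x_theta sigma_pow_closed mult.assoc)
    qed simp
    then have "x ^ n * g * inverse x ^ n = theta ((\<sigma> ^^ n) r)"
      using 1 x_nonzero by (simp add: mult.assoc inverse_power_mult_cancel)
    then show ?thesis
      using 1 theta_after sigma_pow_closed by (metis image_eqI subsetD)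
  next
    case 2
    then have "x ^ n * g * inverse x ^ n = x" using x_nonzero by (simp add: conjugate_power_self)
    then show ?thesis using x_after by metis
  next
    case 3
    then obtain \<mu> where "x ^ n * g * inverse x ^ n = sc \<mu> g" by (rule power_mult_Y)
    then show ?thesis using 3 Y_after subalgD(5)[OF subalg_after] by (metis subsetD)
  qed
qed (use assms x_after x_nonzero in simp_all)

lemma after_subset: "after \<subseteq> denom_powers before x"
  unfolding after_def
  using subset_denom_powers[OF subalg_before x_before] x_before Y_before
  by (intro gen_subset_denom_powers subalg_before x_before x_nonzero before_right_ore)
     (auto intro: theta_in_denom_powers)

lemma before_subset: "before \<subseteq> denom_powers after x"
  unfolding before_def
proof (intro gen_subset_denom_powers subalg_after x_after x_nonzero after_right_ore)
  have *: "after \<subseteq> denom_powers after x" by (rule subset_denom_powers[OF subalg_after x_after])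
  \<comment> \<open>The trivial powers bring the claim into the shape of
    \<open>theta_span_induct\<close>, which expresses r through fractions theta(t) x^(-m).\<close>
  have "inverse x ^ 0 * r * inverse x ^ 0 \<in> denom_powers after x" if "r \<in> H" for r
    by (rule theta_span_induct[OF _ _ _ _ that])
       (use * theta_after subalgD(2)[OF subalg_after] in
         \<open>auto intro!: denom_powers_add denom_powers_minus denom_powers_mult_inverse subalg_after
           x_after x_nonzero\<close>)
  then show "H \<union> insert x Y \<subseteq> denom_powers after x" using * x_after Y_after by auto
qed

lemma denom_powers_eq: "denom_powers after x = denom_powers before x"
proof -
  have "b \<in> denom_powers V x"
    if b: "b \<in> denom_powers U x" and UV: "U \<subseteq> denom_powers V x" and V: "subalg V" "x \<in> V" for U V b
  proof -
    obtain n where "b * x ^ n \<in> U" using b by (rule denom_powersE)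
    then have "b * x ^ n \<in> denom_powers V x" using UV by blast
    then obtain m where "b * x ^ n * x ^ m \<in> V" by (rule denom_powersE)
    then have "b * x ^ (n + m) \<in> V" by (simp add: power_add mult.assoc)
    then show ?thesis using V by (intro denom_powersI)
  qed
  then show ?thesis
    using after_subset before_subset subalg_before subalg_after x_before x_after by blast
qed

end

section \<open>Powers of an element as an Ore set\<close>

context skew_field_algebra
begin

lemma ore_set_powers:
  assumes "z \<in> gen G" "z \<noteq> 0"
    and right: "\<And>a n. a \<in> gen G \<Longrightarrow> inverse z ^ n * a \<in> denom_powers (gen G) z"
    and left: "\<And>a n. a \<in> gen G \<Longrightarrow> \<exists>m. z ^ m * a * inverse z ^ n \<in> gen G"
  shows "ore_set (alg_gen (ambient sc) G) {z ^ n | n. True}"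
  unfolding ore_set_def alg_gen_simps carrier_alg_gen_ambient ambient_simps
proof (intro conjI ballI)
  show "{z ^ n | n. True} \<subseteq> gen G" using assms(1) subalgD(7)[OF subalg_gen] by blast
  show "1 \<in> {z ^ n | n. True}" by (auto intro!: exI[of _ 0])
  fix s assume "s \<in> {z ^ n | n. True}"
  then obtain n where n: "s = z ^ n" by blast
  show "s * t \<in> {z ^ n | n. True}" if t: "t \<in> {z ^ n | n. True}" for t
  proof -
    obtain m where "t = z ^ m" using t by blast
    then have "s * t = z ^ (n + m)" by (simp add: n power_add)
    then show ?thesis by blast
  qed
  fix a assume a: "a \<in> gen G"
  show "s * a = 0 \<longrightarrow> a = 0" "a * s = 0 \<longrightarrow> a = 0" using n assms(2) by auto
next
  fix a s assume a: "a \<in> gen G" and "s \<in> {z ^ n | n. True}"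
  then obtain n where n: "s = z ^ n" by blast
  obtain m where "inverse z ^ n * a * z ^ m \<in> gen G" using right[OF a] by (rule denom_powersE)
  moreover have "a * z ^ m = s * (inverse z ^ n * a * z ^ m)"
    using assms(2) by (simp add: n mult.assoc inverse_power_mult_cancel)
  ultimately show "\<exists>b\<in>gen G. \<exists>t\<in>{z ^ n | n. True}. a * t = s * b" by blast
  obtain m where "z ^ m * a * inverse z ^ n \<in> gen G" using left[OF a] by blast
  moreover have "z ^ m * a = z ^ m * a * inverse z ^ n * s"
    using assms(2) by (simp add: n mult.assoc inverse_power_mult_cancel)
  ultimately show "\<exists>b\<in>gen G. \<exists>t\<in>{z ^ n | n. True}. t * a = b * s" by blast
qed

lemma right_fractions_powers:
  assumes "z \<in> gen G" "z \<noteq> 0"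
  shows "right_fractions (alg_gen (ambient sc) G) {z ^ n | n. True} = denom_powers (gen G) z"
proof (intro equalityI subsetI)
  fix b assume "b \<in> right_fractions (alg_gen (ambient sc) G) {z ^ n | n. True}"
  then obtain a n where "a \<in> gen G" "b = a * inverse (z ^ n)" by (auto simp: right_fractions_def)
  then show "b \<in> denom_powers (gen G) z"
    using assms by (intro denom_powersI[OF subalg_gen, of _ _ _ n]) (auto simp: mult.assoc)
next
  fix b assume "b \<in> denom_powers (gen G) z"
  then obtain m where m: "b * z ^ m \<in> gen G" by (rule denom_powersE)
  moreover have "b = b * z ^ m * inverse (z ^ m)" using assms(2) by (simp add: mult.assoc)
  ultimately show "b \<in> right_fractions (alg_gen (ambient sc) G) {z ^ n | n. True}"
    unfolding right_fractions_def by auto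
qed


section \<open>Ore extensions inside a skew field\<close>

lemma conjugate_mult: "z \<noteq> 0 \<Longrightarrow> conjugate z (a * b) = conjugate z a * conjugate z b"
  by (simp add: conjugate_def mult.assoc) (simp flip: mult.assoc)

lemma conjugate_add: "conjugate z (a + b) = conjugate z a + conjugate z b"
  by (simp add: conjugate_def distrib_left distrib_right)

lemma conjugate_sc: "conjugate z (sc c a) = sc c (conjugate z a)"
  by (simp add: conjugate_def sc_mult_left sc_mult_right)

lemma conjugate_one: "z \<noteq> 0 \<Longrightarrow> conjugate z 1 = 1"
  by (simp add: conjugate_def)

lemma conjugate_conj_inverse: "z \<noteq> 0 \<Longrightarrow> conjugate z (conjugate (inverse z) a) = a"
  by (simp add: conjugate_def mult.assoc) (simp flip: mult.assoc)

lemma conjugate_inverse_conj: "z \<noteq> 0 \<Longrightarrow> conjugate (inverse z) (conjugate z a) = a"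
  by (simp add: conjugate_def mult.assoc) (simp flip: mult.assoc)

lemma conjugate_mult_self: "z \<noteq> 0 \<Longrightarrow> conjugate z a * z = z * a"
  by (simp add: conjugate_def mult.assoc)

lemma conjugate_eqI: "z \<noteq> 0 \<Longrightarrow> z * a = b * z \<Longrightarrow> conjugate z a = b"
  by (simp add: conjugate_def mult.assoc)

text \<open>A homomorphism that scales the generators maps the generated algebra into itself.
  Conjugation by the inverse of \<open>z\<close> scales by the inverse scalars, which gives the
  other inclusion.\<close>

lemma conjugate_gen:
  assumes "z \<noteq> 0" "\<And>g. g \<in> G \<Longrightarrow> \<exists>\<mu>. \<mu> \<noteq> 0 \<and> conjugate z g = sc \<mu> g"
  shows "conjugate z ` gen G = gen G"
proof -
  have sub: "conjugate w a \<in> gen G"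
    if w: "w \<noteq> 0" and G: "\<And>g. g \<in> G \<Longrightarrow> \<exists>\<mu>. conjugate w g = sc \<mu> g" and "a \<in> gen G" for w a
    using that(3)
  proof (induction rule: gen_induct)
    case (scalar c)
    then show ?case by (simp add: conjugate_sc conjugate_one w subalgD[OF subalg_gen])
  next
    case (incl g)
    then show ?case using G[of g] gen_incl[of G] subalgD(5)[OF subalg_gen] by auto
  qed (simp_all add: conjugate_add conjugate_mult w subalgD[OF subalg_gen])
  have "\<exists>\<mu>. conjugate (inverse z) g = sc \<mu> g" if g: "g \<in> G" for g
  proof -
    obtain \<mu> where \<mu>: "\<mu> \<noteq> 0" "conjugate z g = sc \<mu> g" using assms(2)[OF g] by blast
    then have "g = sc \<mu> (conjugate (inverse z) g)"
      by (metis conjugate_inverse_conj[OF assms(1)] conjugate_sc)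
    then have "sc (inverse \<mu>) g = conjugate (inverse z) g"
      using \<mu>(1) by (metis sc_sc left_inverse sc_one)
    then show ?thesis by metis
  qed
  then have "conjugate (inverse z) a \<in> gen G" if "a \<in> gen G" for a
    using sub[of "inverse z"] assms(1) that by auto
  then have "a \<in> conjugate z ` gen G" if "a \<in> gen G" for a
    using that conjugate_conj_inverse[OF assms(1)] by (metis image_eqI)
  moreover have "conjugate z a \<in> gen G" if "a \<in> gen G" for a
    using sub[OF assms(1) _ that] assms(2) by blast
  ultimately show ?thesis by blast
qed

lemma polys_below_mult:
  assumes "subalg H" "z \<noteq> 0" "conjugate z ` H \<subseteq> H" "b \<in> polys_below H z k" "c \<in> polys_below H z l"
  shows "b * c \<in> polys_below H z (k + l)"
proof -
  obtain a where a: "range a \<subseteq> H" "b = (\<Sum>n<k. a n * z ^ n)" using assms(4) by (rule polys_belowE)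
  obtain a' where a': "range a' \<subseteq> H" "c = (\<Sum>n<l. a' n * z ^ n)" using assms(5) by (rule polys_belowE)
  have comm: "z ^ n * h = (conjugate z ^^ n) h * z ^ n" for n h
  proof (induction n)
    case (Suc n)
    have "z ^ Suc n * h = z * (conjugate z ^^ n) h * z ^ n" using Suc by (simp add: mult.assoc)
    also have "z * (conjugate z ^^ n) h = (conjugate z ^^ Suc n) h * z"
      using assms(2) by (simp add: conjugate_mult_self)
    finally show ?case by (simp add: mult.assoc)
  qed simp
  have closed: "(conjugate z ^^ n) h \<in> H" if "h \<in> H" for n h
    by (induction n) (use that assms(3) in auto)
  have "a n * z ^ n * (a' m * z ^ m) = (a n * (conjugate z ^^ n) (a' m)) * z ^ (n + m)" for n m
  proof -
    have "a n * z ^ n * (a' m * z ^ m) = a n * (z ^ n * a' m) * z ^ m" by (simp add: mult.assoc)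
    then show ?thesis unfolding comm by (simp add: mult.assoc power_add)
  qed
  then have "b * c = (\<Sum>n<k. \<Sum>m<l. (a n * (conjugate z ^^ n) (a' m)) * z ^ (n + m))"
    by (simp add: a(2) a'(2) sum_product)
  also have "\<dots> \<in> polys_below H z (k + l)"
    by (intro sum_in_polys_below monom_in_polys_below subalgD(4)[OF assms(1)] closed assms(1))
       (use a(1) a'(1) in auto)
  finally show ?thesis .
qed

text \<open>Conjugation lets \<open>z\<close> pass coefficients, so the polynomials with
  coefficients on the left are closed under products and already form a subalgebra.\<close>

lemma gen_insert_normal:
  assumes "z \<noteq> 0" "conjugate z ` gen G = gen G"
  shows "gen (insert z G) = (\<Union>k. polys_below (gen G) z k)"
proof (intro equalityI gen_minimal)
  have mono: "b \<in> polys_below (gen G) z k \<Longrightarrow> k \<le> l \<Longrightarrow> b \<in> polys_below (gen G) z l" for b k l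
    using polys_below_mult_power[OF subalg_gen, of b G z k 0 l] by simp
  have incl: "a \<in> (\<Union>k. polys_below (gen G) z k)" if "a \<in> gen G" for a
    using monom_in_polys_below[OF subalg_gen that, of 0 1 z] by auto
  have "1 * z ^ 1 \<in> polys_below (gen G) z 2"
    by (intro monom_in_polys_below subalg_gen subalgD(1)[OF subalg_gen]) simp
  then show "insert z G \<subseteq> (\<Union>k. polys_below (gen G) z k)"
    using incl gen_incl[of G] by (auto simp del: UN_iff)
  show "subalg (\<Union>k. polys_below (gen G) z k)"
    unfolding subalg_def
  proof (intro conjI ballI allI)
    show "1 \<in> (\<Union>k. polys_below (gen G) z k)" by (rule incl[OF subalgD(1)[OF subalg_gen]])
    fix a assume "a \<in> (\<Union>k. polys_below (gen G) z k)"
    then obtain k where k: "a \<in> polys_below (gen G) z k" by blast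
    have "sc c 1 \<in> polys_below (gen G) z 1" for c
      using monom_in_polys_below[OF subalg_gen subalgD(5)[OF subalg_gen subalgD(1)[OF subalg_gen]], of 0 1] by simp
    then show "sc c a \<in> (\<Union>k. polys_below (gen G) z k)" for c
      using polys_below_mult[OF subalg_gen assms(1) _ _ k, of "sc c 1" 1] assms(2) sc_conv_mult[of c a] by auto
    fix b assume "b \<in> (\<Union>k. polys_below (gen G) z k)"
    then obtain l where l: "b \<in> polys_below (gen G) z l" by blast
    show "a * b \<in> (\<Union>k. polys_below (gen G) z k)"
      using polys_below_mult[OF subalg_gen assms(1) _ k l] assms(2) by blast
    have "a + b \<in> polys_below (gen G) z (max k l)"
      by (intro polys_below_add subalg_gen mono[OF k] mono[OF l]) auto
    then show "a + b \<in> (\<Union>k. polys_below (gen G) z k)" by blast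
  qed
  show "(\<Union>k. polys_below (gen G) z k) \<subseteq> gen (insert z G)"
    by (intro UN_least polys_below_subset subalg_gen gen_mono)
       (use gen_incl[of "insert z G"] in auto)
qed

lemma finsum_alg_gen:
  assumes "finite I" "\<And>i. i \<in> I \<Longrightarrow> f i \<in> gen G"
  shows "(\<Oplus>\<^bsub>alg_gen (ambient sc) G\<^esub>i\<in>I. f i) = sum f I"
proof -
  interpret ring "alg_gen (ambient sc) G"
    by (rule k_algebraD(1)[OF k_subalgebraD(1)[OF alg_gen_subalgebra[OF algebra]]]) simp
  show ?thesis
    using assms by (induction I) (simp_all add: Pi_def)
qed

lemma nat_pow_alg_gen: "z [^]\<^bsub>alg_gen (ambient sc) G\<^esub> (n::nat) = z ^ n"
  by (induction n) (simp_all add: nat_pow_def power_Suc2 del: power_Suc)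

text \<open>Passage from records to plain sums: the unique existence in \<open>ore_extension\<close>
  splits into injectivity and surjectivity of \<open>left_poly\<close>.\<close>

lemma ore_basis_iff:
  assumes "gen G \<subseteq> gen G'" "z \<in> gen G'"
  shows "(\<forall>b\<in>gen G'. \<exists>!r. range r \<subseteq> gen G \<and> finite {n. r n \<noteq> 0} \<and>
      b = (\<Oplus>\<^bsub>alg_gen (ambient sc) G'\<^esub>n\<in>{n. r n \<noteq> 0}. r n * z ^ n))
    \<longleftrightarrow> left_free (gen G) z \<and> left_poly z ` coeff_seqs (gen G) = gen G'" (is "?L \<longleftrightarrow> ?R")
proof -
  have "(\<Oplus>\<^bsub>alg_gen (ambient sc) G'\<^esub>n\<in>{n. r n \<noteq> 0}. r n * z ^ n) = left_poly z r"
    if "range r \<subseteq> gen G" "finite {n. r n \<noteq> 0}" for r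
    unfolding left_poly_def
    by (rule finsum_alg_gen) (use that assms in \<open>auto intro!: subalgD[OF subalg_gen]\<close>)
  then have "?L \<longleftrightarrow> (\<forall>b\<in>gen G'. \<exists>!r. r \<in> coeff_seqs (gen G) \<and> b = left_poly z r)"
    by (intro ball_cong arg_cong[where f = Ex1] ext) (auto simp: coeff_seqs_def)
  also have "\<dots> \<longleftrightarrow> ?R"
  proof -
    have "left_poly z r \<in> gen G'" if "r \<in> coeff_seqs (gen G)" for r
      using that assms by (auto simp: left_poly_def coeff_seqs_def intro!: subalgD[OF subalg_gen])
    then show ?thesis unfolding left_free_def inj_on_def by blast
  qed
  finally show ?thesis .
qed

lemma ore_extension_left_free:
  assumes "ore_extension (alg_gen (ambient sc) G) (alg_gen (ambient sc) G') z \<sigma> \<delta>"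
  shows "left_free (gen G) z" "left_poly z ` coeff_seqs (gen G) = gen G'"
proof -
  have "k_subalgebra (alg_gen (ambient sc) G) (alg_gen (ambient sc) G')" "z \<in> gen G'"
    and basis: "\<forall>b\<in>gen G'. \<exists>!r. range r \<subseteq> gen G \<and> finite {n. r n \<noteq> 0} \<and>
      b = (\<Oplus>\<^bsub>alg_gen (ambient sc) G'\<^esub>n\<in>{n. r n \<noteq> 0}. r n * z ^ n)"
    using assms by (simp_all add: ore_extension_def nat_pow_alg_gen)
  then have "gen G \<subseteq> gen G'" "z \<in> gen G'" using k_subalgebraD(4) by fastforce+
  then show "left_free (gen G) z" "left_poly z ` coeff_seqs (gen G) = gen G'"
    using ore_basis_iff basis by blast+
qed

text \<open>Normality makes the polynomials in \<open>z\<close> fill the generated algebra,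
  independence makes their coefficients unique; these are the two halves of
  \<open>ore_basis_iff\<close>. Conjugation moves \<open>z\<close> past coefficients without
  remainder, whence the zero derivation.\<close>

lemma ore_extension_conjugate:
  assumes free: "left_free (gen G) z" and normal: "conjugate z ` gen G = gen G"
  shows "ore_extension (alg_gen (ambient sc) G) (alg_gen (ambient sc) (insert z G)) z (conjugate z) (\<lambda>_. 0)"
proof -
  have z: "z \<noteq> 0" by (rule left_free_nonzero[OF free subalg_gen])
  have sub: "k_subalgebra (alg_gen (ambient sc) G) (alg_gen (ambient sc) (insert z G))"
    by (rule alg_gen_mono_subalgebra[OF algebra]) auto
  have inj: "inj_on (conjugate z) (gen G)" by (metis conjugate_inverse_conj[OF z] inj_onI)
  have "conjugate z \<in> k_alg_iso (alg_gen (ambient sc) G) (alg_gen (ambient sc) G)"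
    by (intro k_alg_isoI k_alg_homI)
       (use normal inj in \<open>auto simp: conjugate_mult conjugate_add conjugate_sc conjugate_one z bij_betw_def\<close>)
  moreover have "skew_derivation (alg_gen (ambient sc) G) (conjugate z) (\<lambda>_. 0)"
    by (auto simp: skew_derivation_def k_linear_on_def intro: subalgD(2)[OF subalg_gen])
  moreover have "z * r = conjugate z r * z + 0" for r
    using z by (simp add: conjugate_def mult.assoc)
  moreover have "gen G \<subseteq> gen (insert z G)" by (rule gen_mono) auto
  moreover have "z \<in> gen (insert z G)" using gen_incl[of "insert z G"] by simp
  moreover have "left_poly z ` coeff_seqs (gen G) = gen (insert z G)"
    by (simp only: left_poly_image[OF subalg_gen] gen_insert_normal[OF z normal])
  ultimately show ?thesis
    using sub free ore_basis_iff[of G "insert z G" z]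
    by (simp add: ore_extension_def nat_pow_alg_gen)
qed

text \<open>Expand in powers of \<open>z\<close>, apply \<open>f\<close> to the coefficients and
  reassemble with \<open>z'\<close>. A bare bijection fixing 0 keeps supports, and a bijection is
  all that pulling back a structure asks for.\<close>

lemma extend_bij_betw:
  fixes T T' E E' :: "'f set"
  assumes z: "left_free T z" "left_poly z ` coeff_seqs T = E" and z': "left_free T' z'" "left_poly z' ` coeff_seqs T' = E'"
    and f: "bij_betw f T T'" "f 0 = 0" and "0 \<in> T"
  obtains g where "bij_betw g E E'" "\<And>t. t \<in> T \<Longrightarrow> g t = f t"
proof -
  have f_0: "f a = 0 \<longleftrightarrow> a = 0" if "a \<in> T" for a
    using that f assms(7) by (metis bij_betw_imp_inj_on inj_onD)
  have supp: "{n. f (a n) \<noteq> 0} = {n. a n \<noteq> 0}" if "range a \<subseteq> T" for a :: "nat \<Rightarrow> 'f"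
    using that f_0 by blast
  have bij: "bij_betw (left_poly z) (coeff_seqs T) E" "bij_betw (left_poly z') (coeff_seqs T') E'"
    using z z' by (simp_all add: bij_betw_def left_free_def)
  have "bij_betw ((\<circ>) f) (coeff_seqs T) (coeff_seqs T')"
    unfolding bij_betw_def
  proof (intro conjI equalityI subsetI inj_onI)
    fix a b assume "a \<in> coeff_seqs T" "b \<in> coeff_seqs T" and *: "f \<circ> a = f \<circ> b"
    then have "a n \<in> T" "b n \<in> T" for n by (auto simp: coeff_seqs_def)
    then show "a = b" using f(1) * by (metis bij_betw_imp_inj_on comp_apply ext inj_onD)
  next
    fix a assume "a \<in> (\<circ>) f ` coeff_seqs T"
    then obtain b where "a = f \<circ> b" "range b \<subseteq> T" "finite {n. b n \<noteq> 0}" by (auto simp: coeff_seqs_def)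
    then show "a \<in> coeff_seqs T'" using f(1) supp[of b] by (auto simp: coeff_seqs_def bij_betw_def)
  next
    fix a assume "a \<in> coeff_seqs T'"
    then have a: "range a \<subseteq> f ` T" "finite {n. a n \<noteq> 0}" using f(1) by (auto simp: coeff_seqs_def bij_betw_def)
    let ?b = "inv_into T f \<circ> a"
    have b: "range ?b \<subseteq> T" "f \<circ> ?b = a"
      using a(1) by (auto simp: fun_eq_iff inv_into_into f_inv_into_f subset_iff)
    then have "?b \<in> coeff_seqs T" using supp[OF b(1)] a(2) by (auto simp: coeff_seqs_def fun_eq_iff)
    then show "a \<in> (\<circ>) f ` coeff_seqs T" using b(2) by (metis image_eqI)
  qed
  then have "bij_betw (left_poly z' \<circ> ((\<circ>) f \<circ> inv_into (coeff_seqs T) (left_poly z))) E E'"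
    using bij by (intro bij_betw_trans[OF bij_betw_trans[OF bij_betw_inv_into]])
  moreover have "(left_poly z' \<circ> ((\<circ>) f \<circ> inv_into (coeff_seqs T) (left_poly z))) t = f t" if t: "t \<in> T" for t
  proof -
    \<comment> \<open>The coefficients of a constant polynomial. As \<open>f 0 = 0\<close>,
      composing with \<open>f\<close> gives the coefficients of the constant
      \<open>f t\<close>.\<close>
    let ?c = "\<lambda>t n. if n = (0::nat) then t else (0::'f)"
    have c: "left_poly w (?c t) = t" for t w
      using left_poly_bounded[of 1 "?c t" w] by simp
    have "?c t \<in> coeff_seqs T"
      using t assms(7) by (auto simp: coeff_seqs_def intro!: finite_subset[of _ "{0}"])
    then have "inv_into (coeff_seqs T) (left_poly z) t = ?c t"
      using inv_into_f_f[of "left_poly z" "coeff_seqs T" "?c t"] z(1) c by (simp add: left_free_def)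
    moreover have "f \<circ> ?c t = ?c (f t)" using f(2) by auto
    ultimately show ?thesis using c by (metis comp_apply)
  qed
  ultimately show ?thesis using that by blast
qed

end


section \<open>The deletion step\<close>

lemma k_subalgebra_trans: "k_subalgebra R S \<Longrightarrow> k_subalgebra S T \<Longrightarrow> k_subalgebra R T"
  using k_alg_hom_comp[of "\<lambda>a. a" R S "\<lambda>a. a" T] by (simp add: k_subalgebra_def)

lemma k_subalgebra_of_subset:
  assumes "k_subalgebra R T" "k_subalgebra S T" "carrier R \<subseteq> carrier S"
  shows "k_subalgebra R S"
  using k_alg_hom_corestrict[OF k_subalgebraD(3)[OF assms(1)] assms(2)] assms
  by (simp add: k_subalgebra_def)

locale deletion_data = skew_field_algebra sc
  for sc :: "'k::field \<Rightarrow> 'f::division_ring \<Rightarrow> 'f" +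
  fixes N j :: nat
    and A B :: "('k, 'a) module"
    and X Z :: "nat \<Rightarrow> 'a"
    and \<sigma> \<delta> \<tau> :: "nat \<Rightarrow> 'a \<Rightarrow> 'a"
    and d :: "nat \<Rightarrow> nat \<Rightarrow> 'a \<Rightarrow> 'a"
    and \<Lambda> :: "nat \<Rightarrow> nat \<Rightarrow> 'k"
    and q :: "nat \<Rightarrow> 'k"
    and x :: "nat \<Rightarrow> 'f"
    and \<phi> :: "'f \<Rightarrow> 'a"
  assumes qna: "quantum_nilpotent_algebra N A X \<sigma> \<delta> \<Lambda> q d"
    and j: "j \<in> {2..N}"
    and B: "skew_tail_extension N A X \<sigma> \<delta> j B Z \<tau>"
    and phi: "\<phi> \<in> k_alg_iso (stage (ambient sc) x N) B" "\<And>i. i \<in> {1..N} \<Longrightarrow> \<phi> (x i) = Z i"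
    and eig: "\<And>i l. i \<in> {j+1..N} \<Longrightarrow> l \<in> {1..i-1} \<Longrightarrow> \<tau> i (Z l) = \<Lambda> i l \<odot>\<^bsub>B\<^esub> Z l"
    and comm: "\<And>i l n a. i \<in> {j+1..N} \<Longrightarrow> l \<in> {2..j} \<Longrightarrow> a \<in> carrier (stage A X (l - 1)) \<Longrightarrow>
                 \<tau> i (d l n a) = \<Lambda> i l ^ n \<odot>\<^bsub>B\<^esub> d l n (\<tau> i a)"
begin

lemma iterated_A: "iterated_ore_extension N A X \<sigma> \<delta>"
  and sigma_X: "i \<in> {2..N} \<Longrightarrow> l \<in> {1..<i} \<Longrightarrow> \<sigma> i (X l) = \<Lambda> i l \<odot>\<^bsub>A\<^esub> X l"
  and Lambda_nonzero: "i \<in> {1..N} \<Longrightarrow> l \<in> {1..N} \<Longrightarrow> \<Lambda> i l \<noteq> 0"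
  and qj: "q j \<noteq> 0" "q j \<noteq> 1"
  and higher: "i \<in> {2..N} \<Longrightarrow> higher_skew_derivation (stage A X (i - 1)) (q i) (\<sigma> i) (\<delta> i) (d i)"
  and nilp: "locally_nilpotent (stage A X (j - 1)) (d j)"
  and iter: "iterative (stage A X (j - 1)) (q j) (d j)"
  and comm_A: "i \<in> {2..N} \<Longrightarrow> l \<in> {i+1..N} \<Longrightarrow> a \<in> carrier (stage A X (i - 1)) \<Longrightarrow>
        \<sigma> l (d i n a) = \<Lambda> l i ^ n \<odot>\<^bsub>A\<^esub> d i n (\<sigma> l a)"
  using qna j unfolding quantum_nilpotent_algebra_def by blast+

text \<open>Keeps the index sets \<open>{1..i-1}\<close> in the form in which they are
  stated.\<close>

declare One_nat_def [simp del]

lemma j_bounds [simp]: "2 \<le> j" "j \<le> N" "1 \<le> j" "j - 1 \<le> N" "j - 1 \<le> j" "j \<in> {1..N}" "j \<in> {2..N}"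
  using j by auto

lemma pred_le: "i \<in> {1..N} \<Longrightarrow> i - 1 \<le> N"
  by (meson atLeastAtMost_iff diff_le_self le_trans)

lemma A_algebra: "k_algebra A" and X_carrier: "X ` {1..N} \<subseteq> carrier A"
  using iterated_A unfolding iterated_ore_extension_def by blast+

lemma X_image: "i \<le> N \<Longrightarrow> X ` {1..i} \<subseteq> carrier A"
  using X_carrier by (auto simp: image_subset_iff)

lemma A_sub_B: "k_subalgebra (stage A X j) B"
  and Z_eq_X: "l \<in> {1..j} \<Longrightarrow> Z l = X l"
  and iterated_B: "iterated_ore_extension N B Z (\<lambda>i. if i \<le> j then \<sigma> i else \<tau> i)
      (\<lambda>i. if i \<le> j then \<delta> i else (\<lambda>_. \<zero>\<^bsub>B\<^esub>))"
  using B by (simp_all add: skew_tail_extension_def)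

lemma B_algebra: "k_algebra B" and Z_carrier: "Z ` {1..N} \<subseteq> carrier B"
  and ore_B: "i \<in> {1..N} \<Longrightarrow> ore_extension (stage B Z (i - 1)) (stage B Z i) (Z i)
      (if i \<le> j then \<sigma> i else \<tau> i) (if i \<le> j then \<delta> i else (\<lambda>_. \<zero>\<^bsub>B\<^esub>))"
  using iterated_B unfolding iterated_ore_extension_def by blast+

lemma Z_image: "i \<le> N \<Longrightarrow> Z ` {1..i} \<subseteq> carrier B"
  using Z_carrier by (auto simp: image_subset_iff)

lemma stage_A_sub: "i \<le> l \<Longrightarrow> l \<le> N \<Longrightarrow> k_subalgebra (stage A X i) (stage A X l)"
  by (intro alg_gen_mono_subalgebra A_algebra X_image) auto

lemma stage_A_sub_B: "i \<le> j \<Longrightarrow> k_subalgebra (stage A X i) B"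
  using j by (intro k_subalgebra_trans[OF stage_A_sub A_sub_B]) auto

lemma stage_B_sub: "i \<le> N \<Longrightarrow> k_subalgebra (stage B Z i) B"
  by (intro alg_gen_subalgebra B_algebra Z_image)

text \<open>Stage j of \<open>A\<close> lies in \<open>B\<close> with its operations, so generating
  by X_1, ..., X_i inside \<open>A\<close> or inside \<open>B\<close> gives the same set, although
  the two products may differ beyond stage j.\<close>

lemma stage_B_eq:
  assumes "i \<le> j"
  shows "carrier (stage B Z i) = carrier (stage A X i)"
proof -
  have X: "X ` {1..i} \<subseteq> carrier (stage A X j)"
    using assms by (intro order_trans[OF _ alg_gen_incl]) auto
  have "Z ` {1..i} = X ` {1..i}" using Z_eq_X assms by (intro image_cong) auto
  moreover have "X ` {1..j} \<subseteq> carrier A" by (simp add: X_image)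
  ultimately show ?thesis
    using alg_gen_of_subalgebra[OF A_sub_B X] alg_gen_alg_gen[OF A_algebra _ X] by simp
qed

section \<open>The copy of \<open>B\<close> inside the skew field\<close>

definition psi :: "'a \<Rightarrow> 'f" where
  "psi = inv_into (carrier (stage (ambient sc) x N)) \<phi>"

lemma F_stage_algebra: "k_algebra (stage (ambient sc) w i)"
  by (rule k_subalgebraD(1)[OF alg_gen_subalgebra[OF algebra]]) simp

lemma psi_iso: "psi \<in> k_alg_iso B (stage (ambient sc) x N)"
  unfolding psi_def by (rule k_alg_iso_inv_into[OF F_stage_algebra phi(1)])

lemma psi_hom: "psi \<in> k_alg_hom B (ambient sc)"
  using k_alg_hom_comp[OF k_alg_isoD(1)[OF psi_iso]
      k_subalgebraD(3)[OF alg_gen_subalgebra[OF algebra, of "x ` {1..N}"]]] by simp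

lemma psi_inj: "inj_on psi (carrier B)"
  using k_alg_isoD(2)[OF psi_iso] by (simp add: bij_betw_def)

lemma psi_Z:
  assumes "i \<in> {1..N}"
  shows "psi (Z i) = x i"
proof -
  have "x i \<in> carrier (stage (ambient sc) x N)" using gen_incl[of "x ` {1..N}"] assms by auto
  then show ?thesis
    using phi(2)[OF assms] k_alg_isoD(2)[OF phi(1)] unfolding psi_def bij_betw_def
    by (metis inv_into_f_f)
qed

lemmas psi_simps = k_alg_homD(3-6)[OF psi_hom, unfolded ambient_simps]

lemma psi_zero: "psi \<zero>\<^bsub>B\<^esub> = 0"
  using k_alg_hom_zero[OF psi_hom B_algebra algebra] by simp

lemma psi_image_Z: "i \<le> N \<Longrightarrow> psi ` Z ` {1..i} = x ` {1..i}"
  unfolding image_image by (intro image_cong) (auto intro: psi_Z)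

lemma psi_stage_iso: "i \<le> N \<Longrightarrow> psi \<in> k_alg_iso (stage B Z i) (stage (ambient sc) x i)"
  using k_alg_iso_alg_gen[OF psi_hom psi_inj B_algebra algebra Z_image, of i] by (simp add: psi_image_Z)

lemma psi_stage: "i \<le> N \<Longrightarrow> psi ` carrier (stage B Z i) = gen (x ` {1..i})"
  using k_alg_isoD(2)[OF psi_stage_iso] by (simp add: bij_betw_def)

text \<open>The Ore extension of \<open>B\<close> at step i is carried into the skew field by
  \<open>psi\<close>, with its two maps conjugated by \<open>psi\<close>. Of the result only the
  basis of powers of \<open>x i\<close> is kept.\<close>

lemma x_free:
  assumes "i \<in> {1..N}"
  shows "left_free (gen (x ` {1..i-1})) (x i)"
    and "left_poly (x i) ` coeff_seqs (gen (x ` {1..i-1})) = gen (x ` {1..i})"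
proof -
  let ?inv = "inv_into (carrier (stage B Z (i - 1))) psi"
  let ?\<sigma> = "if i \<le> j then \<sigma> i else \<tau> i" and ?\<delta> = "if i \<le> j then \<delta> i else (\<lambda>_. \<zero>\<^bsub>B\<^esub>)"
  have "inj_on psi (carrier (stage B Z (i - 1)))"
    by (intro inj_on_subset[OF psi_inj] k_subalgebraD(4)[OF stage_B_sub] pred_le[OF assms])
  then have inv: "?inv (psi r) = r" if "r \<in> carrier (stage B Z (i - 1))" for r
    using that by simp
  have "ore_extension (stage (ambient sc) x (i - 1)) (stage (ambient sc) x i) (psi (Z i))
      (\<lambda>b. psi (?\<sigma> (?inv b))) (\<lambda>b. psi (?\<delta> (?inv b)))"
  proof (rule ore_extension_transfer[OF ore_B[OF assms] psi_stage_iso])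
    show "k_subalgebra (stage (ambient sc) x (i - 1)) (stage (ambient sc) x i)"
      by (rule alg_gen_mono_subalgebra[OF algebra]) auto
    show "carrier (stage (ambient sc) x (i - 1)) = psi ` carrier (stage B Z (i - 1))"
      by (rule psi_stage[symmetric, unfolded carrier_alg_gen_ambient[symmetric]]) (rule pred_le[OF assms])
  qed (use assms in \<open>auto simp: inv\<close>)
  from ore_extension_left_free[OF this] show "left_free (gen (x ` {1..i-1})) (x i)"
    and "left_poly (x i) ` coeff_seqs (gen (x ` {1..i-1})) = gen (x ` {1..i})"
    using psi_Z[OF assms] by simp_all
qed

lemma x_mult_psi:
  assumes "i \<in> {1..N}" "b \<in> carrier (stage B Z (i - 1))"
  shows "x i * psi b = psi ((if i \<le> j then \<sigma> i else \<tau> i) b) * x i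
    + psi ((if i \<le> j then \<delta> i else (\<lambda>_. \<zero>\<^bsub>B\<^esub>)) b)"
proof -
  let ?\<sigma> = "if i \<le> j then \<sigma> i else \<tau> i" and ?\<delta> = "if i \<le> j then \<delta> i else (\<lambda>_. \<zero>\<^bsub>B\<^esub>)"
  have eq: "Z i \<otimes>\<^bsub>B\<^esub> b = ?\<sigma> b \<otimes>\<^bsub>B\<^esub> Z i \<oplus>\<^bsub>B\<^esub> ?\<delta> b"
    and \<sigma>: "?\<sigma> \<in> k_alg_iso (stage B Z (i - 1)) (stage B Z (i - 1))"
    and \<delta>: "skew_derivation (stage B Z (i - 1)) ?\<sigma> ?\<delta>"
    using ore_B[OF assms(1)] assms(2) unfolding ore_extension_def by (simp_all only: alg_gen_simps)
  have "?\<sigma> b \<in> carrier (stage B Z (i - 1))"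
    by (rule k_alg_homD(2)[OF k_alg_isoD(1)[OF \<sigma>] assms(2)])
  moreover have "?\<delta> b \<in> carrier (stage B Z (i - 1))"
    using \<delta> assms(2) unfolding skew_derivation_def k_linear_on_def by blast
  moreover have "carrier (stage B Z (i - 1)) \<subseteq> carrier B"
    by (intro k_subalgebraD(4)[OF stage_B_sub] pred_le[OF assms(1)])
  moreover have "Z i \<in> carrier B" using Z_carrier assms(1) by auto
  moreover have "?\<sigma> b \<otimes>\<^bsub>B\<^esub> Z i \<in> carrier B"
    using calculation ring.ring_simprules(5)[OF k_algebraD(1)[OF B_algebra]] by blast
  ultimately have "psi (Z i) * psi b = psi (?\<sigma> b) * psi (Z i) + psi (?\<delta> b)"
    using assms(2) arg_cong[OF eq, of psi] by (simp only: psi_simps subsetD)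
  then show ?thesis by (simp only: psi_Z[OF assms(1)])
qed

section \<open>The base algebra and its transported maps\<close>

abbreviation R where "R \<equiv> stage A X (j - 1)"

abbreviation H where "H \<equiv> gen (x ` {1..j-1})"

abbreviation tr where "tr \<equiv> transported A X sc x (j - 1)"

lemma R_sub_B: "k_subalgebra R B"
  by (rule stage_A_sub_B) simp

lemma R_sub_A: "k_subalgebra R A"
  by (intro alg_gen_subalgebra A_algebra X_image) simp

lemma psi_R: "psi ` carrier R = H"
  using psi_stage[of "j - 1"] stage_B_eq[of "j - 1"] j by simp

lemma psi_X: "l \<in> {1..j} \<Longrightarrow> psi (X l) = x l"
  using psi_Z[of l] Z_eq_X[of l] le_trans[OF _ j_bounds(2), of l] by simp

lemma psi_R_iso: "psi \<in> k_alg_iso R (stage (ambient sc) x (j - 1))"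
proof (rule k_alg_isoI)
  show "bij_betw psi (carrier R) (carrier (stage (ambient sc) x (j - 1)))"
    using inj_on_subset[OF psi_inj k_subalgebraD(4)[OF R_sub_B]] psi_R by (simp add: bij_betw_def)
  show "psi \<in> k_alg_hom R (stage (ambient sc) x (j - 1))"
    by (rule k_alg_hom_corestrict[OF k_alg_hom_restrict[OF psi_hom R_sub_B] alg_gen_subalgebra[OF algebra]])
       (simp_all add: psi_R)
qed

text \<open>\<open>generator_iso\<close> is an arbitrary choice among suitable isomorphisms;
  \<open>psi\<close> shows that there is one, and a homomorphism is determined by its values on
  generators.\<close>

lemma generator_iso_eq_psi:
  assumes "r \<in> carrier R"
  shows "generator_iso A X sc x (j - 1) r = psi r"
proof -
  have "psi \<in> k_alg_iso R (stage (ambient sc) x (j - 1)) \<and> (\<forall>l\<in>{1..j-1}. psi (X l) = x l)"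
    using psi_R_iso by (auto intro!: psi_X)
  from someI[of "\<lambda>\<psi>. \<psi> \<in> k_alg_iso R (stage (ambient sc) x (j - 1)) \<and> (\<forall>l\<in>{1..j-1}. \<psi> (X l) = x l)", OF this]
  have g: "generator_iso A X sc x (j - 1) \<in> k_alg_iso R (stage (ambient sc) x (j - 1))"
    "\<And>l. l \<in> {1..j-1} \<Longrightarrow> generator_iso A X sc x (j - 1) (X l) = x l"
    unfolding generator_iso_def by blast+
  show ?thesis
  proof (rule k_alg_hom_eqI[OF k_alg_isoD(1)[OF g(1)] k_alg_isoD(1)[OF psi_R_iso] k_subalgebraD(1)[OF R_sub_B]])
    show X: "X ` {1..j-1} \<subseteq> carrier R" by (rule alg_gen_incl)
    show "r \<in> carrier (alg_gen R (X ` {1..j-1}))"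
      using assms alg_gen_alg_gen[OF A_algebra X_image X] by simp
  qed (auto simp: g(2) psi_X)
qed

lemma tr_psi:
  assumes "r \<in> carrier R" "f r \<in> carrier R"
  shows "tr f (psi r) = psi (f r)"
proof -
  let ?g = "generator_iso A X sc x (j - 1)"
  have "inj_on ?g (carrier R)"
    using generator_iso_eq_psi inj_on_subset[OF psi_inj k_subalgebraD(4)[OF R_sub_B]]
    by (simp cong: inj_on_cong)
  then have "inv_into (carrier R) ?g (psi r) = r"
    using assms(1) by (metis generator_iso_eq_psi inv_into_f_f)
  then show ?thesis using assms(2) by (simp add: transported_def generator_iso_eq_psi)
qed

lemma sigma_j: "\<sigma> j \<in> k_alg_iso R R" and x_mult_R: "r \<in> carrier R \<Longrightarrow> x j * psi r = psi (\<sigma> j r) * x j + psi (\<delta> j r)"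
proof -
  have "ore_extension R (stage A X j) (X j) (\<sigma> j) (\<delta> j)"
    using iterated_A j by (simp add: iterated_ore_extension_def)
  then show "\<sigma> j \<in> k_alg_iso R R" by (simp add: ore_extension_def)
  show "r \<in> carrier R \<Longrightarrow> x j * psi r = psi (\<sigma> j r) * x j + psi (\<delta> j r)"
    using x_mult_psi[of j r] j stage_B_eq[of "j - 1"] by simp
qed

abbreviation s where "s \<equiv> inv_into (carrier R) (\<sigma> j)"

lemma s_simps: "r \<in> carrier R \<Longrightarrow> s r \<in> carrier R" "r \<in> carrier R \<Longrightarrow> \<sigma> j (s r) = r"
  "r \<in> carrier R \<Longrightarrow> s (\<sigma> j r) = r"
  using k_alg_isoD(2)[OF sigma_j]
  by (auto simp: bij_betw_def inv_into_into f_inv_into_f)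

lemmas sigma_simps = k_alg_homD(2-6)[OF k_alg_isoD(1)[OF sigma_j]]

lemma R_sigma_pow_closed: "r \<in> carrier R \<Longrightarrow> (\<sigma> j ^^ n) r \<in> carrier R"
  by (induction n) (simp_all add: sigma_simps)

lemma R_s_pow_closed: "r \<in> carrier R \<Longrightarrow> (s ^^ n) r \<in> carrier R"
  by (induction n) (simp_all add: s_simps)

lemma R_ops:
  "a \<in> carrier R \<Longrightarrow> b \<in> carrier R \<Longrightarrow> psi (a \<otimes>\<^bsub>R\<^esub> b) = psi a * psi b"
  "a \<in> carrier R \<Longrightarrow> b \<in> carrier R \<Longrightarrow> psi (a \<oplus>\<^bsub>R\<^esub> b) = psi a + psi b"
  "psi \<one>\<^bsub>R\<^esub> = 1" "a \<in> carrier R \<Longrightarrow> psi (c \<odot>\<^bsub>R\<^esub> a) = sc c (psi a)" "psi \<zero>\<^bsub>R\<^esub> = 0"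
  using k_alg_homD(3-6)[OF k_alg_isoD(1)[OF psi_R_iso], unfolded alg_gen_simps ambient_simps]
    k_alg_hom_zero[OF k_alg_isoD(1)[OF psi_R_iso] k_subalgebraD(1)[OF R_sub_A] F_stage_algebra]
  by simp_all

lemma R_closed:
  "a \<in> carrier R \<Longrightarrow> b \<in> carrier R \<Longrightarrow> a \<otimes>\<^bsub>R\<^esub> b \<in> carrier R"
  "a \<in> carrier R \<Longrightarrow> b \<in> carrier R \<Longrightarrow> a \<oplus>\<^bsub>R\<^esub> b \<in> carrier R"
  "a \<in> carrier R \<Longrightarrow> c \<odot>\<^bsub>R\<^esub> a \<in> carrier R"
  using alg_gen_mult[of a A _ b] alg_gen_add[of a A _ b] k_algebraD(3)[OF k_subalgebraD(1)[OF R_sub_A], of a c]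
  by simp_all

lemma d_simps:
  "r \<in> carrier R \<Longrightarrow> d j n r \<in> carrier R"
  "r \<in> carrier R \<Longrightarrow> t \<in> carrier R \<Longrightarrow> d j n (r \<oplus>\<^bsub>R\<^esub> t) = d j n r \<oplus>\<^bsub>R\<^esub> d j n t"
  "r \<in> carrier R \<Longrightarrow> d j n (c \<odot>\<^bsub>R\<^esub> r) = c \<odot>\<^bsub>R\<^esub> d j n r"
  "r \<in> carrier R \<Longrightarrow> d j 0 r = r" "r \<in> carrier R \<Longrightarrow> d j 1 r = \<delta> j r"
  "r \<in> carrier R \<Longrightarrow> t \<in> carrier R \<Longrightarrow> d j n (r \<otimes>\<^bsub>R\<^esub> t)
     = (\<Oplus>\<^bsub>R\<^esub>i\<in>{0..n}. (\<sigma> j ^^ (n - i)) (d j i r) \<otimes>\<^bsub>R\<^esub> d j (n - i) t)"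
  "r \<in> carrier R \<Longrightarrow> d j n (\<sigma> j r) = q j ^ n \<odot>\<^bsub>R\<^esub> \<sigma> j (d j n r)"
  "r \<in> carrier R \<Longrightarrow> d j n (d j m r) = q_binomial (q j) (n + m) m \<odot>\<^bsub>R\<^esub> d j (n + m) r"
  using higher[OF j] iter by (auto simp: higher_skew_derivation_def k_linear_on_def iterative_def)

lemma psi_finsum:
  assumes "finite I" "\<And>i. i \<in> I \<Longrightarrow> f i \<in> carrier R"
  shows "psi (\<Oplus>\<^bsub>R\<^esub>i\<in>I. f i) = (\<Sum>i\<in>I. psi (f i))"
proof -
  interpret ring R by (rule k_algebraD(1)[OF k_subalgebraD(1)[OF R_sub_A]])
  have "(\<Oplus>\<^bsub>R\<^esub>i\<in>I. f i) \<in> carrier R \<and> psi (\<Oplus>\<^bsub>R\<^esub>i\<in>I. f i) = (\<Sum>i\<in>I. psi (f i))"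
    using assms
  proof (induction I)
    case empty
    then show ?case using R_ops(5) zero_closed by (simp only: finsum_empty sum.empty simp_thms)
  next
    case (insert i I)
    then have "f \<in> I \<rightarrow> carrier R" "f i \<in> carrier R" by auto
    then show ?case
      using insert by (simp only: finsum_insert R_ops R_closed sum.insert simp_thms insert_iff)
  qed
  then show ?thesis ..
qed

text \<open>Every element of \<open>H\<close> is \<open>psi a\<close> for some \<open>a\<close> in
  \<open>R\<close>, and by \<open>tr_psi\<close> a transported map acts on it as the original map
  acts on \<open>a\<close>. Each rule on \<open>H\<close> is thus an identity in \<open>R\<close>
  seen through \<open>psi\<close>.\<close>

sublocale deletion sc H "tr (\<sigma> j)" "tr s" "\<lambda>n. tr (d j n)" "q j" "x j"
proof unfold_locales
  fix r t :: 'f and n m :: nat and c :: 'k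
  have H: "\<exists>a\<in>carrier R. b = psi a" if "b \<in> H" for b using that psi_R by blast
  show "subalg H" by (rule subalg_gen)
  show "q j \<noteq> 0" "q j \<noteq> 1" by (rule qj)+
  show "left_free H (x j)" using x_free(1)[of j] j by simp
  {
    assume "r \<in> H"
    then obtain a where a: "a \<in> carrier R" "r = psi a" using H by blast
    show "tr (\<sigma> j) r \<in> H" "tr s r \<in> H" "tr (d j n) r \<in> H"
      using a by (simp_all add: tr_psi s_simps sigma_simps(1) d_simps(1) psi_R[symmetric])
    show "tr (\<sigma> j) (tr s r) = r" "tr s (tr (\<sigma> j) r) = r"
      by (simp_all add: a tr_psi s_simps sigma_simps(1))
    show "tr (\<sigma> j) (sc c r) = sc c (tr (\<sigma> j) r)"
      using tr_psi[of "c \<odot>\<^bsub>R\<^esub> a" "\<sigma> j"]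
      by (simp only: R_ops R_closed a tr_psi sigma_simps)
    show "tr (d j n) (sc c r) = sc c (tr (d j n) r)"
      using tr_psi[of "c \<odot>\<^bsub>R\<^esub> a" "d j n"]
      by (simp only: R_ops R_closed a tr_psi d_simps(1,3))
    show "tr (d j 0) r = r" by (simp add: a tr_psi d_simps)
    show "tr (d j n) (tr (\<sigma> j) r) = sc (q j ^ n) (tr (\<sigma> j) (tr (d j n) r))"
      by (simp only: a tr_psi sigma_simps(1) d_simps(1,7) R_ops R_closed)
    show "tr (d j n) (tr (d j m) r) = sc (q_binomial (q j) (n + m) m) (tr (d j (n + m)) r)"
      by (simp only: a tr_psi d_simps(1,8) R_ops R_closed)
    obtain n0 where "\<And>n. n \<ge> n0 \<Longrightarrow> d j n a = \<zero>\<^bsub>R\<^esub>"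
      using nilp a(1) unfolding locally_nilpotent_def by blast
    moreover have "tr (d j n) r = psi (d j n a)" for n by (simp only: a tr_psi d_simps(1))
    ultimately have "tr (d j n) r = 0" if "n \<ge> n0" for n
      using that by (simp only: R_ops)
    then show "\<exists>n0. \<forall>n\<ge>n0. tr (d j n) r = 0" by blast
    show "x j * r = tr (\<sigma> j) r * x j + tr (d j 1) r"
      using d_simps(1)[OF a(1), of 1] by (simp only: a tr_psi sigma_simps(1) d_simps(5) x_mult_R)
    assume "t \<in> H"
    then obtain b where b: "b \<in> carrier R" "t = psi b" using H by blast
    show "tr (\<sigma> j) (r + t) = tr (\<sigma> j) r + tr (\<sigma> j) t"
      using tr_psi[of "a \<oplus>\<^bsub>R\<^esub> b" "\<sigma> j"] by (simp only: a b R_ops R_closed tr_psi sigma_simps)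
    show "tr (\<sigma> j) (r * t) = tr (\<sigma> j) r * tr (\<sigma> j) t"
      using tr_psi[of "a \<otimes>\<^bsub>R\<^esub> b" "\<sigma> j"] by (simp only: a b R_ops R_closed tr_psi sigma_simps)
    show "tr (d j n) (r + t) = tr (d j n) r + tr (d j n) t"
      using tr_psi[of "a \<oplus>\<^bsub>R\<^esub> b" "d j n"] by (simp only: a b R_ops R_closed tr_psi d_simps(1,2))
    have pow: "(tr (\<sigma> j) ^^ k) (psi u) = psi ((\<sigma> j ^^ k) u)" if "u \<in> carrier R" for k u
      by (induction k) (simp_all add: that tr_psi R_sigma_pow_closed sigma_simps(1))
    have "tr (d j n) (r * t) = psi (d j n (a \<otimes>\<^bsub>R\<^esub> b))"
      using tr_psi[of "a \<otimes>\<^bsub>R\<^esub> b" "d j n"] by (simp only: a b R_ops R_closed d_simps(1))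
    also have "\<dots> = (\<Sum>i\<in>{0..n}. psi ((\<sigma> j ^^ (n - i)) (d j i a) \<otimes>\<^bsub>R\<^esub> d j (n - i) b))"
      unfolding d_simps(6)[OF a(1) b(1)]
      by (rule psi_finsum) (intro finite_atLeastAtMost R_closed(1) R_sigma_pow_closed d_simps(1) a b)+
    also have "\<dots> = (\<Sum>i\<le>n. (tr (\<sigma> j) ^^ (n - i)) (tr (d j i) r) * tr (d j (n - i)) t)"
      by (simp only: atLeast0AtMost R_ops(1) a b pow tr_psi d_simps(1) R_sigma_pow_closed)
    finally show "tr (d j n) (r * t) = (\<Sum>i\<le>n. (tr (\<sigma> j) ^^ (n - i)) (tr (d j i) r) * tr (d j (n - i)) t)" .
  }
qed

lemma in_range_N: "l \<in> {1..j-1} \<Longrightarrow> l \<in> {1..N}" "i \<in> {j..N} \<Longrightarrow> i \<in> {1..N}"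
  "i \<in> {j+1..N} \<Longrightarrow> i \<in> {1..N}" "i \<in> {1..N} \<Longrightarrow> l \<in> {1..i-1} \<Longrightarrow> l \<in> {1..N}"
  using j_bounds(2,3) by (auto simp del: j_bounds)

section \<open>The new generators and their relations\<close>

definition y :: "nat \<Rightarrow> 'f" where
  "y = deletion_step A X \<sigma> q d sc j x"

lemma y_ge: "l \<ge> j \<Longrightarrow> y l = x l"
  by (simp add: y_def deletion_step_def)

lemma X_in_R: "l \<in> {1..j-1} \<Longrightarrow> X l \<in> carrier R"
  using alg_gen_incl[of "X ` {1..j-1}" A] by blast

lemma x_in_H: "l \<in> {1..j-1} \<Longrightarrow> x l \<in> H"
  using gen_incl[of "x ` {1..j-1}"] by blast

lemma psi_X_lt: "l \<in> {1..j-1} \<Longrightarrow> psi (X l) = x l"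
  by (rule psi_X) auto

text \<open>\<open>deletion_step\<close> transports the whole composite of \<open>d j n\<close> with
  a power of \<open>s\<close>, whereas \<open>dterm\<close> composes maps transported one at a time.
  They agree because every intermediate value stays in \<open>R\<close>.\<close>

lemma y_lt:
  assumes "l \<in> {1..j-1}"
  shows "y l = theta (x l)"
proof -
  have "(tr s ^^ n) (psi (X l)) = psi ((s ^^ n) (X l))" for n
    by (induction n) (simp_all add: tr_psi s_simps R_s_pow_closed X_in_R[OF assms])
  then have "dterm n (psi (X l)) = tr (d j n \<circ> s ^^ n) (psi (X l))" for n
    using X_in_R[OF assms] by (simp add: dterm_def tr_psi R_s_pow_closed d_simps(1))
  moreover have "l < j" using assms by auto
  ultimately show ?thesis
    by (simp add: y_def deletion_step_def theta_def coef_def psi_X_lt[OF assms])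
qed

lemma x_skew:
  assumes "i \<in> {j+1..N}" "l \<in> {1..i-1}"
  shows "x i * x l = sc (\<Lambda> i l) (x l * x i)"
proof -
  have il: "i \<in> {1..N}" "l \<in> {1..N}" "\<not> i \<le> j" using assms by auto
  have "Z l \<in> carrier (stage B Z (i - 1))"
    using assms(2) alg_gen_incl[of "Z ` {1..i-1}" B] by blast
  moreover have "Z l \<in> carrier B" using Z_carrier il by blast
  ultimately show ?thesis
    using x_mult_psi[of i "Z l"] il
    by (simp add: psi_Z eig[OF assms] psi_simps psi_zero sc_mult_left)
qed

lemma Lambda_j_nonzero: "i \<in> {1..N} \<Longrightarrow> \<Lambda> i j \<noteq> 0"
  by (intro Lambda_nonzero) simp_all

lemma deletion_tail:
  assumes "i \<le> N"
  shows "deletion_tail sc H (tr (\<sigma> j)) (tr s) (\<lambda>n. tr (d j n)) (q j) (x j) (x ` {j+1..i})"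
proof unfold_locales
  fix w assume "w \<in> x ` {j+1..i}"
  then obtain m where m: "w = x m" "m \<in> {j+1..N}" using assms by auto
  then have \<Lambda>: "\<Lambda> m j \<noteq> 0" by (intro Lambda_j_nonzero) auto
  have "x m * x j = sc (\<Lambda> m j) (x j * x m)" using m by (intro x_skew) auto
  then have "x j * x m = sc (inverse (\<Lambda> m j)) (x m * x j)" using \<Lambda> by simp
  then show "\<exists>\<mu>. \<mu> \<noteq> 0 \<and> x j * w = sc \<mu> (w * x j)" using m(1) \<Lambda> by (auto intro!: exI[of _ "inverse (\<Lambda> m j)"])
qed

lemma interval_split: "j \<le> i \<Longrightarrow> w ` {1..i} = w ` {1..j-1} \<union> insert (w j) (w ` {j+1..i})"
proof -
  assume "j \<le> i"
  then have "{1..i} = {1..j-1} \<union> insert j {j+1..i}" by auto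
  then show ?thesis by (simp add: image_Un)
qed

lemma gen_x: "j \<le> i \<Longrightarrow> gen (x ` {1..i}) = gen (H \<union> insert (x j) (x ` {j+1..i}))"
  unfolding gen_gen_Un by (rule arg_cong[OF interval_split])

lemma theta_hom: "theta \<in> k_alg_hom (stage (ambient sc) x (j - 1)) (ambient sc)"
  by (rule k_alg_homI) (simp_all add: theta_mult theta_add theta_one theta_sc)

lemma theta_H: "theta ` H = gen (y ` {1..j-1})"
proof -
  have G: "x ` {1..j-1} \<subseteq> carrier (stage (ambient sc) x (j - 1))" by (rule alg_gen_incl)
  have "theta ` x ` {1..j-1} = y ` {1..j-1}"
    unfolding image_image by (intro image_cong) (simp_all only: y_lt)
  then show ?thesis
    using k_alg_hom_image_alg_gen[OF theta_hom F_stage_algebra algebra G]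
      alg_gen_alg_gen[OF algebra _ G] by simp
qed

lemma gen_y:
  assumes "j \<le> i"
  shows "gen (y ` {1..i}) = gen (theta ` H \<union> insert (x j) (x ` {j+1..i}))"
proof -
  have "y ` {j+1..i} = x ` {j+1..i}" by (intro image_cong) (simp_all add: y_ge)
  then show ?thesis
    unfolding theta_H gen_gen_Un by (simp add: interval_split[OF assms] y_ge)
qed

lemma tr_sigma_x:
  assumes "l \<in> {1..j-1}"
  shows "tr (\<sigma> j) (x l) = sc (\<Lambda> j l) (x l)"
proof -
  have "tr (\<sigma> j) (psi (X l)) = psi (\<sigma> j (X l))"
    using X_in_R[OF assms] by (simp only: tr_psi sigma_simps(1))
  also have "\<sigma> j (X l) = \<Lambda> j l \<odot>\<^bsub>R\<^esub> X l"
    using sigma_X[of j l] assms by auto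
  finally show ?thesis
    using X_in_R[OF assms] by (simp only: R_ops psi_X_lt[OF assms])
qed

text \<open>For i = j this is \<open>x_theta\<close> at the eigenvector \<open>x l\<close> of the
  transported \<open>\<sigma> j\<close>. For i > j and l >= j neither generator has changed. For l <
  j < i the weights of d_n and of x^(-n) cancel in each term of theta.\<close>

lemma y_skew:
  assumes "i \<in> {j..N}" "l \<in> {1..i-1}"
  shows "y i * y l = sc (\<Lambda> i l) (y l * y i)"
proof -
  consider "i = j" | "i > j" "l \<ge> j" | "i > j" "l < j" using assms by fastforce
  then show ?thesis
  proof cases
    case 1
    then have l: "l \<in> {1..j-1}" using assms(2) by simp
    show ?thesis
      using x_theta[OF x_in_H[OF l]] tr_sigma_x[OF l] x_in_H[OF l]
      by (simp add: 1 y_ge y_lt[OF l] theta_sc sc_mult_left)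
  next
    case 2
    then show ?thesis using x_skew[of i l] assms by (simp add: y_ge)
  next
    case 3
    then have l: "l \<in> {1..j-1}" and i: "i \<in> {j+1..N}" using assms by auto
    have \<Lambda>: "\<Lambda> j l \<noteq> 0" by (intro Lambda_nonzero in_range_N(1)[OF l]) simp
    have xl: "x l \<in> H" by (rule x_in_H[OF l])
    have "x i * theta (x l) = sc (\<Lambda> i l) (theta (x l) * x i)"
    \<comment> \<open>The instance has \<open>x i\<close> for z, with \<mu> =
      \<open>\<Lambda> i j\<close>, \<kappa> = \<open>\<Lambda> i l\<close> and the inverse of
      \<open>\<Lambda> j l\<close> for \<nu>.\<close>
    proof (rule theta_skew_commute[OF xl])
      show "\<Lambda> i j \<noteq> 0" using i by (intro Lambda_j_nonzero) auto
      show "x i * x j = sc (\<Lambda> i j) (x j * x i)" using i by (intro x_skew) auto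
      have "tr s (tr (\<sigma> j) (sc (inverse (\<Lambda> j l)) (x l))) = sc (inverse (\<Lambda> j l)) (x l)"
        by (intro s_sigma subalgD(5)[OF subalg_gen] xl)
      then show "tr s (x l) = sc (inverse (\<Lambda> j l)) (x l)"
        using \<Lambda> by (simp add: sigma_sc[OF xl] tr_sigma_x[OF l])
      fix n
      have d: "d j n (X l) \<in> carrier R" by (rule d_simps(1)[OF X_in_R[OF l]])
      have "carrier R \<subseteq> carrier (stage B Z (i - 1))"
      proof -
        have "carrier R = carrier (stage B Z (j - 1))" by (rule stage_B_eq[symmetric]) simp
        also have "\<dots> \<subseteq> carrier (stage B Z (i - 1))"
          using i by (intro k_subalgebraD(4)[OF alg_gen_mono_subalgebra[OF B_algebra Z_image]] image_mono) auto
        finally show ?thesis .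
      qed
      then have "x i * psi (d j n (X l)) = psi (\<tau> i (d j n (X l))) * x i"
        using x_mult_psi[of i "d j n (X l)"] i d by (auto simp: psi_zero)
      also have "\<tau> i (d j n (X l)) = \<Lambda> i j ^ n \<odot>\<^bsub>B\<^esub> d j n (\<tau> i (X l))"
        using i X_in_R[OF l] by (intro comm) auto
      also have "\<tau> i (X l) = \<Lambda> i l \<odot>\<^bsub>R\<^esub> X l"
      proof -
        have "\<tau> i (Z l) = \<Lambda> i l \<odot>\<^bsub>B\<^esub> Z l" using i l by (intro eig) auto
        moreover have "Z l = X l" using l by (intro Z_eq_X) auto
        ultimately show ?thesis by (simp only: k_subalgebraD(9)[OF R_sub_B X_in_R[OF l]])
      qed
      also have "d j n (\<Lambda> i l \<odot>\<^bsub>R\<^esub> X l) = \<Lambda> i l \<odot>\<^bsub>R\<^esub> d j n (X l)"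
        by (rule d_simps(3)[OF X_in_R[OF l]])
      also have "\<Lambda> i j ^ n \<odot>\<^bsub>B\<^esub> (\<Lambda> i l \<odot>\<^bsub>R\<^esub> d j n (X l)) = \<Lambda> i j ^ n \<odot>\<^bsub>R\<^esub> (\<Lambda> i l \<odot>\<^bsub>R\<^esub> d j n (X l))"
        by (rule k_subalgebraD(9)[OF R_sub_B R_closed(3)[OF d], symmetric])
      also have "psi (\<Lambda> i j ^ n \<odot>\<^bsub>R\<^esub> (\<Lambda> i l \<odot>\<^bsub>R\<^esub> d j n (X l))) = sc (\<Lambda> i j ^ n * \<Lambda> i l) (psi (d j n (X l)))"
        using d by (simp only: R_ops R_closed sc_sc)
      also have "psi (d j n (X l)) = tr (d j n) (x l)"
        using X_in_R[OF l] d by (simp only: tr_psi flip: psi_X_lt[OF l])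
      finally show "x i * tr (d j n) (x l) = sc (\<Lambda> i j ^ n * \<Lambda> i l) (tr (d j n) (x l) * x i)"
        by (simp only: sc_mult_left)
    qed
    then show ?thesis using i by (simp add: y_ge y_lt[OF l])
  qed
qed

text \<open>At i = j independence is \<open>left_free_theta\<close>. For later i it holds over the
  old stage i - 1, and the new stage i - 1 lies in the localization of the old one at the powers of
  \<open>x j\<close>.\<close>

lemma y_free:
  assumes "i \<in> {j..N}"
  shows "left_free (gen (y ` {1..i-1})) (y i)"
proof (cases "i = j")
  case True
  then show ?thesis using left_free_theta by (simp add: y_ge theta_H)
next
  case False
  then have i: "i \<in> {j+1..N}" "j \<le> i - 1" "i - 1 \<le> N" using assms by auto
  interpret T: deletion_tail sc H "tr (\<sigma> j)" "tr s" "\<lambda>n. tr (d j n)" "q j" "x j" "x ` {j+1..i-1}"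
    by (rule deletion_tail[OF i(3)])
  have "left_free T.after (x i)"
  proof (rule left_free_denom_powers[OF _ T.subalg_before T.subalg_after T.after_subset x_nonzero])
    show "left_free T.before (x i)"
      using x_free(1)[of i] i gen_x[OF i(2)] by (simp add: T.before_def)
    show "\<Lambda> i j \<noteq> 0" using i by (intro Lambda_j_nonzero) auto
    show "x i * x j = sc (\<Lambda> i j) (x j * x i)" using i by (intro x_skew) auto
  qed
  then show ?thesis using i gen_y[OF i(2)] by (simp add: T.after_def y_ge)
qed

lemma y_nonzero: "i \<in> {j..N} \<Longrightarrow> y i \<noteq> 0"
  by (rule left_free_nonzero[OF y_free subalg_gen])

lemma conjugate_y: "i \<in> {j..N} \<Longrightarrow> l \<in> {1..i-1} \<Longrightarrow> conjugate (y i) (y l) = sc (\<Lambda> i l) (y l)"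
  by (rule conjugate_eqI[OF y_nonzero]) (simp_all only: y_skew sc_mult_left)

lemma ore_y:
  assumes "i \<in> {j..N}"
  shows "ore_extension (stage (ambient sc) y (i - 1)) (stage (ambient sc) y i) (y i) (conjugate (y i)) (\<lambda>_. 0)"
proof -
  have "conjugate (y i) ` gen (y ` {1..i-1}) = gen (y ` {1..i-1})"
  proof (rule conjugate_gen[OF y_nonzero[OF assms]])
    fix g assume "g \<in> y ` {1..i-1}"
    then obtain l where l: "g = y l" "l \<in> {1..i-1}" by blast
    moreover have "\<Lambda> i l \<noteq> 0" by (intro Lambda_nonzero in_range_N(2)[OF assms] in_range_N(4)[OF _ l(2)])
    ultimately show "\<exists>\<mu>. \<mu> \<noteq> 0 \<and> conjugate (y i) g = sc \<mu> g" using conjugate_y[OF assms] by metis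
  qed
  from ore_extension_conjugate[OF y_free[OF assms] this] 
  moreover have "insert (y i) (y ` {1..i-1}) = y ` {1..i}"
  proof -
    have "{1..i} = insert i {1..i-1}" using in_range_N(2)[OF assms] by auto
    then show ?thesis by simp
  qed
  ultimately show ?thesis by simp
qed

section \<open>The new algebra on the type of the old one\<close>

lemma extension_exists:
  assumes "i \<in> {j-1..N}"
  shows "\<exists>g. bij_betw g (gen (x ` {1..i})) (gen (y ` {1..i})) \<and> (\<forall>h\<in>H. g h = theta h)"
proof -
  from assms have "j - 1 \<le> i" "i \<le> N" by auto
  \<comment> \<open>The start is \<open>theta\<close> on \<open>H\<close>. Each further variable
    extends the bijection through the coefficients of its powers and leaves its values on the
    previous stage unchanged.\<close>
  then show ?thesis
  proof (induction rule: dec_induct)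
    case base
    then show ?case using theta_inj theta_H by (auto simp: bij_betw_def)
  next
    case (step i)
    then have i: "Suc i \<in> {1..N}" "Suc i \<in> {j..N}" by auto
    obtain g where g: "bij_betw g (gen (x ` {1..i})) (gen (y ` {1..i}))" "\<And>h. h \<in> H \<Longrightarrow> g h = theta h"
      using step by auto
    have "g 0 = 0" using g(2)[of 0] subalgD(2)[OF subalg_gen] theta_zero by simp
    from extend_bij_betw[OF _ _ _ _ g(1) this subalgD(2)[OF subalg_gen]]
    obtain g' where g': "bij_betw g' (gen (x ` {1..Suc i})) (gen (y ` {1..Suc i}))"
        "\<And>t. t \<in> gen (x ` {1..i}) \<Longrightarrow> g' t = g t"
      using x_free[OF i(1)] ore_extension_left_free[OF ore_y[OF i(2)]] by (metis diff_Suc_1)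
    have H: "H \<subseteq> gen (x ` {1..i})" using step(1) by (intro gen_mono image_mono) auto
    have "g' h = theta h" if "h \<in> H" for h
      using g'(2)[OF subsetD[OF H that]] g(2)[OF that] by (rule trans)
    then show ?case using g'(1) by blast
  qed
qed

definition ext :: "'f \<Rightarrow> 'f" where
  "ext = (SOME g. bij_betw g (gen (x ` {1..N})) (gen (y ` {1..N})) \<and> (\<forall>h\<in>H. g h = theta h))"

lemma ext: "bij_betw ext (gen (x ` {1..N})) (gen (y ` {1..N}))" "h \<in> H \<Longrightarrow> ext h = theta h"
proof -
  have "N \<in> {j-1..N}" by simp
  from someI_ex[OF extension_exists[OF this]]
  show "bij_betw ext (gen (x ` {1..N})) (gen (y ` {1..N}))" "h \<in> H \<Longrightarrow> ext h = theta h"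
    unfolding ext_def by blast+
qed

definition emb :: "'a \<Rightarrow> 'f" where
  "emb = ext \<circ> psi"

text \<open>The set \<open>carrier B\<close> with the operations of the new subalgebra of the skew
  field. On \<open>R\<close> the map \<open>emb\<close> is \<open>theta\<close> after
  \<open>psi\<close>, hence a homomorphism, so there the original operations reappear.\<close>

definition C :: "('k, 'a) module" where
  "C = pullback_algebra (carrier B) emb (stage (ambient sc) y N)"

definition pull :: "'f \<Rightarrow> 'a" where
  "pull = inv_into (carrier B) emb"

definition W :: "nat \<Rightarrow> 'a" where
  "W l = pull (y l)"

definition \<rho> :: "nat \<Rightarrow> 'a \<Rightarrow> 'a" where
  "\<rho> i a = pull (conjugate (y i) (emb a))"

lemma emb_bij: "bij_betw emb (carrier B) (carrier (stage (ambient sc) y N))"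
proof -
  have "bij_betw psi (carrier B) (gen (x ` {1..N}))"
    using k_alg_isoD(2)[OF psi_iso] by simp
  then show ?thesis using ext(1) unfolding emb_def by (simp add: bij_betw_trans)
qed

lemma C_algebra: "k_algebra C" and pull_iso: "pull \<in> k_alg_iso (stage (ambient sc) y N) C"
  unfolding C_def pull_def by (rule pullback_algebra[OF F_stage_algebra emb_bij])+

lemma pull_emb: "a \<in> carrier B \<Longrightarrow> pull (emb a) = a"
  using emb_bij by (simp add: pull_def bij_betw_def)

lemma emb_pull: "b \<in> gen (y ` {1..N}) \<Longrightarrow> emb (pull b) = b"
  using emb_bij by (simp add: pull_def bij_betw_def f_inv_into_f)

lemma pull_hom: "pull \<in> k_alg_hom (stage (ambient sc) y N) C"
  by (rule k_alg_isoD(1)[OF pull_iso])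

lemma psi_in_H: "r \<in> carrier R \<Longrightarrow> psi r \<in> H"
  using psi_R by blast

lemma emb_R: "r \<in> carrier R \<Longrightarrow> emb r = theta (psi r)"
  by (simp add: emb_def ext(2) psi_in_H)

lemma y_in_gen: "l \<in> {1..i} \<Longrightarrow> y l \<in> gen (y ` {1..i})"
  using gen_incl[of "y ` {1..i}"] by blast

lemma gen_y_mono: "i \<le> k \<Longrightarrow> gen (y ` {1..i}) \<subseteq> gen (y ` {1..k})"
  by (intro gen_mono image_mono) auto

lemma W_eq_X:
  assumes "l \<in> {1..j-1}"
  shows "W l = X l"
proof -
  have "emb (X l) = y l"
    using emb_R[OF X_in_R[OF assms]] by (simp only: psi_X_lt[OF assms] y_lt[OF assms])
  moreover have "X l \<in> carrier B" using X_in_R[OF assms] k_subalgebraD(4)[OF R_sub_B] by blast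
  ultimately show ?thesis unfolding W_def by (metis pull_emb)
qed

lemma pull_stage_iso:
  assumes "i \<le> N"
  shows "pull \<in> k_alg_iso (stage (ambient sc) y i) (stage C W i)"
proof -
  have G: "y ` {1..i} \<subseteq> carrier (stage (ambient sc) y N)"
    using assms by (intro order_trans[OF _ alg_gen_incl] image_mono) auto
  have "inj_on pull (carrier (stage (ambient sc) y N))"
    using k_alg_isoD(2)[OF pull_iso] by (simp only: bij_betw_def)
  from k_alg_iso_alg_gen[OF pull_hom this F_stage_algebra C_algebra G]
  have "pull \<in> k_alg_iso (alg_gen (stage (ambient sc) y N) (y ` {1..i})) (alg_gen C (pull ` y ` {1..i}))" .
  moreover have "pull ` y ` {1..i} = W ` {1..i}" by (auto simp: W_def image_image)
  moreover have "alg_gen (stage (ambient sc) y N) (y ` {1..i}) = stage (ambient sc) y i"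
    using alg_gen_alg_gen[OF algebra _ G] by simp
  ultimately show ?thesis by (simp only:)
qed

lemma carrier_stage_C: "i \<le> N \<Longrightarrow> carrier (stage C W i) = pull ` gen (y ` {1..i})"
  using k_alg_isoD(2)[OF pull_stage_iso] by (simp add: bij_betw_def)

lemma W_carrier: "i \<le> N \<Longrightarrow> W ` {1..i} \<subseteq> carrier C"
  using k_alg_homD(2)[OF pull_hom] y_in_gen by (auto simp: W_def)

lemma stage_C_sub: "i \<le> N \<Longrightarrow> k_subalgebra (stage C W i) C"
  by (intro alg_gen_subalgebra C_algebra W_carrier)

text \<open>\<open>pull\<close> undoes \<open>emb\<close>, so the composite homomorphism of
  \<open>psi\<close>, \<open>theta\<close> and \<open>pull\<close> is the identity map on
  \<open>R\<close>; thus the identity respects the operations of \<open>C\<close>.\<close>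

lemma R_sub_C: "k_subalgebra R C"
proof -
  have "theta \<in> k_alg_hom (stage (ambient sc) x (j - 1)) (stage (ambient sc) y N)"
  proof (rule k_alg_hom_corestrict[OF theta_hom alg_gen_subalgebra[OF algebra]])
    show "theta ` carrier (stage (ambient sc) x (j - 1)) \<subseteq> carrier (stage (ambient sc) y N)"
      by (simp add: theta_H gen_y_mono)
  qed simp
  from k_alg_hom_comp[OF k_alg_hom_comp[OF k_alg_isoD(1)[OF psi_R_iso] this] pull_hom]
  have hom: "(\<lambda>r. pull (theta (psi r))) \<in> k_alg_hom R C" .
  have id: "pull (theta (psi r)) = r" if "r \<in> carrier R" for r
    using that pull_emb k_subalgebraD(4)[OF R_sub_B] by (simp only: emb_R[symmetric] subsetD)
  have one: "\<one>\<^bsub>R\<^esub> \<in> carrier R"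
    by (rule ring.ring_simprules(6)[OF k_algebraD(1)[OF k_subalgebraD(1)[OF R_sub_A]]])
  have "(\<lambda>r. r) \<in> k_alg_hom R C"
    using k_alg_homD(2-6)[OF hom] by (intro k_alg_homI) (simp_all only: id R_closed one)
  then show ?thesis
    using k_subalgebraD(1)[OF R_sub_A] C_algebra by (simp add: k_subalgebra_def)
qed

lemma W_image: "i \<le> j - 1 \<Longrightarrow> W ` {1..i} = X ` {1..i}"
  by (intro image_cong) (simp_all add: W_eq_X)

lemma X_in_stage_R: "i \<le> j - 1 \<Longrightarrow> X ` {1..i} \<subseteq> carrier R"
  by (intro order_trans[OF _ alg_gen_incl] image_mono) auto

lemma alg_gen_R: "i \<le> j - 1 \<Longrightarrow> alg_gen R (X ` {1..i}) = stage A X i"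
  by (intro alg_gen_alg_gen[OF A_algebra X_image X_in_stage_R]) simp_all

lemma stage_R_iso:
  assumes "i \<le> j - 1"
  shows "(\<lambda>a. a) \<in> k_alg_iso (stage A X i) (stage C W i)"
proof -
  have "(\<lambda>a. a) \<in> k_alg_iso (alg_gen R (X ` {1..i})) (alg_gen C ((\<lambda>a. a) ` X ` {1..i}))"
    by (rule k_alg_iso_alg_gen[OF k_subalgebraD(3)[OF R_sub_C] _ k_subalgebraD(1)[OF R_sub_C] C_algebra X_in_stage_R[OF assms]])
       simp
  then show ?thesis by (simp only: alg_gen_R[OF assms] W_image[OF assms] image_ident)
qed

lemma carrier_stage_C_lt:
  assumes "i \<le> j - 1"
  shows "carrier (stage C W i) = carrier (stage A X i)"
  using k_alg_isoD(2)[OF stage_R_iso[OF assms]] by (simp add: bij_betw_def)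

lemma ore_C_lt:
  assumes "i \<in> {1..j-1}"
  shows "ore_extension (stage C W (i - 1)) (stage C W i) (W i) (\<sigma> i) (\<delta> i)"
proof -
  have i: "i \<in> {1..N}" "i \<le> j - 1" "i - 1 \<le> j - 1" "i \<le> N" using in_range_N(1)[OF assms] assms by auto
  have "ore_extension (stage A X (i - 1)) (stage A X i) (X i) (\<sigma> i) (\<delta> i)"
    using iterated_A i(1) unfolding iterated_ore_extension_def by blast
  from ore_extension_transfer[OF this stage_R_iso[OF i(2)]]
  have "ore_extension (stage C W (i - 1)) (stage C W i) (X i) (\<sigma> i) (\<delta> i)"
    using alg_gen_mono_subalgebra[OF C_algebra W_carrier[OF i(4)], of "W ` {1..i-1}"]
      carrier_stage_C_lt[OF i(3)] by (auto simp: image_mono)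
  then show ?thesis by (simp only: W_eq_X[OF assms])
qed

lemma ore_C_ge:
  assumes "i \<in> {j..N}"
  shows "ore_extension (stage C W (i - 1)) (stage C W i) (W i) (\<rho> i) (\<lambda>_. \<zero>\<^bsub>C\<^esub>)"
proof -
  have i: "i \<in> {1..N}" "i - 1 \<le> N" "i \<le> N" using in_range_N(2)[OF assms] pred_le by auto
  have zero: "pull 0 = \<zero>\<^bsub>C\<^esub>"
    using k_alg_hom_zero[OF pull_hom F_stage_algebra C_algebra] by simp
  have "ore_extension (stage C W (i - 1)) (stage C W i) (pull (y i)) (\<rho> i) (\<lambda>_. \<zero>\<^bsub>C\<^esub>)"
  proof (rule ore_extension_transfer[OF ore_y[OF assms] pull_stage_iso[OF i(3)]])
    show "k_subalgebra (stage C W (i - 1)) (stage C W i)"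
      by (intro alg_gen_mono_subalgebra[OF C_algebra W_carrier[OF i(3)]] image_mono) auto
    show "carrier (stage C W (i - 1)) = pull ` carrier (stage (ambient sc) y (i - 1))"
      by (simp add: carrier_stage_C i)
    show "\<rho> i (pull r) = pull (conjugate (y i) r)" if "r \<in> carrier (stage (ambient sc) y (i - 1))" for r
    proof -
      have "r \<in> gen (y ` {1..N})" using that gen_y_mono[OF i(2)] by auto
      then show ?thesis by (simp only: \<rho>_def emb_pull)
    qed
  qed (simp add: zero)
  then show ?thesis by (simp only: W_def)
qed

lemma skew_tail_C: "skew_tail_extension N A X \<sigma> \<delta> (j - 1) C W \<rho>"
  unfolding skew_tail_extension_def iterated_ore_extension_def
proof (intro conjI ballI)
  show "k_subalgebra R C" by (rule R_sub_C)
  show "k_algebra C" by (rule C_algebra)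
  show "W ` {1..N} \<subseteq> carrier C" by (rule W_carrier) simp
  have "pull ` gen (y ` {1..N}) = carrier C"
    using k_alg_isoD(2)[OF pull_iso] by (simp add: bij_betw_def)
  then show "carrier C = carrier (stage C W N)" by (simp add: carrier_stage_C)
  show "\<one>\<^bsub>C\<^esub> \<noteq> \<zero>\<^bsub>C\<^esub>"
  proof
    assume eq: "\<one>\<^bsub>C\<^esub> = \<zero>\<^bsub>C\<^esub>"
    have "pull 1 = pull 0"
      using k_alg_hom_zero[OF pull_hom F_stage_algebra C_algebra] k_alg_homD(5)[OF pull_hom] eq by simp
    then have "(1::'f) = 0" using emb_pull[of 1] emb_pull[of 0] subalgD(1,2)[OF subalg_gen] by metis
    then show False by simp
  qed
  show "W l = X l" if "l \<in> {1..j-1}" for l by (rule W_eq_X[OF that])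
  fix i assume i: "i \<in> {1..N}"
  show "ore_extension (stage C W (i - 1)) (stage C W i) (W i) (if i \<le> j - 1 then \<sigma> i else \<rho> i)
      (if i \<le> j - 1 then \<delta> i else (\<lambda>_. \<zero>\<^bsub>C\<^esub>))"
  proof (cases "i \<le> j - 1")
    case True
    then show ?thesis using ore_C_lt[of i] i by simp
  next
    case False
    then show ?thesis using ore_C_ge[of i] i by simp
  qed
qed

section \<open>The automorphisms of the new algebra and the higher derivations\<close>

lemma rho_iso: "i \<in> {j..N} \<Longrightarrow> \<rho> i \<in> k_alg_iso (stage C W (i - 1)) (stage C W (i - 1))"
  using ore_C_ge by (simp add: ore_extension_def)

lemma rho_W:
  assumes "i \<in> {j..N}" "l \<in> {1..i-1}"
  shows "\<rho> i (W l) = \<Lambda> i l \<odot>\<^bsub>C\<^esub> W l"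
proof -
  have l: "y l \<in> gen (y ` {1..N})" by (intro y_in_gen in_range_N(4)[OF in_range_N(2)[OF assms(1)] assms(2)])
  have "\<rho> i (W l) = pull (sc (\<Lambda> i l) (y l))"
    by (simp only: \<rho>_def W_def emb_pull[OF l] conjugate_y[OF assms])
  then show ?thesis using k_alg_homD(6)[OF pull_hom, of "y l"] l by (simp add: W_def)
qed

text \<open>The automorphism that the old algebra attaches to step i, seen on \<open>R\<close>; at i
  = j it comes from an extension that still has a derivation. Its relations with the higher
  derivations are given, and those of \<open>\<rho> i\<close> are read off from it.\<close>

definition \<eta> :: "nat \<Rightarrow> 'a \<Rightarrow> 'a" where
  "\<eta> i = (if i = j then \<sigma> j else \<tau> i)"

lemma eta_hom:
  assumes "i \<in> {j..N}"
  shows "\<eta> i \<in> k_alg_hom R B"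
proof (cases "i = j")
  case True
  then show ?thesis
    using k_alg_hom_comp[OF k_alg_isoD(1)[OF sigma_j] k_subalgebraD(3)[OF R_sub_B]] by (simp add: \<eta>_def)
next
  case False
  then have i: "i \<in> {1..N}" "i - 1 \<le> N" "j - 1 \<le> i - 1" "\<not> i \<le> j"
    using in_range_N(2)[OF assms] pred_le assms by auto
  have "\<tau> i \<in> k_alg_iso (stage B Z (i - 1)) (stage B Z (i - 1))"
    using ore_B[OF i(1)] i(4) by (simp add: ore_extension_def)
  from k_alg_hom_comp[OF k_alg_isoD(1)[OF this] k_subalgebraD(3)[OF stage_B_sub[OF i(2)]]]
  have "\<tau> i \<in> k_alg_hom (stage B Z (i - 1)) B" by simp
  moreover have "k_subalgebra R (stage B Z (i - 1))"
  proof (rule k_subalgebra_of_subset[OF R_sub_B stage_B_sub[OF i(2)]])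
    have "carrier R = carrier (stage B Z (j - 1))" by (rule stage_B_eq[symmetric]) simp
    also have "\<dots> \<subseteq> carrier (stage B Z (i - 1))"
      using i(3) by (intro k_subalgebraD(4)[OF alg_gen_mono_subalgebra[OF B_algebra Z_image[OF i(2)]]] image_mono) auto
    finally show "carrier R \<subseteq> carrier (stage B Z (i - 1))" .
  qed
  ultimately show ?thesis using False k_alg_hom_restrict by (simp add: \<eta>_def)
qed

lemma eta_X:
  assumes "i \<in> {j..N}" "l \<in> {1..j-1}"
  shows "\<eta> i (X l) = \<Lambda> i l \<odot>\<^bsub>R\<^esub> X l"
proof (cases "i = j")
  case True
  then show ?thesis using sigma_X[of j l] assms(2) by (auto simp: \<eta>_def)
next
  case False
  then have "\<tau> i (Z l) = \<Lambda> i l \<odot>\<^bsub>B\<^esub> Z l" using assms by (intro eig) auto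
  moreover have "Z l = X l" using assms(2) by (intro Z_eq_X) auto
  ultimately show ?thesis
    using False by (simp only: \<eta>_def if_False k_subalgebraD(9)[OF R_sub_B X_in_R[OF assms(2)]])
qed

text \<open>Each \<open>X l\<close> with l < j is an eigenvector of \<open>\<eta> i\<close>, so
  every stage below j is invariant. This matters because the rules for \<open>d l n\<close> are
  confined to stage l - 1.\<close>

lemma eta_stage:
  assumes "i \<in> {j..N}" "m \<le> j - 1"
  shows "\<eta> i ` carrier (stage A X m) \<subseteq> carrier (stage A X m)"
proof -
  have X: "X ` {1..m} \<subseteq> carrier R" by (rule X_in_stage_R[OF assms(2)])
  have m: "carrier (alg_gen B (X ` {1..m})) = carrier (stage A X m)"
    using alg_gen_of_subalgebra[OF R_sub_B X] by (simp only: alg_gen_R[OF assms(2)])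
  have "m \<le> N" using assms(2) j_bounds(4) by (rule le_trans)
  then have A_m: "k_algebra (stage A X m)"
    by (intro k_subalgebraD(1)[OF alg_gen_subalgebra[OF A_algebra X_image]])
  have "\<eta> i ` carrier (alg_gen R (X ` {1..m})) \<subseteq> carrier (alg_gen B (X ` {1..m}))"
  proof (rule k_alg_hom_alg_gen_subset[OF eta_hom[OF assms(1)] k_subalgebraD(1)[OF R_sub_B] B_algebra X])
    show "\<eta> i ` X ` {1..m} \<subseteq> carrier (alg_gen B (X ` {1..m}))"
      unfolding m
    proof clarify
      fix l assume l: "l \<in> {1..m}"
      then have "X l \<in> carrier (stage A X m)" using alg_gen_incl[of "X ` {1..m}" A] by blast
      then have "\<Lambda> i l \<odot>\<^bsub>stage A X m\<^esub> X l \<in> carrier (stage A X m)" by (rule k_algebraD(3)[OF A_m])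
      moreover have "l \<in> {1..j-1}" using l assms(2) by auto
      ultimately show "\<eta> i (X l) \<in> carrier (stage A X m)" by (simp add: eta_X[OF assms(1)])
    qed
  qed
  then show ?thesis by (simp only: m alg_gen_R[OF assms(2)])
qed

text \<open>Both maps scale \<open>X l\<close> by \<open>\<Lambda> i l\<close>. They come from
  \<open>C\<close> and \<open>B\<close>, whose products differ in general; both products restrict to
  that of \<open>R\<close>, so the maps can be compared as homomorphisms from \<open>R\<close> to
  \<open>C\<close>.\<close>

lemma rho_eq_eta:
  assumes "i \<in> {j..N}" "r \<in> carrier R"
  shows "\<rho> i r = \<eta> i r"
proof (rule k_alg_hom_eqI[where f = "\<rho> i" and g = "\<eta> i" and A = R and B = C and G = "X ` {1..j-1}"])
  have i: "i - 1 \<le> N" "j - 1 \<le> i - 1" using in_range_N(2)[OF assms(1)] pred_le assms(1) by auto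
  have "k_subalgebra R (stage C W (i - 1))"
  proof (rule k_subalgebra_of_subset[OF R_sub_C stage_C_sub[OF i(1)]])
    have "carrier R = carrier (stage C W (j - 1))" by (rule carrier_stage_C_lt[symmetric]) simp
    also have "\<dots> \<subseteq> carrier (stage C W (i - 1))"
      using i(2) by (intro k_subalgebraD(4)[OF alg_gen_mono_subalgebra[OF C_algebra W_carrier[OF i(1)]]] image_mono) auto
    finally show "carrier R \<subseteq> carrier (stage C W (i - 1))" .
  qed
  then have "\<rho> i \<in> k_alg_hom R (stage C W (i - 1))"
    by (rule k_alg_hom_restrict[OF k_alg_isoD(1)[OF rho_iso[OF assms(1)]]])
  from k_alg_hom_comp[OF this k_subalgebraD(3)[OF stage_C_sub[OF i(1)]]]
  show "\<rho> i \<in> k_alg_hom R C" by simp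
  have "\<eta> i \<in> k_alg_hom R R"
    by (rule k_alg_hom_corestrict[OF eta_hom[OF assms(1)] R_sub_B eta_stage[OF assms(1)]]) simp
  from k_alg_hom_comp[OF this k_subalgebraD(3)[OF R_sub_C]]
  show "\<eta> i \<in> k_alg_hom R C" by simp
  show "k_algebra R" by (rule k_subalgebraD(1)[OF R_sub_C])
  show "X ` {1..j-1} \<subseteq> carrier R" by (rule X_in_stage_R) simp
  show "r \<in> carrier (alg_gen R (X ` {1..j-1}))" using assms(2) alg_gen_R[of "j - 1"] by simp
  fix a assume "a \<in> X ` {1..j-1}"
  then obtain l where l: "a = X l" "l \<in> {1..j-1}" by blast
  have "\<rho> i (W l) = \<Lambda> i l \<odot>\<^bsub>C\<^esub> W l" using l(2) i(2) by (intro rho_W[OF assms(1)]) auto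
  then show "\<rho> i a = \<eta> i a"
    by (simp only: W_eq_X[OF l(2)] l(1) eta_X[OF assms(1) l(2)] k_subalgebraD(9)[OF R_sub_C X_in_R[OF l(2)]])
qed

text \<open>All values involved stay in \<open>R\<close>, where \<open>\<rho> i\<close> is
  \<open>\<eta> i\<close>. The relation is then the one in the definition of a quantum nilpotent
  algebra for i = j, and hypothesis (b) for i > j.\<close>

lemma rho_d:
  assumes i: "i \<in> {j..N}" and l: "l \<in> {2..j-1}" and a: "a \<in> carrier (stage A X (l - 1))"
  shows "\<rho> i (d l n a) = \<Lambda> i l ^ n \<odot>\<^bsub>C\<^esub> d l n (\<rho> i a)"
proof -
  have l': "l - 1 \<le> j - 1" "l \<in> {2..N}" "l \<in> {2..j}" "j \<in> {l+1..N}"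
    using l in_range_N(1)[of l] by auto
  have sub: "carrier (stage A X (l - 1)) \<subseteq> carrier R"
    by (rule k_subalgebraD(4)[OF stage_A_sub]) (use l' in auto)
  have d: "d l n b \<in> carrier (stage A X (l - 1))" if "b \<in> carrier (stage A X (l - 1))" for b
    using higher[OF l'(2)] that unfolding higher_skew_derivation_def k_linear_on_def by blast
  have \<eta>a: "\<eta> i a \<in> carrier (stage A X (l - 1))" using eta_stage[OF i l'(1)] a by blast
  then have "d l n (\<eta> i a) \<in> carrier R" using d sub by blast
  \<comment> \<open>On \<open>R\<close> the scalings of \<open>B\<close> and of \<open>C\<close> are
    both that of \<open>R\<close>, so a relation found in \<open>B\<close> can be read in
    \<open>C\<close>.\<close>
  note smult = k_subalgebraD(9)[OF R_sub_B this] k_subalgebraD(9)[OF R_sub_C this]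
  have "\<rho> i (d l n a) = \<eta> i (d l n a)" using rho_eq_eta[OF i] d[OF a] sub by blast
  also have "\<dots> = \<Lambda> i l ^ n \<odot>\<^bsub>R\<^esub> d l n (\<eta> i a)"
  proof (cases "i = j")
    case True
    then show ?thesis using comm_A[OF l'(2,4) a] by (simp add: \<eta>_def)
  next
    case False
    then have "\<tau> i (d l n a) = \<Lambda> i l ^ n \<odot>\<^bsub>B\<^esub> d l n (\<tau> i a)"
      using i by (intro comm[OF _ l'(3) a]) auto
    then show ?thesis using False smult(1) by (simp add: \<eta>_def del: alg_gen_simps)
  qed
  also have "\<dots> = \<Lambda> i l ^ n \<odot>\<^bsub>C\<^esub> d l n (\<rho> i a)"
    using smult(2) rho_eq_eta[OF i subsetD[OF sub a]] by (simp only:)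
  finally show ?thesis .
qed

lemma deletion_step_algebra:
  "\<exists>(C :: ('k, 'a) module) W \<rho>.
        skew_tail_extension N A X \<sigma> \<delta> (j - 1) C W \<rho> \<and>
        (\<exists>\<phi> \<in> k_alg_iso (stage (ambient sc) y N) C. \<forall>l\<in>{1..N}. \<phi> (y l) = W l) \<and>
        (\<forall>i\<in>{j..N}. \<rho> i \<in> k_alg_iso (stage C W (i - 1)) (stage C W (i - 1)) \<and>
          (\<forall>l\<in>{1..i-1}. \<rho> i (W l) = \<Lambda> i l \<odot>\<^bsub>C\<^esub> W l) \<and>
          (\<forall>l\<in>{2..j-1}. \<forall>n. \<forall>a\<in>carrier (stage A X (l - 1)).
             \<rho> i (d l n a) = \<Lambda> i l ^ n \<odot>\<^bsub>C\<^esub> d l n (\<rho> i a)))"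
proof (rule exI[of _ C], rule exI[of _ W], rule exI[of _ \<rho>], intro conjI ballI allI)
  show "\<exists>\<phi> \<in> k_alg_iso (stage (ambient sc) y N) C. \<forall>l\<in>{1..N}. \<phi> (y l) = W l"
    using pull_iso by (intro bexI[of _ pull]) (simp_all add: W_def)
qed (rule skew_tail_C rho_iso rho_W rho_d; assumption)+

lemma deletion_step_localization:
  defines "S \<equiv> {x j ^ n | n. True}"
  shows "ore_set (stage (ambient sc) x N) S" "ore_set (stage (ambient sc) y N) S"
    "right_fractions (stage (ambient sc) y N) S = right_fractions (stage (ambient sc) x N) S"
proof -
  \<comment> \<open>With all later variables in the tail, \<open>T.before\<close> and
    \<open>T.after\<close> are the full algebras.\<close>
  interpret T: deletion_tail sc H "tr (\<sigma> j)" "tr s" "\<lambda>n. tr (d j n)" "q j" "x j" "x ` {j+1..N}"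
    by (rule deletion_tail) simp
  have x: "gen (x ` {1..N}) = T.before" and y: "gen (y ` {1..N}) = T.after"
    by (simp_all only: gen_x gen_y j_bounds T.before_def T.after_def)
  show "ore_set (stage (ambient sc) x N) S" unfolding S_def
    by (rule ore_set_powers; (unfold x)?)
       (use T.x_before x_nonzero T.before_right_ore T.before_left_ore in blast)+
  show "ore_set (stage (ambient sc) y N) S" unfolding S_def
    by (rule ore_set_powers; (unfold y)?)
       (use T.x_after x_nonzero T.after_right_ore T.after_left_ore in blast)+
  show "right_fractions (stage (ambient sc) y N) S = right_fractions (stage (ambient sc) x N) S"
    using right_fractions_powers[of "x j" "x ` {1..N}"] right_fractions_powers[of "x j" "y ` {1..N}"]
    by (simp add: S_def x y T.x_before T.x_after x_nonzero T.denom_powers_eq)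
qed

end

theorem theorem2p3:
  fixes N j :: nat
    and A B :: "('k::field, 'a) module"
    and X Z :: "nat \<Rightarrow> 'a"
    and \<sigma> \<delta> \<tau> :: "nat \<Rightarrow> 'a \<Rightarrow> 'a"
    and d :: "nat \<Rightarrow> nat \<Rightarrow> 'a \<Rightarrow> 'a"
    and \<Lambda> :: "nat \<Rightarrow> nat \<Rightarrow> 'k"
    and q :: "nat \<Rightarrow> 'k"
    and sc :: "'k \<Rightarrow> 'f::division_ring \<Rightarrow> 'f"
    and \<iota> :: "'a \<Rightarrow> 'f"
    and x y :: "nat \<Rightarrow> 'f"
    and S :: "'f set"
  assumes qna: "quantum_nilpotent_algebra N A X \<sigma> \<delta> \<Lambda> q d"
    and frac: "frac_embedding A sc \<iota>"
    and j: "j \<in> {2..N}"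
    and x: "x = deletion_seq A X \<sigma> q d sc \<iota> N (j + 1)"
    \<comment> \<open>(a)\<close>
    and B: "skew_tail_extension N A X \<sigma> \<delta> j B Z \<tau>"
    and iso: "\<exists>\<phi> \<in> k_alg_iso (stage (ambient sc) x N) B. \<forall>i\<in>{1..N}. \<phi> (x i) = Z i"
    \<comment> \<open>(b)\<close>
    and aut: "\<forall>i\<in>{j+1..N}. \<tau> i \<in> k_alg_iso (stage B Z (i - 1)) (stage B Z (i - 1))"
    and eig: "\<forall>i\<in>{j+1..N}. \<forall>l\<in>{1..i-1}. \<tau> i (Z l) = \<Lambda> i l \<odot>\<^bsub>B\<^esub> Z l"
    and comm: "\<forall>i\<in>{j+1..N}. \<forall>l\<in>{2..j}. \<forall>n. \<forall>a\<in>carrier (stage A X (l - 1)).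
                 \<tau> i (d l n a) = \<Lambda> i l ^ n \<odot>\<^bsub>B\<^esub> d l n (\<tau> i a)"
    and y: "y = deletion_step A X \<sigma> q d sc j x"
    and S: "S = {x j ^ n | n. True}"
  shows
    \<comment> \<open>(I) and (II)\<close>
    "(\<exists>(C :: ('k, 'a) module) W \<rho>.
        skew_tail_extension N A X \<sigma> \<delta> (j - 1) C W \<rho> \<and>
        (\<exists>\<phi> \<in> k_alg_iso (stage (ambient sc) y N) C. \<forall>l\<in>{1..N}. \<phi> (y l) = W l) \<and>
        (\<forall>i\<in>{j..N}. \<rho> i \<in> k_alg_iso (stage C W (i - 1)) (stage C W (i - 1)) \<and>
          (\<forall>l\<in>{1..i-1}. \<rho> i (W l) = \<Lambda> i l \<odot>\<^bsub>C\<^esub> W l) \<and>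
          (\<forall>l\<in>{2..j-1}. \<forall>n. \<forall>a\<in>carrier (stage A X (l - 1)).
             \<rho> i (d l n a) = \<Lambda> i l ^ n \<odot>\<^bsub>C\<^esub> d l n (\<rho> i a))))
     \<and> \<comment> \<open>(III)\<close>
     S = {y j ^ n | n. True} \<and>
     ore_set (stage (ambient sc) x N) S \<and>
     ore_set (stage (ambient sc) y N) S \<and>
     right_fractions (stage (ambient sc) y N) S = right_fractions (stage (ambient sc) x N) S"
proof -
  have algebra: "k_algebra (ambient sc)" using frac by (simp add: frac_embedding_def)
  obtain \<phi> where \<phi>: "\<phi> \<in> k_alg_iso (stage (ambient sc) x N) B" "\<And>i. i \<in> {1..N} \<Longrightarrow> \<phi> (x i) = Z i"
    using iso by blast
  interpret deletion_data sc N j A B X Z \<sigma> \<delta> \<tau> d \<Lambda> q x \<phi>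
    using algebra qna j B \<phi> eig comm by unfold_locales blast+
  have y_eq: "y = deletion_data.y sc j A X \<sigma> d q x"
    using y y_def by simp
  have "S = {y j ^ n | n. True}" by (simp add: S y_eq y_ge)
  then show ?thesis
    using deletion_step_algebra deletion_step_localization unfolding S y_eq by blast
qed

end
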